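(* (1) For every $\gamma\in S_\infty$ and every positive integer $t$, $$r_t(\mathfrak G_\gamma(X))=\sum_v(-1)^{\ell(\gamma)-\ell(\mathrm{label}(v))}\mathfrak G_{\mathrm{label}(v)}(X),$$ the sum over all leaves $v$ of $K\mathcal T_t(\gamma)$ with $\mathrm{label}(v)\ne\emptyset$. (2) If $\sigma\in S_n$ has last descent $\le t$ and $\alpha\in S_n$ is arbitrary, then $$\mathfrak G_\sigma(X)\,r_t(\mathfrak G_{\mathrm{id}\star_n\alpha}(X))=\sum_v(-1)^{\ell(\sigma)+\ell(\alpha)-\ell(\mathrm{label}(v))}\mathfrak G_{\mathrm{label}(v)}(X),$$ the sum over all leaves $v$ of $K\mathcal T_t(\sigma\star_n\alpha)$ with $\mathrm{label}(v)\ne\emptyset$.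
   Context: $X=\{x_1,x_2,\dots\}$ are commuting variables; the truncation $r_t:\mathbb Z[X]\to\mathbb Z[X]$ is the ring homomorphism $f(X)\mapsto f(x_1,\dots,x_t,0,0,\dots)$. $\mathfrak G_w(X)$, $w\in S_\infty$, are the Grothendieck polynomials: for $w\in S_N$, $\mathfrak G_{w_0}=x_1^{N-1}x_2^{N-2}\cdots x_{N-1}$ for the longest $w_0\in S_N$ and $\mathfrak G_{ws_i}=\pi_i\mathfrak G_w$ whenever $\ell(ws_i)<\ell(w)$, where $\pi_i f=\frac{(1-x_{i+1})f-(1-x_i)f|_{x_i\leftrightarrow x_{i+1}}}{x_i-x_{i+1}}$ (independent of $N$; e.g. $\mathfrak G_{\mathrm{id}}=1$, $\mathfrak G_{s_1}=x_1$). Permutations: $\ell(w)$ is the number of inversions; the last descent of $\pi$ is the largest $l$ with $\pi(l)>\pi(l+1)$ ($0$ for the identity). For $\sigma,\alpha\in S_n$, $\sigma\star_n\alpha\in S_{2n}$ is given by $(\sigma\star_n\alpha)(i)=\sigma(i)$ for $i\le n$ and $n+\alpha(i-n)$ for $i>n$. Diagrams: $G(\pi)$ has dots at $(i,\pi(i))$ (row, column; rows increase southward, columns eastward). $D(\pi)=\{(p,q):\pi(p)>q,\ \pi^{-1}(q)>p\}$, the cells covered by no hook (a dot together with the cells east of it in its row and south of it in its column). The maximal corner $(l,m)$ is the southernmost, then eastmost, box of $D(\pi)$. A pivot is a dot strictly northwest of $(l,m)$ that is maximally southeast among such dots. Marching: with no pivots the output is $\emptyset$. Otherwise for a pivot $(i,j)$,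 remove its hook and move strictly northwest every diagram box in the rectangle with corners $(i,j),(l,m)$ into the only spaces available (hopping over hooks in the way), processing boxes from the northwest box of the rectangle, left to right along rows, top to bottom; the result is $D(\rho)$ for a permutation $\rho$, written $\pi\xrightarrow{i}\rho$. $K$-marching: for pivot rows $i_1<\dots<i_k$ ($k\ge1$): $\pi\xrightarrow{i_1}\rho_1$, add a box at $(l,\rho_1(l))$ to get $D(\rho_1')$ (this box is the maximal corner of $\rho_1'$ and the dot in row $i_2$ is a pivot), then $\rho_1'\xrightarrow{i_2}\rho_2$, and so on, ending at $\rho=\rho_k$; write $\pi\xrightarrow{i_1,\dots,i_k}\rho$. No pivots gives $\emptyset$. Tree $K\mathcal T_t(\beta)$: root labeled $\beta$; a vertex labeled $\emptyset$ or by a permutation with last descent $\le t$ is a leaf; otherwise its children are labeled by the outputs of all $K$-marchings from it (one for each nonempty set of pivot rows; a single child $\emptyset$ if there are no pivots). *)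

theory Defs
  imports "HOL-Library.Poly_Mapping" "HOL-Combinatorics.Permutations"
begin

text \<open>
  The ring \<open>\<int>[x\<^sub>1, x\<^sub>2, \<dots>]\<close>: finitely supported maps from monomials (finitely supported exponent
  functions) to coefficients. Rows, columns, values and variables are indexed from 1; the
  index 0 exists in the type but is never used.
\<close>

type_synonym mpoly = "(nat \<Rightarrow>\<^sub>0 nat) \<Rightarrow>\<^sub>0 int"

definition X :: "nat \<Rightarrow> mpoly" where
  "X i = Poly_Mapping.single (Poly_Mapping.single i 1) 1"

definition subst :: "(nat \<Rightarrow> mpoly) \<Rightarrow> mpoly \<Rightarrow> mpoly" where
  "subst g f = (\<Sum>m\<in>Poly_Mapping.keys f. of_int (Poly_Mapping.lookup f m) *
     (\<Prod>i\<in>Poly_Mapping.keys m. g i ^ Poly_Mapping.lookup m i))"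

definition trunc :: "nat \<Rightarrow> mpoly \<Rightarrow> mpoly" where
  "trunc t = subst (\<lambda>i. if 1 \<le> i \<and> i \<le> t then X i else 0)"

definition swap_vars :: "nat \<Rightarrow> mpoly \<Rightarrow> mpoly" where
  "swap_vars i = subst (\<lambda>k. X (Transposition.transpose i (i + 1) k))"

text \<open>The quotient by \<open>x\<^sub>i - x\<^sub>i\<^sub>+\<^sub>1\<close> is exact in the polynomial ring.\<close>

definition demazure :: "nat \<Rightarrow> mpoly \<Rightarrow> mpoly" where
  "demazure i f = (THE g. (X i - X (i + 1)) * g =
     (1 - X (i + 1)) * f - (1 - X i) * swap_vars i f)"


definition S :: "nat \<Rightarrow> (nat \<Rightarrow> nat) set" where
  "S n = {w. w permutes {1..n}}"

definition S_inf :: "(nat \<Rightarrow> nat) set" where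
  "S_inf = (\<Union>n. S n)"

definition len :: "(nat \<Rightarrow> nat) \<Rightarrow> nat" where
  "len w = card {(i, j). 1 \<le> i \<and> i < j \<and> w i > w j}"

definition last_descent :: "(nat \<Rightarrow> nat) \<Rightarrow> nat" where
  "last_descent w = Max (insert 0 {l. 1 \<le> l \<and> w l > w (l + 1)})"

definition star :: "nat \<Rightarrow> (nat \<Rightarrow> nat) \<Rightarrow> (nat \<Rightarrow> nat) \<Rightarrow> nat \<Rightarrow> nat" where
  "star n \<sigma> \<alpha> i = (if i \<le> n then \<sigma> i else n + \<alpha> (i - n))"

definition longest :: "nat \<Rightarrow> nat \<Rightarrow> nat" where
  "longest N i = (if 1 \<le> i \<and> i \<le> N then N + 1 - i else i)"


text \<open>
  \<open>groth_rel N w f\<close>: \<open>f\<close> is obtained for \<open>w \<in> S N\<close> by descending from the longest element of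
  \<open>S N\<close>. The result depends neither on the chosen descents nor on \<open>N\<close>.
\<close>

inductive groth_rel :: "nat \<Rightarrow> (nat \<Rightarrow> nat) \<Rightarrow> mpoly \<Rightarrow> bool" for N :: nat where
  longest: "groth_rel N (longest N) (\<Prod>i=1..N. X i ^ (N - i))"
| descend: "\<lbrakk>groth_rel N w f; 1 \<le> i; i < N;
    len (w \<circ> Transposition.transpose i (i + 1)) < len w\<rbrakk>
    \<Longrightarrow> groth_rel N (w \<circ> Transposition.transpose i (i + 1)) (demazure i f)"

definition Groth :: "(nat \<Rightarrow> nat) \<Rightarrow> mpoly" where
  "Groth w = (THE f. \<exists>N. groth_rel N w f)"


text \<open>Cells are pairs (row, column), as in matrices.\<close>

definition diagram :: "(nat \<Rightarrow> nat) \<Rightarrow> (nat \<times> nat) set" where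
  "diagram \<pi> = {(p, q). 1 \<le> p \<and> 1 \<le> q \<and> \<pi> p > q \<and> inv \<pi> q > p}"

definition hook :: "nat \<times> nat \<Rightarrow> (nat \<times> nat) set" where
  "hook d = {(p, q). (p = fst d \<and> snd d \<le> q) \<or> (q = snd d \<and> fst d \<le> p)}"

definition corner_row :: "(nat \<Rightarrow> nat) \<Rightarrow> nat" where
  "corner_row \<pi> = Max (fst ` diagram \<pi>)"

definition corner_col :: "(nat \<Rightarrow> nat) \<Rightarrow> nat" where
  "corner_col \<pi> = Max {q. (corner_row \<pi>, q) \<in> diagram \<pi>}"

definition nw_dot_rows :: "(nat \<Rightarrow> nat) \<Rightarrow> nat set" where
  "nw_dot_rows \<pi> = {i. 1 \<le> i \<and> i < corner_row \<pi> \<and> \<pi> i < corner_col \<pi>}"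

definition pivot_rows :: "(nat \<Rightarrow> nat) \<Rightarrow> nat set" where
  "pivot_rows \<pi> = {i \<in> nw_dot_rows \<pi>. \<not> (\<exists>i' \<in> nw_dot_rows \<pi>. i < i' \<and> \<pi> i < \<pi> i')}"

definition perm_of_diagram :: "(nat \<times> nat) set \<Rightarrow> nat \<Rightarrow> nat" where
  "perm_of_diagram B = (THE \<rho>. \<rho> \<in> S_inf \<and> diagram \<rho> = B)"

text \<open>
  \<open>H\<close> is the set of cells covered by hooks and \<open>B\<close> the current set of boxes: the box \<open>b\<close> moves
  to the only cell strictly northwest of it that is neither covered nor occupied.
\<close>

definition move_box :: "(nat \<times> nat) set \<Rightarrow> nat \<times> nat \<Rightarrow> (nat \<times> nat) set \<Rightarrow> (nat \<times> nat) set" where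
  "move_box H b B = insert
     (THE c. 1 \<le> fst c \<and> fst c < fst b \<and> 1 \<le> snd c \<and> snd c < snd b \<and> c \<notin> H \<and> c \<notin> B)
     (B - {b})"

definition rect_boxes :: "(nat \<Rightarrow> nat) \<Rightarrow> nat \<Rightarrow> (nat \<times> nat) list" where
  "rect_boxes \<pi> i = filter (\<lambda>b. b \<in> diagram \<pi>)
     (List.product [i..<Suc (corner_row \<pi>)] [\<pi> i..<Suc (corner_col \<pi>)])"

definition march :: "(nat \<Rightarrow> nat) \<Rightarrow> nat \<Rightarrow> nat \<Rightarrow> nat" where
  "march \<pi> i = perm_of_diagram
     (fold (move_box (\<Union>p\<in>{1..} - {i}. hook (p, \<pi> p))) (rect_boxes \<pi> i) (diagram \<pi>))"

text \<open>\<open>l\<close> is the row of the maximal corner of the permutation the process starts from.\<close>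

fun K_march_list :: "nat \<Rightarrow> (nat \<Rightarrow> nat) \<Rightarrow> nat list \<Rightarrow> nat \<Rightarrow> nat" where
  "K_march_list l \<pi> [] = \<pi>"
| "K_march_list l \<pi> [i] = march \<pi> i"
| "K_march_list l \<pi> (i # i' # is) =
     (let \<rho> = march \<pi> i
      in K_march_list l (perm_of_diagram (insert (l, \<rho> l) (diagram \<rho>))) (i' # is))"

definition K_march :: "(nat \<Rightarrow> nat) \<Rightarrow> nat set \<Rightarrow> nat \<Rightarrow> nat" where
  "K_march \<pi> I = K_march_list (corner_row \<pi>) \<pi> (sorted_list_of_set I)"


text \<open>
  \<open>KT_vertex t \<beta> \<nu> a\<close>: the tree has a vertex with label \<open>a\<close> at address \<open>\<nu>\<close>, where \<open>None\<close> is the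
  label \<open>\<emptyset>\<close>. The address lists the sets of pivot rows used on the way from the root, so that
  distinct vertices carrying the same label are kept apart; the child of a vertex without
  pivots has the empty set as last entry of its address.
\<close>

inductive KT_vertex ::
  "nat \<Rightarrow> (nat \<Rightarrow> nat) \<Rightarrow> nat set list \<Rightarrow> (nat \<Rightarrow> nat) option \<Rightarrow> bool"
  for t :: nat and \<beta> :: "nat \<Rightarrow> nat" where
  root: "KT_vertex t \<beta> [] (Some \<beta>)"
| march: "\<lbrakk>KT_vertex t \<beta> \<nu> (Some \<pi>); t < last_descent \<pi>; I \<noteq> {}; I \<subseteq> pivot_rows \<pi>\<rbrakk>
    \<Longrightarrow> KT_vertex t \<beta> (\<nu> @ [I]) (Some (K_march \<pi> I))"
| no_pivots: "\<lbrakk>KT_vertex t \<beta> \<nu> (Some \<pi>); t < last_descent \<pi>; pivot_rows \<pi> = {}\<rbrakk>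
    \<Longrightarrow> KT_vertex t \<beta> (\<nu> @ [{}]) None"

definition KT_leaves ::
  "nat \<Rightarrow> (nat \<Rightarrow> nat) \<Rightarrow> (nat set list \<times> (nat \<Rightarrow> nat) option) set" where
  "KT_leaves t \<beta> = {(\<nu>, a). KT_vertex t \<beta> \<nu> a \<and> (\<forall>\<pi>. a = Some \<pi> \<longrightarrow> last_descent \<pi> \<le> t)}"

abbreviation label :: "nat set list \<times> (nat \<Rightarrow> nat) option \<Rightarrow> nat \<Rightarrow> nat" where
  "label v \<equiv> the (snd v)"

text \<open>The exponents in question are negative in general: marching never decreases the length.\<close>

definition neg_one_power :: "int \<Rightarrow> mpoly" where
  "neg_one_power k = (- 1) ^ nat \<bar>k\<bar>"

end

theory Submission
  imports Defs
begin

text \<open>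
  Let \<open>l\<close> be the last descent of \<open>\<pi>\<close>, let \<open>k\<close> be the last position with \<open>\<pi> k < \<pi> l\<close>, and let
  \<open>v = \<pi> t\<^sub>l\<^sub>k\<close>. Lascoux's transition formula reads
  \<open>\<GG>\<^sub>\<pi> = \<GG>\<^sub>v - (1 - x\<^sub>l) \<Sum>\<^sub>I (-1)\<^bsup>|I|\<^esup> \<GG>\<^sub>v\<^sub>I\<close>, where \<open>I\<close> runs over all sets of pivot rows
  \<open>i\<^sub>1 < \<dots> < i\<^sub>r\<close> and \<open>vI = v t\<^bsub>i\<^sub>1 l\<^esub> \<cdots> t\<^bsub>i\<^sub>r l\<^esub>\<close>. Setting \<open>x\<^sub>l = 0\<close> cancels \<open>\<GG>\<^sub>v\<close> and leaves the
  nonempty \<open>I\<close>, and \<open>vI\<close> is exactly the result of \<open>K\<close>-marching along \<open>I\<close>; iterating until the last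
  descent is at most \<open>t\<close> gives the first part.

  Transition is an instance of Lenart's Monk rule: for every \<open>v\<close> and \<open>l\<close>,
  \<open>(1 - x\<^sub>l) \<Sum>\<^sub>I (-1)\<^bsup>|I|\<^esup> \<GG>\<^sub>v\<^sub>I = \<Sum>\<^sub>J (-1)\<^bsup>|J|\<^esup> \<GG>\<^sub>v\<^sub>J\<close>, where \<open>I\<close> and \<open>J\<close> run over the sets of positions to the
  left and to the right of \<open>l\<close> whose transposition with \<open>l\<close> is a Bruhat cover of \<open>v\<close>. It is explicit
  for the longest element and is carried down by the isobaric divided differences.

  For the second part, \<open>\<GG>\<^bsub>\<sigma>\<star>\<alpha>\<^esub>\<close> and \<open>\<GG>\<^sub>\<sigma> \<GG>\<^bsub>id\<star>\<alpha>\<^esub>\<close> satisfy the same transition recursion in \<open>\<sigma>\<close>, hence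
  agree.
\<close>

section \<open>Substitution homomorphisms\<close>

text \<open>Both sides of the Monk rule are kept as products of operators
  \<open>F(v) - F(v t_al)\<close>, one for each position \<open>a\<close>, and are expanded into
  sums over sets only afterwards. A divided difference at \<open>i\<close> then concerns just the
  factors at the positions \<open>i\<close> and \<open>i + 1\<close>: neither is compatible with it
  alone, but their product is. If \<open>l\<close> itself is \<open>i\<close> or
  \<open>i + 1\<close>, the factor \<open>1 - x_l\<close> is not symmetric, and its product rule
  trades the rule for \<open>l\<close> against the one for the neighbouring index; hence all
  \<open>l\<close> are treated in one induction. Marching moves boxes one at a time, with a target
  cell that depends on the boxes moved before. What tames it is that the boxes between pivot and
  corner fill a full grid of rows and columns, which is pushed one step northwest; the outcome for a
  single pivot row \<open>i\<close> is \<open>\<pi> t_lk t_il\<close>. The box inserted between two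
  marches multiplies by some \<open>t_lk'\<close>, and the next march starts by multiplying by the
  same \<open>t_lk'\<close>, so that the two cancel and only the exchanges with \<open>l\<close>
  survive. The signs follow because each transposition flips the parity of the length.\<close>

definition eval_monom :: "(nat \<Rightarrow> mpoly) \<Rightarrow> (nat \<Rightarrow>\<^sub>0 nat) \<Rightarrow> mpoly" where
  "eval_monom g m = (\<Prod>i\<in>Poly_Mapping.keys m. g i ^ Poly_Mapping.lookup m i)"

lemma eval_monom_superset:
  assumes "finite A" "Poly_Mapping.keys m \<subseteq> A"
  shows "eval_monom g m = (\<Prod>i\<in>A. g i ^ Poly_Mapping.lookup m i)"
  unfolding eval_monom_def using assms
  by (intro prod.mono_neutral_left) (auto simp: in_keys_iff)

lemma eval_monom_0 [simp]: "eval_monom g 0 = 1"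
  by (simp add: eval_monom_def)

lemma eval_monom_add: "eval_monom g (m + n) = eval_monom g m * eval_monom g n"
proof -
  let ?A = "Poly_Mapping.keys m \<union> Poly_Mapping.keys n"
  have "eval_monom g (m + n) = (\<Prod>i\<in>?A. g i ^ Poly_Mapping.lookup (m + n) i)"
    by (intro eval_monom_superset) (auto dest: subsetD[OF keys_add])
  also have "\<dots> = eval_monom g m * eval_monom g n"
    by (simp add: eval_monom_superset[of ?A] lookup_add power_add prod.distrib)
  finally show ?thesis .
qed

lemma subst_conv_eval_monom:
  "subst g f = (\<Sum>m\<in>Poly_Mapping.keys f. of_int (Poly_Mapping.lookup f m) * eval_monom g m)"
  by (simp add: subst_def eval_monom_def)

lemma subst_superset:
  assumes "finite A" "Poly_Mapping.keys f \<subseteq> A"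
  shows "subst g f = (\<Sum>m\<in>A. of_int (Poly_Mapping.lookup f m) * eval_monom g m)"
  unfolding subst_conv_eval_monom using assms
  by (intro sum.mono_neutral_left) (auto simp: in_keys_iff)

lemma subst_diff [simp]: "subst g (a - b) = subst g a - subst g b"
proof -
  let ?A = "Poly_Mapping.keys a \<union> Poly_Mapping.keys b"
  have "subst g (a - b) = (\<Sum>m\<in>?A. of_int (Poly_Mapping.lookup (a - b) m) * eval_monom g m)"
    by (intro subst_superset) (auto dest: subsetD[OF keys_diff])
  also have "\<dots> = subst g a - subst g b"
    by (simp add: subst_superset[of ?A] lookup_minus left_diff_distrib sum_subtractf)
  finally show ?thesis .
qed

lemma subst_0 [simp]: "subst g 0 = 0"
  by (simp add: subst_def)

lemma subst_uminus [simp]: "subst g (- a) = - subst g a"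
  using subst_diff[of g 0 a] by simp

lemma subst_add [simp]: "subst g (a + b) = subst g a + subst g b"
  using subst_diff[of g a "- b"] by simp

lemma subst_monom: "subst g (Poly_Mapping.single m 1) = eval_monom g m"
  by (simp add: subst_conv_eval_monom)

lemma subst_1 [simp]: "subst g 1 = 1"
  using subst_monom[of g 0] by simp

lemma subst_X [simp]: "subst g (X i) = g i"
  unfolding X_def subst_monom by (simp add: eval_monom_def)

text \<open>As an additive group the polynomial ring is free on the monomials, so additivity in each
  factor reduces the claim to monomials. \<open>frag_induction\<close> is the induction rule of free
  abelian groups.\<close>

lemma subst_mult [simp]: "subst g (a * b) = subst g a * subst g b"
proof -
  have 1: "subst g (Poly_Mapping.single m 1 * b) = eval_monom g m * subst g b" for m
  proof (induction b rule: frag_induction[OF subset_UNIV])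
    case (2 n)
    then show ?case by (simp add: mult_single subst_monom eval_monom_add)
  qed (simp_all add: right_diff_distrib)
  show ?thesis
  proof (induction a rule: frag_induction[OF subset_UNIV])
    case (2 n)
    then show ?case using 1 by (simp add: subst_monom)
  qed (simp_all add: left_diff_distrib)
qed

lemma subst_power [simp]: "subst g (a ^ n) = subst g a ^ n"
  by (induction n) simp_all

lemma subst_prod [simp]: "subst g (\<Prod>i\<in>A. f i) = (\<Prod>i\<in>A. subst g (f i))"
  by (induction A rule: infinite_finite_induct) simp_all

lemma subst_sum [simp]: "subst g (\<Sum>i\<in>A. f i) = (\<Sum>i\<in>A. subst g (f i))"
  by (induction A rule: infinite_finite_induct) simp_all

section \<open>Induction over the polynomial ring\<close>

lemma monom_induct [case_names one mult]:
  assumes "P 1" and "\<And>f i. P f \<Longrightarrow> P (f * X i)"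
  shows "P (Poly_Mapping.single m 1)"
proof (induction m rule: update_induct)
  case const
  then show ?case using assms(1) by simp
next
  case (update m k v)
  have eq: "Poly_Mapping.update k v m = m + Poly_Mapping.single k v"
    using update(1) by (intro poly_mapping_eqI)
      (auto simp: lookup_update lookup_add lookup_single when_def in_keys_iff)
  have "P (Poly_Mapping.single (m + Poly_Mapping.single k v') 1)" for v'
  proof (induction v')
    case 0
    then show ?case using update by simp
  next
    case (Suc n)
    have "Poly_Mapping.single (m + Poly_Mapping.single k (Suc n)) 1
        = Poly_Mapping.single (m + Poly_Mapping.single k n) 1 * X k"
      unfolding X_def mult_single
      by (simp add: add.assoc single_add[symmetric])
    then show ?case using assms(2)[OF Suc.IH, of k] by simp
  qed
  then show ?case using eq by simp
qed

text \<open>Closure under differences, in place of sums, also yields \<open>0\<close> and negatives.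
  Identities between ring homomorphisms then have to be checked on variables only.\<close>

lemma mpoly_induct [case_names one X diff mult]:
  assumes "P 1" "\<And>i. P (X i)" "\<And>a b. P a \<Longrightarrow> P b \<Longrightarrow> P (a - b)"
    "\<And>a b. P a \<Longrightarrow> P b \<Longrightarrow> P (a * b)"
  shows "P f"
proof (induction f rule: frag_induction[OF subset_UNIV])
  case 1
  then show ?case using assms(3)[OF assms(1,1)] by simp
next
  case (2 n)
  show ?case by (rule monom_induct) (use assms in auto)
qed (use assms in auto)

lemma subst_subst: "subst g (subst h f) = subst (\<lambda>i. subst g (h i)) f"
  by (induction f rule: mpoly_induct) simp_all

lemma subst_ident: "subst X f = f"
  by (induction f rule: mpoly_induct) simp_all

lemma X_inj: "X i = X j \<longleftrightarrow> i = j"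
proof
  assume "X i = X j"
  then have "Poly_Mapping.keys (X i) = Poly_Mapping.keys (X j)" by simp
  then have "Poly_Mapping.single i (1::nat) = Poly_Mapping.single j 1"
    by (simp add: X_def)
  then have "Poly_Mapping.keys (Poly_Mapping.single i (1::nat)) = Poly_Mapping.keys (Poly_Mapping.single j (1::nat))" by simp
  then show "i = j" by simp
qed simp

lemma one_minus_X_neq_0: "1 - X i \<noteq> 0"
proof
  assume "1 - X i = 0"
  then have "subst (\<lambda>_. 0) (1 - X i) = 0" by (simp only: subst_0)
  then show False by simp
qed

section \<open>Exchange of two neighbouring variables\<close>

lemma swap_vars_hom [simp]:
  "swap_vars i (a - b) = swap_vars i a - swap_vars i b"
  "swap_vars i (a + b) = swap_vars i a + swap_vars i b"
  "swap_vars i (a * b) = swap_vars i a * swap_vars i b"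
  "swap_vars i (a ^ n) = swap_vars i a ^ n"
  "swap_vars i 1 = 1" "swap_vars i 0 = 0"
  "swap_vars i (X j) = X (Transposition.transpose i (i + 1) j)"
  by (simp_all add: swap_vars_def)

lemma swap_vars_prod: "swap_vars i (\<Prod>j\<in>A. f j) = (\<Prod>j\<in>A. swap_vars i (f j))"
  by (simp add: swap_vars_def)

lemma swap_vars_invol [simp]: "swap_vars i (swap_vars i f) = f"
  by (simp add: swap_vars_def subst_subst subst_ident)

lemma swap_vars_commute:
  assumes "i + 1 < j \<or> j + 1 < i"
  shows "swap_vars i (swap_vars j f) = swap_vars j (swap_vars i f)"
  by (induction f rule: mpoly_induct)
     (use assms in \<open>auto simp: transpose_def\<close>)

lemma swap_vars_braid:
  "swap_vars i (swap_vars (i+1) (swap_vars i f)) = swap_vars (i+1) (swap_vars i (swap_vars (i+1) f))"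
  by (induction f rule: mpoly_induct) (auto simp: transpose_def)

section \<open>Isobaric divided differences\<close>

lemma X_diff_neq_0: "X i - X (i + 1) \<noteq> 0"
  by (simp add: X_inj)

text \<open>The polynomials with this property form a subring, because
  \<open>ab - s(ab) = (a - sa) b + sa (b - sb)\<close>. It makes the quotient in
  \<open>demazure\<close> exact.\<close>

lemma dvd_diff_swap_vars: "X i - X (i + 1) dvd f - swap_vars i f"
proof (induction f rule: mpoly_induct)
  case (X j)
  consider "j = i" | "j = i + 1" | "j \<noteq> i" "j \<noteq> i + 1" by blast
  then show ?case
  proof cases
    case 2
    have "X (i + 1) - X i = (X i - X (i + 1)) * (- 1)" by simp
    then have "X i - X (i + 1) dvd X (i + 1) - X i" by (rule dvdI)
    then show ?thesis using 2 by simp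
  qed auto
next
  case (diff a b)
  have "a - b - swap_vars i (a - b) = (a - swap_vars i a) - (b - swap_vars i b)" by simp
  then show ?case using diff by (metis dvd_diff)
next
  case (mult a b)
  have "a * b - swap_vars i (a * b) = (a - swap_vars i a) * b + swap_vars i a * (b - swap_vars i b)"
    by (simp add: algebra_simps)
  then show ?case using mult by (metis dvd_add dvd_mult dvd_mult2)
qed simp

text \<open>Multiplication by \<open>x_i - x_(i+1)\<close> is injective, so the description by
  \<open>THE\<close> can be traded for an equation without division. The properties of
  \<open>demazure\<close> below rest on this equation.\<close>

lemma demazure_eq_iff:
  "demazure i f = g \<longleftrightarrow>
    (X i - X (i + 1)) * g = (1 - X (i + 1)) * f - (1 - X i) * swap_vars i f"
proof -
  obtain h where h: "f - swap_vars i f = (X i - X (i + 1)) * h"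
    using dvd_diff_swap_vars by (auto simp: dvd_def)
  \<comment> \<open>The quotient is \<open>f + (1 - x_i) h\<close>, where \<open>h\<close> is the
    ordinary divided difference of \<open>f\<close>.\<close>
  have "(1 - X (i + 1)) * f - (1 - X i) * swap_vars i f
      = (X i - X (i + 1)) * f + (1 - X i) * (f - swap_vars i f)" by (simp add: algebra_simps)
  also have "\<dots> = (X i - X (i + 1)) * (f + (1 - X i) * h)" unfolding h by (simp add: algebra_simps)
  finally have *: "(X i - X (i + 1)) * (f + (1 - X i) * h) =
      (1 - X (i + 1)) * f - (1 - X i) * swap_vars i f" ..
  have "demazure i f = f + (1 - X i) * h"
    unfolding demazure_def
  proof (rule the_equality)
    show "(X i - X (i + 1)) * (f + (1 - X i) * h) = (1 - X (i + 1)) * f - (1 - X i) * swap_vars i f"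
      by (rule *)
  next
    fix g assume "(X i - X (i + 1)) * g = (1 - X (i + 1)) * f - (1 - X i) * swap_vars i f"
    then have "(X i - X (i + 1)) * g = (X i - X (i + 1)) * (f + (1 - X i) * h)" using * by simp
    then show "g = f + (1 - X i) * h" using X_diff_neq_0 mult_left_cancel by blast
  qed
  then show ?thesis using * X_diff_neq_0 mult_left_cancel by metis
qed

lemma demazure_eq:
  "(X i - X (i + 1)) * demazure i f = (1 - X (i + 1)) * f - (1 - X i) * swap_vars i f"
  using demazure_eq_iff by blast

lemma demazure_diff: "demazure i (f - g) = demazure i f - demazure i g"
  unfolding demazure_eq_iff right_diff_distrib demazure_eq by (simp add: algebra_simps)

lemma demazure_0: "demazure i 0 = 0"
  unfolding demazure_eq_iff by simp

lemma demazure_mult_symmetric: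
  assumes "swap_vars i g = g"
  shows "demazure i (g * f) = g * demazure i f"
proof -
  have "(X i - X (i + 1)) * (g * demazure i f) = g * ((X i - X (i + 1)) * demazure i f)"
    by (simp only: ac_simps)
  then show ?thesis unfolding demazure_eq_iff demazure_eq swap_vars_hom assms
    by (simp add: algebra_simps)
qed

lemma demazure_fixed_iff: "demazure i f = f \<longleftrightarrow> swap_vars i f = f"
proof -
  have "demazure i f = f \<longleftrightarrow> (1 - X i) * swap_vars i f = (1 - X i) * f"
    unfolding demazure_eq_iff by (simp add: algebra_simps)
  then show ?thesis using one_minus_X_neq_0 by (metis mult_left_cancel)
qed

lemma swap_vars_demazure: "swap_vars i (demazure i f) = demazure i f"
proof -
  have "swap_vars i ((X i - X (i + 1)) * demazure i f) =
     (1 - X i) * swap_vars i f - (1 - X (i + 1)) * f"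
    unfolding demazure_eq by simp
  then have "(X (i + 1) - X i) * swap_vars i (demazure i f) = (1 - X i) * swap_vars i f - (1 - X (i + 1)) * f"
    by simp
  then have "demazure i f = swap_vars i (demazure i f)"
    unfolding demazure_eq_iff by (simp add: algebra_simps)
  then show ?thesis ..
qed

lemma demazure_idem: "demazure i (demazure i f) = demazure i f"
  using demazure_fixed_iff swap_vars_demazure by blast

text \<open>These product rules cover the two factors \<open>1 - x_l\<close> that \<open>s_i\<close>
  does not fix. They convert a factor for \<open>i\<close> into one for \<open>i + 1\<close> and
  conversely, which moves the Monk rule between neighbouring indices.\<close>

lemma demazure_times_y:
  "demazure i ((1 - X i) * f) = (1 - X (i + 1)) * (demazure i f - f)"
  "demazure i ((1 - X (i + 1)) * f) = (1 - X i) * demazure i f + (1 - X (i + 1)) * f"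
proof -
  have *: "(X i - X (i + 1)) * (p * demazure i f) = p * ((X i - X (i + 1)) * demazure i f)" for p
    by (simp only: ac_simps)
  show "demazure i ((1 - X i) * f) = (1 - X (i + 1)) * (demazure i f - f)"
    unfolding demazure_eq_iff right_diff_distrib[of "1 - X (i + 1)" "demazure i f"]
      right_diff_distrib[of "X i - X (i + 1)" "_ * demazure i f"] * demazure_eq
    by (simp add: algebra_simps)
  show "demazure i ((1 - X (i + 1)) * f) = (1 - X i) * demazure i f + (1 - X (i + 1)) * f"
    unfolding demazure_eq_iff distrib_left[of "X i - X (i + 1)" "_ * demazure i f"] * demazure_eq
    by (simp add: algebra_simps)
qed

lemma swap_vars_demazure_far:
  assumes "i + 1 < j \<or> j + 1 < i"
  shows "swap_vars j (demazure i f) = demazure i (swap_vars j f)"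
proof -
  have "swap_vars j ((X i - X (i + 1)) * demazure i f) = (X i - X (i + 1)) * swap_vars j (demazure i f)"
    using assms by (auto simp: transpose_def)
  moreover have "swap_vars j ((X i - X (i + 1)) * demazure i f) =
     (1 - X (i + 1)) * swap_vars j f - (1 - X i) * swap_vars i (swap_vars j f)"
    unfolding demazure_eq swap_vars_commute[OF assms] using assms by (auto simp: transpose_def)
  ultimately show ?thesis using demazure_eq_iff by metis
qed

text \<open>\<open>demazure j\<close> is linear over polynomials symmetric in \<open>x_j\<close>,
  \<open>x_(j+1)\<close>, and the coefficients in the equation for \<open>demazure i\<close> are of
  this kind.\<close>

lemma demazure_commute:
  assumes "i + 1 < j \<or> j + 1 < i"
  shows "demazure i (demazure j f) = demazure j (demazure i f)"
proof -
  have sym: "swap_vars j (X i - X (i + 1)) = X i - X (i + 1)" "swap_vars j (1 - X i) = 1 - X i"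
    "swap_vars j (1 - X (i + 1)) = 1 - X (i + 1)"
    using assms by (auto simp: transpose_def)
  have far: "swap_vars i (demazure j f) = demazure j (swap_vars i f)"
    by (rule swap_vars_demazure_far) (use assms in auto)
  have "(X i - X (i + 1)) * demazure j (demazure i f) = demazure j ((X i - X (i + 1)) * demazure i f)"
    using demazure_mult_symmetric[OF sym(1)] by simp
  also have "\<dots> = (1 - X (i + 1)) * demazure j f - (1 - X i) * demazure j (swap_vars i f)"
    unfolding demazure_eq demazure_diff using demazure_mult_symmetric sym by simp
  finally show ?thesis unfolding demazure_eq_iff far .
qed

text \<open>Both triple products equal the antisymmetrisation of \<open>b c\<^sup>2 f\<close> over \<open>S\<^sub>3\<close>, divided by the
  Vandermonde product, where \<open>a, b, c\<close> stand for \<open>1 - x\<^sub>i\<close>, \<open>1 - x\<^sub>i\<^sub>+\<^sub>1\<close>, \<open>1 - x\<^sub>i\<^sub>+\<^sub>2\<close>.\<close>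

lemma demazure_braid:
  "demazure i (demazure (i+1) (demazure i f)) = demazure (i+1) (demazure i (demazure (i+1) f))"
proof -
  define a b c where "a = 1 - X i" "b = 1 - X (i+1)" "c = 1 - X (i+2)"
  note abc = this
  define s r where "s = swap_vars i" "r = swap_vars (i+1)"
  note sr = this
  have s: "s (u - v) = s u - s v" "s (u * v) = s u * s v" "s a = b" "s b = a" "s c = c" for u v
    by (simp_all add: sr abc transpose_def)
  have r: "r (u - v) = r u - r v" "r (u * v) = r u * r v" "r a = a" "r b = c" "r c = b" for u v
    by (simp_all add: sr abc transpose_def)
  have di: "(b - a) * demazure i u = b * u - a * s u" for u
    using demazure_eq[of i u] by (simp add: abc sr)
  have dj: "(c - b) * demazure (i+1) u = c * u - b * r u" for u
    using demazure_eq[of "i+1" u] by (simp add: abc sr)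
  have sd: "s (demazure i u) = demazure i u" for u by (simp add: sr swap_vars_demazure)
  have rd: "r (demazure (i+1) u) = demazure (i+1) u" for u
    unfolding sr by (rule swap_vars_demazure)
  have brd: "s (r (s f)) = r (s (r f))" using swap_vars_braid by (simp add: sr)
  define V where "V = (b - a) * (c - a) * (c - b)"
  have V0: "V \<noteq> 0"
    by (simp add: V_def abc X_inj)
  have L: "V * demazure i (demazure (i+1) (demazure i f)) =
     c*c*(b*f - a * s f) - b*b*(c * r f - a * r (s f)) + a*a*(c * s (r f) - b * s (r (s f)))"
  proof -
    define g where "g = demazure i f"
    define h where "h = demazure (i+1) g"
    have g1: "(b - a) * g = b * f - a * s f" using di g_def by simp
    have g2: "(c - a) * r g = c * r f - a * r (s f)" using arg_cong[OF g1, of r] r by simp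
    have g3: "(c - b) * s (r g) = c * s (r f) - b * s (r (s f))" using arg_cong[OF g2, of s] s by simp
    have h1: "(c - b) * h = c * g - b * r g" using dj h_def by simp
    have h2: "(c - a) * s h = c * g - a * s (r g)" using arg_cong[OF h1, of s] s sd g_def by simp
    have "V * demazure i h = (c - a) * (c - b) * ((b - a) * demazure i h)"
      by (simp add: V_def ac_simps)
    also have "\<dots> = b * (c - a) * ((c - b) * h) - a * (c - b) * ((c - a) * s h)"
      unfolding di by (simp add: algebra_simps)
    also have "\<dots> = c * c * ((b - a) * g) - b * b * ((c - a) * r g) + a * a * ((c - b) * s (r g))"
      unfolding h1 h2 by (simp add: algebra_simps)
    finally show ?thesis using g1 g2 g3 by (simp only: h_def g_def)
  qed
  have R: "V * demazure (i+1) (demazure i (demazure (i+1) f)) =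
     b*c*(c*f - b * r f) - a*c*(c * s f - a * s (r f)) + a*b*(b * r (s f) - a * r (s (r f)))"
  proof -
    define g where "g = demazure (i+1) f"
    define h where "h = demazure i g"
    have g1: "(c - b) * g = c * f - b * r f" using dj g_def by simp
    have g2: "(c - a) * s g = c * s f - a * s (r f)" using arg_cong[OF g1, of s] s by simp
    have g3: "(b - a) * r (s g) = b * r (s f) - a * r (s (r f))" using arg_cong[OF g2, of r] r by simp
    have h1: "(b - a) * h = b * g - a * s g" using di h_def by simp
    have h2: "(c - a) * r h = c * g - a * r (s g)" using arg_cong[OF h1, of r] r rd g_def by simp
    have "V * demazure (i+1) h = (c - a) * (b - a) * ((c - b) * demazure (i+1) h)"
      by (simp add: V_def ac_simps)
    also have "\<dots> = c * (c - a) * ((b - a) * h) - b * (b - a) * ((c - a) * r h)"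
      unfolding dj by (simp add: algebra_simps)
    also have "\<dots> = b * c * ((c - b) * g) - a * c * ((c - a) * s g) + a * b * ((b - a) * r (s g))"
      unfolding h1 h2 by (simp add: algebra_simps)
    finally show ?thesis using g1 g2 g3 by (simp only: h_def g_def)
  qed
  have "V * demazure i (demazure (i+1) (demazure i f)) = V * demazure (i+1) (demazure i (demazure (i+1) f))"
    unfolding L R brd by (simp add: algebra_simps)
  then show ?thesis using V0 mult_left_cancel by blast
qed

section \<open>Permutations and inversions\<close>

abbreviation tr :: "nat \<Rightarrow> nat \<Rightarrow> nat \<Rightarrow> nat" where
  "tr \<equiv> Transposition.transpose"

lemma S_mono: "n \<le> m \<Longrightarrow> w \<in> S n \<Longrightarrow> w \<in> S m"
  unfolding S_def using permutes_subset[of w "{1..n}" "{1..m}"] by auto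

lemma S_subset_S_inf: "w \<in> S n \<Longrightarrow> w \<in> S_inf"
  by (auto simp: S_inf_def)

lemma S_infE:
  assumes "w \<in> S_inf"
  obtains n where "w \<in> S n" "n \<ge> k"
proof -
  obtain n where n: "w \<in> S n" using assms by (auto simp: S_inf_def)
  show ?thesis by (rule that[of "max n k"]) (use S_mono[OF _ n, of "max n k"] in auto)
qed

lemma S_comp_tr: "w \<in> S n \<Longrightarrow> a \<in> {1..n} \<Longrightarrow> b \<in> {1..n} \<Longrightarrow> w \<circ> tr a b \<in> S n"
  unfolding S_def using permutes_compose[OF permutes_swap_id, of a "{1..n}" b w] by auto

lemma S_inf_comp_tr:
  assumes "w \<in> S_inf" "1 \<le> a" "1 \<le> b"
  shows "w \<circ> tr a b \<in> S_inf"
proof -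
  obtain n where "w \<in> S n" "n \<ge> max a b" using S_infE[OF assms(1)] by blast
  then have "w \<circ> tr a b \<in> S n" using assms by (intro S_comp_tr) auto
  then show ?thesis by (rule S_subset_S_inf)
qed

lemma S_bij: "w \<in> S n \<Longrightarrow> bij w"
  by (auto simp: S_def permutes_bij)

lemma S_inf_bij: "w \<in> S_inf \<Longrightarrow> bij w"
  by (auto simp: S_inf_def S_bij)

lemma S_inf_inj: "w \<in> S_inf \<Longrightarrow> inj w"
  using S_inf_bij bij_is_inj by blast

lemma S_inf_eq_iff: "w \<in> S_inf \<Longrightarrow> w a = w b \<longleftrightarrow> a = b"
  using S_inf_inj inj_eq by metis

lemma S_outside: "w \<in> S n \<Longrightarrow> p > n \<Longrightarrow> w p = p"
  by (auto simp: S_def intro: permutes_not_in)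

lemma S_inside: "w \<in> S n \<Longrightarrow> 1 \<le> p \<Longrightarrow> p \<le> n \<Longrightarrow> 1 \<le> w p \<and> w p \<le> n"
  unfolding S_def using permutes_in_image[of w "{1..n}" p] by auto

lemma S_inf_0 [simp]: "w \<in> S_inf \<Longrightarrow> w 0 = 0"
  by (auto simp: S_inf_def S_def intro: permutes_not_in)

lemma S_inf_ge_1: "w \<in> S_inf \<Longrightarrow> 1 \<le> w p \<longleftrightarrow> 1 \<le> p"
  using S_inf_eq_iff[of w p 0] by (cases p; cases "w p") auto

lemma comp_tr_tr [simp]: "w \<circ> tr a b \<circ> tr a b = w"
  by (simp add: comp_assoc)

section \<open>Inversions, length and descents\<close>

definition inversions :: "(nat \<Rightarrow> nat) \<Rightarrow> (nat \<times> nat) set" where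
  "inversions w = {(i, j). 1 \<le> i \<and> i < j \<and> w i > w j}"

lemma len_inversions: "len w = card (inversions w)"
  by (simp add: len_def inversions_def)

lemma inversions_subset:
  assumes "w \<in> S n"
  shows "inversions w \<subseteq> {1..n} \<times> {1..n}"
proof safe
  fix i j assume "(i, j) \<in> inversions w"
  then have *: "1 \<le> i" "i < j" "w i > w j" by (auto simp: inversions_def)
  have "j \<le> n"
  proof (rule ccontr)
    assume "\<not> j \<le> n"
    then have "w j = j" using S_outside[OF assms] by simp
    moreover have "w i < j" using S_outside[OF assms, of i] S_inside[OF assms, of i] * \<open>\<not> j \<le> n\<close>
      by (cases "i \<le> n") auto
    ultimately show False using * by simp
  qed
  then show "i \<in> {1..n}" "j \<in> {1..n}" using * by auto
qed

lemma finite_inversions: "w \<in> S_inf \<Longrightarrow> finite (inversions w)"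
  by (auto simp: S_inf_def intro: finite_subset[OF inversions_subset])

lemma len_le: "w \<in> S n \<Longrightarrow> len w \<le> n * n"
  unfolding len_inversions using card_mono[OF _ inversions_subset[of w n]]
  by (simp add: card_cartesian_product)

text \<open>\<open>s_i\<close> preserves the order of every pair of positions except
  \<open>(i, i + 1)\<close>. Applying it to both positions of a pair is thus a bijection from the
  remaining inversions of \<open>w\<close> onto those of \<open>w s_i\<close>.\<close>

lemma len_descent:
  assumes "w \<in> S_inf" "1 \<le> i" "w i > w (i + 1)"
  shows "len w = Suc (len (w \<circ> tr i (i + 1)))"
proof -
  let ?t = "tr i (i + 1)"
  have mono: "1 \<le> ?t p \<and> ?t p < ?t q" if "1 \<le> p" "p < q" "(p, q) \<noteq> (i, i + 1)" for p q
    using that assms(2) unfolding transpose_def by auto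
  have "inversions (w \<circ> ?t) = map_prod ?t ?t ` (inversions w - {(i, i + 1)})"
  proof (intro set_eqI iffI)
    fix z assume z: "z \<in> inversions (w \<circ> ?t)"
    obtain p q where pq: "z = (p, q)" by fastforce
    have z': "1 \<le> p" "p < q" "w (?t p) > w (?t q)" using z by (auto simp: pq inversions_def)
    have "(p, q) \<noteq> (i, i + 1)" using z' assms by auto
    then have "1 \<le> ?t p" "?t p < ?t q" using mono[of p q] z' by auto
    moreover have "(?t p, ?t q) \<noteq> (i, i + 1)"
    proof
      assume "(?t p, ?t q) = (i, i + 1)"
      then have "p = i + 1" "q = i" by (metis prod.inject transpose_involutory transpose_apply_first transpose_apply_second)+
      then show False using z' by simp
    qed
    ultimately have "(?t p, ?t q) \<in> inversions w - {(i, i + 1)}"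
      using z' by (simp add: inversions_def)
    moreover have "z = map_prod ?t ?t (?t p, ?t q)" by (simp add: pq)
    ultimately show "z \<in> map_prod ?t ?t ` (inversions w - {(i, i + 1)})" by blast
  next
    fix z assume "z \<in> map_prod ?t ?t ` (inversions w - {(i, i + 1)})"
    then obtain y where y: "z = map_prod ?t ?t y" "y \<in> inversions w - {(i, i + 1)}"
      by (rule imageE)
    obtain p q where "y = (p, q)" by (cases y)
    then have pq: "z = (?t p, ?t q)" "(p, q) \<in> inversions w" "(p, q) \<noteq> (i, i + 1)"
      using y by simp_all
    then show "z \<in> inversions (w \<circ> ?t)"
      using mono[of p q] by (simp add: inversions_def)
  qed
  then have "len (w \<circ> ?t) = card (inversions w - {(i, i + 1)})"
    unfolding len_inversions
    using card_image[OF inj_on_subset[OF prod.inj_map[OF inj_transpose inj_transpose] subset_UNIV]] by metis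
  moreover have "(i, i + 1) \<in> inversions w" using assms by (auto simp: inversions_def)
  ultimately show ?thesis
    using finite_inversions[OF assms(1)] unfolding len_inversions by (metis card_Suc_Diff1)
qed

lemma len_ascent:
  assumes "w \<in> S_inf" "1 \<le> i" "w i < w (i + 1)"
  shows "len (w \<circ> tr i (i + 1)) = Suc (len w)"
  using len_descent[of "w \<circ> tr i (i + 1)" i] assms S_inf_comp_tr[of w i "i + 1"] by simp

lemma len_less_iff_descent:
  assumes "w \<in> S_inf" "1 \<le> i"
  shows "len (w \<circ> tr i (i + 1)) < len w \<longleftrightarrow> w i > w (i + 1)"
proof -
  have "w i \<noteq> w (i + 1)" using S_inf_eq_iff[OF assms(1)] by simp
  then consider "w i < w (i + 1)" | "w i > w (i + 1)" by linarith
  then show ?thesis using len_descent[OF assms] len_ascent[OF assms] by cases auto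
qed

lemma longest_permutes: "longest N \<in> S N"
proof -
  have "bij_betw (longest N) {1..N} {1..N}"
    by (rule bij_betw_byWitness[where f' = "longest N"]) (auto simp: longest_def)
  then show ?thesis unfolding S_def
    by (auto intro!: bij_imp_permutes simp: longest_def)
qed

text \<open>Strict decrease from an entry at most \<open>N\<close> bounds the entries above, strict
  decrease towards an entry at least \<open>1\<close> bounds them below, and the two bounds
  coincide. Every other element of \<open>S N\<close> hence has an ascent, where downward inductions
  take their step.\<close>

lemma decreasing_imp_longest:
  assumes "w \<in> S N" and dec: "\<And>i. 1 \<le> i \<Longrightarrow> i < N \<Longrightarrow> w i > w (i + 1)"
  shows "w = longest N"
proof
  fix p
  show "w p = longest N p"
  proof (cases "1 \<le> p \<and> p \<le> N")
    case True
    have up: "w q \<le> N + 1 - q" if "1 \<le> q" "q \<le> N" for q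
      using that
    proof (induction q rule: dec_induct)
      case base
      then show ?case using S_inside[OF assms(1), of 1] by simp
    next
      case (step q)
      then show ?case using dec[of q] by simp
    qed
    have low: "N + 1 - q \<le> w q" if "1 \<le> q" "q \<le> N" for q
      using that(2,1)
    proof (induction rule: inc_induct)
      case base
      then show ?case using S_inside[OF assms(1), of N] by simp
    next
      case (step q)
      then show ?case using dec[of q] by simp
    qed
    show ?thesis using up[of p] low[of p] True by (simp add: longest_def)
  next
    case False
    then show ?thesis using S_outside[OF assms(1), of p] S_inf_0[OF S_subset_S_inf[OF assms(1)]]
      by (cases p) (auto simp: longest_def)
  qed
qed

section \<open>Grothendieck polynomials\<close>

lemma groth_rel_S: "groth_rel N w f \<Longrightarrow> w \<in> S N"
proof (induction rule: groth_rel.induct)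
  case longest
  show ?case by (rule longest_permutes)
next
  case (descend w f i)
  then show ?case by (intro S_comp_tr) auto
qed

lemma groth_rel_descend:
  assumes "groth_rel N w f" "1 \<le> i" "i < N" "w i > w (i + 1)"
  shows "groth_rel N (w \<circ> tr i (i + 1)) (demazure i f)"
  using assms len_less_iff_descent[OF S_subset_S_inf[OF groth_rel_S[OF assms(1)]] assms(2)]
  by (intro groth_rel.descend) auto

lemma groth_rel_exists: "w \<in> S N \<Longrightarrow> \<exists>f. groth_rel N w f"
\<comment> \<open>\<open>N * N\<close> is a crude upper bound for lengths in \<open>S N\<close>; the
  induction descends from the longest element.\<close>
proof (induction "N * N - len w" arbitrary: w rule: less_induct)
  case less
  note w = less.prems
  show ?case
  proof (cases "w = longest N")
    case True
    then show ?thesis using groth_rel.longest by blast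
  next
    case False
    then obtain i where i: "1 \<le> i" "i < N" "\<not> w i > w (i + 1)"
      using decreasing_imp_longest[OF w] by blast
    have wi: "w \<in> S_inf" using w by (rule S_subset_S_inf)
    have lt: "w i < w (i + 1)" using i S_inf_eq_iff[OF wi, of i "i + 1"] by simp
    let ?u = "w \<circ> tr i (i + 1)"
    have u: "?u \<in> S N" using i w by (intro S_comp_tr) auto
    have "N * N - len ?u < N * N - len w"
      using len_ascent[OF wi i(1) lt] len_le[OF u] by simp
    then obtain f where f: "groth_rel N ?u f" using less.hyps u by blast
    have "?u i > ?u (i + 1)" using lt by simp
    then show ?thesis using groth_rel_descend[OF f i(1,2)] by auto
  qed
qed

text \<open>Rule inversion with the last step expressed as an ascent of the permutation reached.
  Confluence compares two such last steps.\<close>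

lemma groth_rel_cases_ascent:
  assumes "groth_rel N w f"
  shows "w = longest N \<and> f = (\<Prod>i=1..N. X i ^ (N - i)) \<or>
    (\<exists>i f'. 1 \<le> i \<and> i < N \<and> w i < w (i + 1) \<and> groth_rel N (w \<circ> tr i (i + 1)) f' \<and> f = demazure i f')"
  using assms
proof cases
  case longest
  then show ?thesis by blast
next
  case (descend u g i)
  have "u i > u (i + 1)"
    using descend len_less_iff_descent[OF S_subset_S_inf[OF groth_rel_S[OF descend(3)]] descend(4)] by simp
  then have "w i < w (i + 1)" using descend by simp
  moreover have "w \<circ> tr i (i + 1) = u" using descend by simp
  ultimately show ?thesis using descend by blast
qed

lemma longest_descent: "1 \<le> i \<Longrightarrow> i < N \<Longrightarrow> longest N i > longest N (i + 1)"
  by (simp add: longest_def)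

text \<open>Local confluence of the descents from the longest element suffices, because the recursion
  is well founded.\<close>

lemma groth_rel_unique: "groth_rel N w f \<Longrightarrow> groth_rel N w g \<Longrightarrow> f = g"
proof (induction "N * N - len w" arbitrary: w f g rule: less_induct)
  case less
  have w: "w \<in> S N" using less.prems groth_rel_S by blast
  have wi: "w \<in> S_inf" using w by (rule S_subset_S_inf)
  have IH: "f' = g'" if "1 \<le> i" "i < N" "w i < w (i + 1)"
    "groth_rel N (w \<circ> tr i (i + 1)) f'" "groth_rel N (w \<circ> tr i (i + 1)) g'" for i f' g'
  proof (rule less.hyps[OF _ that(4,5)])
    show "N * N - len (w \<circ> tr i (i + 1)) < N * N - len w"
      using len_ascent[OF wi that(1,3)] len_le[OF groth_rel_S[OF that(4)]] by simp
  qed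
  have adj: "demazure i f' = demazure (i+1) g'"
    if i: "1 \<le> i" "i + 1 < N" "w i < w (i + 1)" "w (i + 1) < w (i + 2)"
      and f': "groth_rel N (w \<circ> tr i (i + 1)) f'" and g': "groth_rel N (w \<circ> tr (i + 1) (i + 2)) g'"
    for i f' g'
  proof -
    let ?x = "w \<circ> tr i (i + 2)"
    have "?x \<in> S N" using w i by (intro S_comp_tr) auto
    then obtain h where h: "groth_rel N ?x h" using groth_rel_exists by blast
    have h1: "groth_rel N (?x \<circ> tr i (i + 1)) (demazure i h)"
      using i by (intro groth_rel_descend[OF h]) (auto simp: transpose_def)
    have h2: "groth_rel N (?x \<circ> tr (i + 1) (i + 1 + 1)) (demazure (i+1) h)"
      using i by (intro groth_rel_descend[OF h]) (auto simp: transpose_def)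
    have "groth_rel N (?x \<circ> tr i (i + 1) \<circ> tr (i + 1) (i + 1 + 1)) (demazure (i+1) (demazure i h))"
      using i by (intro groth_rel_descend[OF h1]) (auto simp: transpose_def)
    moreover have "?x \<circ> tr i (i + 1) \<circ> tr (i + 1) (i + 1 + 1) = w \<circ> tr i (i + 1)"
      by (auto simp: fun_eq_iff transpose_def)
    ultimately have "f' = demazure (i+1) (demazure i h)" using IH[of i] f' i by auto
    moreover have "groth_rel N (?x \<circ> tr (i + 1) (i + 1 + 1) \<circ> tr i (i + 1)) (demazure i (demazure (i+1) h))"
      using i by (intro groth_rel_descend[OF h2]) (auto simp: transpose_def)
    moreover have "?x \<circ> tr (i + 1) (i + 1 + 1) \<circ> tr i (i + 1) = w \<circ> tr (i + 1) (i + 2)"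
      by (auto simp: fun_eq_iff transpose_def)
    ultimately have "g' = demazure i (demazure (i+1) h)" using IH[of "i + 1"] g' i by auto
    then show ?thesis using \<open>f' = _\<close> demazure_braid by simp
  qed
  have far: "demazure i f' = demazure j g'"
    if i: "1 \<le> i" "i < N" "w i < w (i + 1)" and j: "1 \<le> j" "j < N" "w j < w (j + 1)"
      and ij: "i + 1 < j \<or> j + 1 < i"
      and f': "groth_rel N (w \<circ> tr i (i + 1)) f'" and g': "groth_rel N (w \<circ> tr j (j + 1)) g'"
    for i j f' g'
  proof -
    let ?x = "w \<circ> tr i (i + 1) \<circ> tr j (j + 1)"
    have x: "?x = w \<circ> tr j (j + 1) \<circ> tr i (i + 1)"
      using ij by (auto simp: fun_eq_iff transpose_def)
    have "?x \<in> S N" using w i j by (intro S_comp_tr) auto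
    then obtain h where h: "groth_rel N ?x h" using groth_rel_exists by blast
    have "groth_rel N (?x \<circ> tr j (j + 1)) (demazure j h)"
      using i j ij by (intro groth_rel_descend[OF h]) (auto simp: transpose_def)
    then have "f' = demazure j h" using IH[of i] f' i by auto
    moreover have "groth_rel N (w \<circ> tr j (j + 1) \<circ> tr i (i + 1) \<circ> tr i (i + 1)) (demazure i h)"
      unfolding x[symmetric] using i j ij by (intro groth_rel_descend[OF h]) (auto simp: transpose_def)
    then have "g' = demazure i h" using IH[of j] g' j by auto
    ultimately show ?thesis using demazure_commute[OF ij] by simp
  qed
  consider "w = longest N" | "w \<noteq> longest N" by blast
  then show ?case
  proof cases
    case 1
    have "h = (\<Prod>i=1..N. X i ^ (N - i))" if "groth_rel N w h" for h
      using groth_rel_cases_ascent[OF that] longest_descent[of _ N] unfolding 1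
      by (meson less_asym)
    from this[OF less.prems(1)] this[OF less.prems(2)] show ?thesis by (rule trans[OF _ sym])
  next
    case 2
    then obtain i f' where i: "1 \<le> i" "i < N" "w i < w (i + 1)" "groth_rel N (w \<circ> tr i (i + 1)) f'" "f = demazure i f'"
      using groth_rel_cases_ascent[OF less.prems(1)] by blast
    obtain j g' where j: "1 \<le> j" "j < N" "w j < w (j + 1)" "groth_rel N (w \<circ> tr j (j + 1)) g'" "g = demazure j g'"
      using groth_rel_cases_ascent[OF less.prems(2)] 2 by blast
    consider "i = j" | "j = i + 1" | "i = j + 1" | "i + 1 < j \<or> j + 1 < i" by linarith
    then show ?thesis
    proof cases
      case 1
      then show ?thesis using IH[of i] i j by auto
    next
      case 2
      then show ?thesis using adj[of i f' g'] i j by simp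
    next
      case 3
      then show ?thesis using adj[of j g' f'] i j by simp
    next
      case 4
      then show ?thesis using far i j by blast
    qed
  qed
qed

section \<open>Monomial Grothendieck polynomials and independence of \<open>N\<close>\<close>

definition mon :: "nat \<Rightarrow> (nat \<Rightarrow> nat) \<Rightarrow> mpoly" where
  "mon M e = (\<Prod>p=1..M. X p ^ e p)"

lemma demazure_X: "demazure i (X i) = 1"
  unfolding demazure_eq_iff by (simp add: algebra_simps)

text \<open>With exponents differing by one, the monomial is \<open>x_i\<close> times a monomial
  symmetric in \<open>x_i\<close>, \<open>x_(i+1)\<close>, and \<open>demazure i\<close> sends
  \<open>x_i\<close> to \<open>1\<close>.\<close>

lemma demazure_mon:
  assumes "1 \<le> i" "i < M" "e i = Suc (e (i + 1))"
  shows "demazure i (mon M e) = mon M (e(i := e (i + 1)))"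
proof -
  let ?A = "{1..M} - {i, i + 1}"
  define g where "g = (\<Prod>p\<in>?A. X p ^ e p) * (X i ^ e (i + 1) * X (i + 1) ^ e (i + 1))"
  have split: "mon M e' = (\<Prod>p\<in>?A. X p ^ e' p) * (X i ^ e' i * X (i + 1) ^ e' (i + 1))" for e'
  proof -
    have "{1..M} = insert i (insert (i + 1) ?A)" using assms by auto
    then have "mon M e' = (\<Prod>p\<in>insert i (insert (i + 1) ?A). X p ^ e' p)" by (simp only: mon_def)
    also have "\<dots> = (\<Prod>p\<in>?A. X p ^ e' p) * (X i ^ e' i * X (i + 1) ^ e' (i + 1))"
      by (simp add: ac_simps)
    finally show ?thesis .
  qed
  have "swap_vars i (\<Prod>p\<in>?A. X p ^ e p) = (\<Prod>p\<in>?A. X p ^ e p)"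
    unfolding swap_vars_prod by (rule prod.cong) (auto simp: transpose_def)
  then have sym: "swap_vars i g = g" unfolding g_def by (simp add: ac_simps)
  have "mon M e = g * X i" unfolding split g_def using assms by (simp add: ac_simps)
  then have "demazure i (mon M e) = g" using demazure_mult_symmetric[OF sym] demazure_X by simp
  also have "g = mon M (e(i := e (i + 1)))"
    unfolding split g_def by (auto intro!: arg_cong2[where f = "(*)"] prod.cong)
  finally show ?thesis .
qed

text \<open>\<open>cyc w a b\<close> is the one-line notation of \<open>w\<close> with the entry in position \<open>a\<close> moved to
  position \<open>b\<close>.\<close>

definition cyc :: "(nat \<Rightarrow> nat) \<Rightarrow> nat \<Rightarrow> nat \<Rightarrow> nat \<Rightarrow> nat" where
  "cyc w a b p = (if a \<le> p \<and> p < b then w (p + 1) else if p = b then w a else w p)"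

text \<open>The moved entry exceeds all entries that it passes, so every adjacent exchange is a
  descent. Consecutive exponents differ by one along its way, so the polynomial stays a
  monomial.\<close>

lemma groth_rel_cyc:
  assumes "groth_rel M w (mon M e)" "1 \<le> a" "a \<le> b" "b \<le> M"
    "\<And>p. a < p \<Longrightarrow> p \<le> b \<Longrightarrow> w p < w a"
    "\<And>p. a \<le> p \<Longrightarrow> p < b \<Longrightarrow> e p = Suc (e (p + 1))"
  shows "groth_rel M (cyc w a b) (mon M (\<lambda>p. if a \<le> p \<and> p < b then e p - 1 else e p))"
  using assms(3-)
proof (induction b rule: dec_induct)
  case base
  have "cyc w a a = w" by (auto simp: cyc_def fun_eq_iff)
  moreover have "(\<lambda>p. if a \<le> p \<and> p < a then e p - 1 else e p) = e" by auto
  ultimately show ?case using assms(1) by simp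
next
  case (step b)
  let ?e = "\<lambda>p. if a \<le> p \<and> p < b then e p - 1 else e p"
  let ?w = "cyc w a b"
  have *: "groth_rel M ?w (mon M ?e)"
    using step.IH step.prems by (meson Suc_leD le_SucI less_SucI)
  have "groth_rel M (?w \<circ> tr b (b + 1)) (demazure b (mon M ?e))"
    using step.hyps step.prems(1,2) assms(2) by (intro groth_rel_descend[OF *]) (auto simp: cyc_def)
  moreover have "?w \<circ> tr b (b + 1) = cyc w a (Suc b)"
    using step.hyps by (auto simp: fun_eq_iff cyc_def transpose_def)
  moreover have "demazure b (mon M ?e) = mon M (?e(b := ?e (b + 1)))"
    using step.hyps step.prems(1) step.prems(3)[of b] assms(2) by (intro demazure_mon) simp_all
  moreover have "?e(b := ?e (b + 1)) = (\<lambda>p. if a \<le> p \<and> p < Suc b then e p - 1 else e p)"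
    using step.prems(3)[of b] step.hyps by (auto simp: fun_eq_iff)
  ultimately show ?case by simp
qed

lemma groth_rel_longest_mon: "groth_rel N (longest N) (mon N (\<lambda>p. N - p))"
  using groth_rel.longest[of N] by (simp add: mon_def)

lemma mon_Suc: "e (Suc N) = 0 \<Longrightarrow> mon (Suc N) e = mon N e"
  by (simp add: mon_def)

lemma mon_cong: "(\<And>p. 1 \<le> p \<Longrightarrow> p \<le> N \<Longrightarrow> e p = e' p) \<Longrightarrow> mon N e = mon N e'"
  by (simp add: mon_def)

text \<open>Only the starting points have to be compared: carrying the entry \<open>N + 1\<close> of
  the longest element of \<open>S (N + 1)\<close> from the first to the last position leaves the
  longest element of \<open>S N\<close>, and lowers each exponent in positions up to
  \<open>N\<close> by one.\<close>

lemma groth_rel_Suc: "groth_rel N w f \<Longrightarrow> groth_rel (Suc N) w f"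
proof (induction rule: groth_rel.induct)
  case longest
  let ?e = "\<lambda>p. Suc N - p"
  have "groth_rel (Suc N) (cyc (longest (Suc N)) 1 (Suc N))
      (mon (Suc N) (\<lambda>p. if 1 \<le> p \<and> p < Suc N then ?e p - 1 else ?e p))"
    by (rule groth_rel_cyc[OF groth_rel_longest_mon]) (auto simp: longest_def)
  moreover have "cyc (longest (Suc N)) 1 (Suc N) = longest N"
    by (auto simp: cyc_def longest_def fun_eq_iff)
  moreover have "mon (Suc N) (\<lambda>p. if 1 \<le> p \<and> p < Suc N then ?e p - 1 else ?e p) = (\<Prod>i=1..N. X i ^ (N - i))"
    unfolding mon_def by (simp add: atLeastLessThanSuc_atLeastAtMost[symmetric])
  ultimately show ?case by simp
next
  case (descend w f i)
  then show ?case by (intro groth_rel.descend) auto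
qed

lemma groth_rel_mono: "groth_rel N w f \<Longrightarrow> N \<le> M \<Longrightarrow> groth_rel M w f"
  by (rotate_tac, induction M rule: dec_induct) (auto intro: groth_rel_Suc)

lemma Groth_eqI:
  assumes "groth_rel N w f"
  shows "Groth w = f"
  unfolding Groth_def
proof (rule the_equality)
  show "\<exists>N. groth_rel N w f" using assms by blast
next
  fix g assume "\<exists>M. groth_rel M w g"
  then obtain M where "groth_rel M w g" ..
  then show "g = f"
    using groth_rel_unique[of "max N M" w g f] groth_rel_mono assms by (metis max.cobounded1 max.cobounded2)
qed

lemma groth_rel_Groth: "w \<in> S N \<Longrightarrow> groth_rel N w (Groth w)"
  using groth_rel_exists Groth_eqI by blast

lemma demazure_Groth_descent:
  assumes "w \<in> S_inf" "1 \<le> i" "w i > w (i + 1)"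
  shows "demazure i (Groth w) = Groth (w \<circ> tr i (i + 1))"
proof -
  obtain N where N: "w \<in> S N" "i + 1 \<le> N" using S_infE[OF assms(1)] by blast
  show ?thesis
    using groth_rel_descend[OF groth_rel_Groth[OF N(1)] assms(2) _ assms(3)] N Groth_eqI by force
qed

lemma demazure_Groth_ascent:
  assumes "w \<in> S_inf" "1 \<le> i" "w i < w (i + 1)"
  shows "demazure i (Groth w) = Groth w"
proof -
  have "demazure i (Groth (w \<circ> tr i (i + 1))) = Groth w"
    using demazure_Groth_descent[of "w \<circ> tr i (i + 1)" i] S_inf_comp_tr[of w i "i + 1"] assms by simp
  then show ?thesis using demazure_idem by metis
qed

lemma Groth_id: "Groth id = 1"
proof -
  have "longest 0 = id" by (auto simp: longest_def fun_eq_iff)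
  then show ?thesis using Groth_eqI[OF groth_rel.longest[of 0]] by simp
qed

text \<open>The start of the Monk rule: for the longest element of \<open>S N\<close>, the exchange
  with \<open>N + 1\<close> is the only cover at \<open>l\<close>.\<close>

lemma Groth_longest_transpose:
  assumes l: "1 \<le> l" "l \<le> N"
  shows "Groth (longest N \<circ> tr l (N + 1)) = X l * Groth (longest N)"
proof -
  let ?M = "Suc N"
  \<comment> \<open>In the longest element of \<open>S (N + 1)\<close> the entry
    \<open>N + 1 - l\<close> moves from position \<open>l + 1\<close> to the end, and afterwards the
    entry \<open>N + 1\<close> moves from the front to position \<open>l\<close>. Both moves
    together lower the exponents of all positions up to \<open>N\<close> except \<open>l\<close>,
    whence the factor \<open>x_l\<close>.\<close>
  let ?w1 = "cyc (longest ?M) (l + 1) ?M"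
  let ?e0 = "\<lambda>p. ?M - p"
  let ?e1 = "\<lambda>p. if l + 1 \<le> p \<and> p < ?M then ?e0 p - 1 else ?e0 p"
  let ?e2 = "\<lambda>p. if 1 \<le> p \<and> p < l then ?e1 p - 1 else ?e1 p"
  have 1: "groth_rel ?M ?w1 (mon ?M ?e1)"
    using l by (intro groth_rel_cyc[OF groth_rel_longest_mon]) (auto simp: longest_def)
  have 2: "groth_rel ?M (cyc ?w1 1 l) (mon ?M ?e2)"
    using l by (intro groth_rel_cyc[OF 1]) (auto simp: longest_def cyc_def)
  have 3: "cyc ?w1 1 l = longest N \<circ> tr l (N + 1)"
    using l by (auto simp: fun_eq_iff cyc_def longest_def transpose_def)
  have "mon ?M ?e2 = mon N ?e2" by (rule mon_Suc) (use l in auto)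
  also have "\<dots> = mon N (\<lambda>p. (N - p) + (if p = l then 1 else 0))"
    by (rule mon_cong) auto
  also have "\<dots> = mon N (\<lambda>p. N - p) * (\<Prod>p=1..N. if p = l then X p else 1)"
    unfolding mon_def prod.distrib[symmetric] by (rule prod.cong) (auto simp: Suc_diff_le)
  also have "(\<Prod>p=1..N. if p = l then X p else 1) = X l"
    using l by simp
  finally have "Groth (longest N \<circ> tr l (N + 1)) = mon N (\<lambda>p. N - p) * X l"
    using Groth_eqI[OF 2[unfolded 3]] by simp
  then show ?thesis using Groth_eqI[OF groth_rel_longest_mon[of N]] by simp
qed

section \<open>The K-theoretic Monk rule\<close>

declare One_nat_def [simp del]

text \<open>\<open>covers w l a\<close>: exchanging the entries in positions \<open>a\<close> and \<open>l\<close> of \<open>w\<close> raises the length by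
  exactly one.\<close>

definition covers :: "(nat \<Rightarrow> nat) \<Rightarrow> nat \<Rightarrow> nat \<Rightarrow> bool" where
  "covers w l a \<longleftrightarrow> (if a < l then w a < w l \<and> (\<forall>p. a < p \<and> p < l \<longrightarrow> \<not> (w a < w p \<and> w p < w l))
     else w l < w a \<and> (\<forall>p. l < p \<and> p < a \<longrightarrow> \<not> (w l < w p \<and> w p < w a)))"

text \<open>One factor of a product that, multiplied out, becomes an alternating sum over sets of
  positions.\<close>

definition cover_diff :: "nat \<Rightarrow> nat \<Rightarrow> ((nat \<Rightarrow> nat) \<Rightarrow> mpoly) \<Rightarrow> (nat \<Rightarrow> nat) \<Rightarrow> mpoly" where
  "cover_diff l a F w = F w - (if covers w l a then F (w \<circ> tr a l) else 0)"

text \<open>The two sides of the Monk rule are \<open>cover_diffs l [1..<l] Groth v\<close> and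
  \<open>cover_diffs l (rev [l + 1..<N + 2]) Groth v\<close> for \<open>v \<in> S N\<close>; the head of the list is the
  transposition applied to \<open>v\<close> first.\<close>

definition cover_diffs :: "nat \<Rightarrow> nat list \<Rightarrow> ((nat \<Rightarrow> nat) \<Rightarrow> mpoly) \<Rightarrow> (nat \<Rightarrow> nat) \<Rightarrow> mpoly" where
  "cover_diffs l xs F = foldr (cover_diff l) xs F"

text \<open>The 0-Hecke action of \<open>s_i\<close> on permutations; \<open>demazure i\<close> acts
  by it on the indices of Grothendieck polynomials.\<close>

definition dn :: "nat \<Rightarrow> (nat \<Rightarrow> nat) \<Rightarrow> nat \<Rightarrow> nat" where
  "dn i w = (if w i > w (i + 1) then w \<circ> tr i (i + 1) else w)"

lemma cover_diffs_Nil [simp]: "cover_diffs l [] F = F"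
  and cover_diffs_Cons: "cover_diffs l (a # xs) F = cover_diff l a (cover_diffs l xs F)"
  and cover_diffs_append: "cover_diffs l (xs @ ys) F = cover_diffs l xs (cover_diffs l ys F)"
  by (simp_all add: cover_diffs_def)

lemma demazure_cover_diffs: "demazure i (cover_diffs l xs F w) = cover_diffs l xs (\<lambda>w. demazure i (F w)) w"
proof (induction xs arbitrary: w)
  case (Cons a xs)
  show ?case unfolding cover_diffs_Cons cover_diff_def demazure_diff
    by (cases "covers w l a") (simp_all only: Cons.IH demazure_0 if_True if_False)
qed simp

lemma cover_diffs_cong:
  assumes "\<And>w. w \<in> S_inf \<Longrightarrow> F w = H w" "1 \<le> l" "\<forall>a\<in>set xs. 1 \<le> a" "w \<in> S_inf"
  shows "cover_diffs l xs F w = cover_diffs l xs H w"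
  using assms(3,4)
proof (induction xs arbitrary: w)
  case Nil
  then show ?case using assms(1) by simp
next
  case (Cons a xs)
  then show ?case unfolding cover_diffs_Cons cover_diff_def using S_inf_comp_tr[OF Cons.prems(2), of a l] assms(2) by simp
qed

lemma cover_diffs_trivial:
  assumes "\<forall>a\<in>set xs. \<not> covers w l a"
  shows "cover_diffs l xs F w = F w"
  using assms by (induction xs) (simp_all add: cover_diffs_Cons cover_diff_def)

lemma demazure_Groth: "w \<in> S_inf \<Longrightarrow> 1 \<le> i \<Longrightarrow> demazure i (Groth w) = Groth (dn i w)"
  using demazure_Groth_descent[of w i] demazure_Groth_ascent[of w i] S_inf_eq_iff[of w i "i + 1"]
  unfolding dn_def by (cases "w i" "w (i + 1)" rule: linorder_cases) auto

text \<open>The positions \<open>i\<close> and \<open>i + 1\<close> lie either both between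
  \<open>a\<close> and \<open>l\<close> or both outside, so the exchange preserves the set of
  entries between \<open>a\<close> and \<open>l\<close>.\<close>

lemma covers_far:
  assumes "l \<noteq> i" "l \<noteq> i + 1" "a \<noteq> i" "a \<noteq> i + 1"
  shows "covers (w \<circ> tr i (i + 1)) l a = covers w l a"
proof -
  let ?t = "tr i (i + 1)"
  have ends: "?t l = l" "?t a = a" using assms by (auto simp: transpose_def)
  have btw: "x < ?t p \<and> ?t p < y \<longleftrightarrow> x < p \<and> p < y"
    if "x \<noteq> i" "x \<noteq> i + 1" "y \<noteq> i" "y \<noteq> i + 1" for x y p
    using that by (auto simp: transpose_def)
  have all: "(\<forall>p. x < p \<and> p < y \<longrightarrow> P (?t p)) \<longleftrightarrow> (\<forall>p. x < p \<and> p < y \<longrightarrow> P p)"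
    if "x \<noteq> i" "x \<noteq> i + 1" "y \<noteq> i" "y \<noteq> i + 1" for x y P
    using btw[OF that] by (metis transpose_involutory)
  show ?thesis
    unfolding covers_def comp_apply ends
    using all[of a l "\<lambda>q. \<not> (w a < w q \<and> w q < w l)"] all[of l a "\<lambda>q. \<not> (w l < w q \<and> w q < w a)"] assms
    by simp
qed

lemma dn_comp_tr_far:
  assumes "l \<noteq> i" "l \<noteq> i + 1" "a \<noteq> i" "a \<noteq> i + 1"
  shows "dn i (w \<circ> tr a l) = dn i w \<circ> tr a l"
proof -
  have "w \<circ> tr a l \<circ> tr i (i + 1) = w \<circ> tr i (i + 1) \<circ> tr a l"
    using assms by (auto simp: fun_eq_iff transpose_def)
  moreover have "tr a l i = i" "tr a l (i + 1) = i + 1" using assms by (auto simp: transpose_def)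
  ultimately show ?thesis by (simp add: dn_def)
qed

text \<open>Quantification over all \<open>F\<close> makes the property composable: in a
  concatenated list, the \<open>F\<close> of the front part is produced by the operators of the rear
  part.\<close>

definition commutes_dn :: "nat \<Rightarrow> nat \<Rightarrow> nat list \<Rightarrow> bool" where
  "commutes_dn i l xs \<longleftrightarrow>
    (\<forall>F. \<forall>w\<in>S_inf. cover_diffs l xs (\<lambda>w. F (dn i w)) w = cover_diffs l xs F (dn i w))"

lemma commutes_dn_append:
  assumes "commutes_dn i l xs" "commutes_dn i l ys" "1 \<le> l" "\<forall>a\<in>set xs. 1 \<le> a"
  shows "commutes_dn i l (xs @ ys)"
  unfolding commutes_dn_def cover_diffs_append
proof (intro allI ballI)
  fix F w assume w: "w \<in> S_inf"
  have "cover_diffs l xs (cover_diffs l ys (\<lambda>w. F (dn i w))) w = cover_diffs l xs (\<lambda>w. cover_diffs l ys F (dn i w)) w"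
    using assms w by (intro cover_diffs_cong) (auto simp: commutes_dn_def)
  also have "\<dots> = cover_diffs l xs (cover_diffs l ys F) (dn i w)"
    using assms(1) w by (simp add: commutes_dn_def)
  finally show "cover_diffs l xs (cover_diffs l ys (\<lambda>w. F (dn i w))) w = cover_diffs l xs (cover_diffs l ys F) (dn i w)" .
qed

lemma commutes_dn_far:
  assumes "l \<noteq> i" "l \<noteq> i + 1" "i \<notin> set xs" "i + 1 \<notin> set xs" "1 \<le> l" "\<forall>a\<in>set xs. 1 \<le> a"
  shows "commutes_dn i l xs"
  using assms(3,4,6)
proof (induction xs)
  case Nil
  then show ?case by (simp add: commutes_dn_def)
next
  case (Cons a xs)
  have "commutes_dn i l [a]"
    unfolding commutes_dn_def cover_diffs_Cons cover_diffs_Nil cover_diff_def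
  proof (intro allI ballI)
    fix F w
    have "covers (dn i w) l a = covers w l a"
      using covers_far[of l i a w] assms(1,2) Cons.prems by (auto simp: dn_def)
    moreover have "dn i (w \<circ> tr a l) = dn i w \<circ> tr a l"
      using assms(1,2) Cons.prems by (intro dn_comp_tr_far) auto
    ultimately show "F (dn i w) - (if covers w l a then F (dn i (w \<circ> tr a l)) else 0) =
       F (dn i w) - (if covers (dn i w) l a then F (dn i w \<circ> tr a l) else 0)" by simp
  qed
  moreover have "commutes_dn i l xs" using Cons by simp
  ultimately show ?case using commutes_dn_append[of i l "[a]" xs] assms Cons.prems by simp
qed

lemma tr_conj:
  assumes "x \<noteq> y" "x \<noteq> l" "y \<noteq> l"
  shows "tr x l \<circ> tr x y = tr x y \<circ> tr y l" "tr x l \<circ> tr y l \<circ> tr x y = tr y l"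
  using assms by (simp_all add: fun_eq_iff transpose_def)

text \<open>When both \<open>covers w l x\<close> and \<open>covers w l y\<close> hold, two of the four terms on the left
  have the same image under \<open>dn i\<close>, and cancel.\<close>

lemma cover_diff_cover_diff_dn_descent:
  assumes xy: "(x = i \<and> y = i + 1) \<or> (x = i + 1 \<and> y = i)" and l: "l \<noteq> i" "l \<noteq> i + 1"
    and desc: "w i > w (i + 1)"
    and Q12: "\<not> covers (w \<circ> tr i (i + 1) \<circ> tr x l) l y"
    and Q1: "covers (w \<circ> tr i (i + 1)) l x \<longleftrightarrow> covers w l y \<and> \<not> covers w l x"
    and Q2: "covers (w \<circ> tr i (i + 1)) l y \<longleftrightarrow> covers w l x"
    and P12: "covers w l x \<Longrightarrow> covers (w \<circ> tr x l) l y \<longleftrightarrow> covers w l y"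
    and d1: "covers w l x \<Longrightarrow> (w \<circ> tr x l) i > (w \<circ> tr x l) (i + 1)"
    and d2: "covers w l y \<Longrightarrow> (w \<circ> tr y l) i > (w \<circ> tr y l) (i + 1) \<longleftrightarrow> \<not> covers w l x"
    and d12: "covers w l x \<Longrightarrow> covers w l y \<Longrightarrow> (w \<circ> tr x l \<circ> tr y l) i > (w \<circ> tr x l \<circ> tr y l) (i + 1)"
  shows "cover_diff l x (cover_diff l y (\<lambda>w. F (dn i w))) w = cover_diff l x (cover_diff l y F) (dn i w)"
proof -
  let ?s = "tr i (i + 1)"
  have t: "w \<circ> tr x l \<circ> ?s = w \<circ> ?s \<circ> tr y l" "w \<circ> tr y l \<circ> ?s = w \<circ> ?s \<circ> tr x l"
    "w \<circ> tr x l \<circ> tr y l \<circ> ?s = w \<circ> tr y l"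
  proof -
    have s: "?s = tr x y" "?s = tr y x" and d: "x \<noteq> y" "x \<noteq> l" "y \<noteq> l"
      using xy l by (auto simp: transpose_commute)
    show "w \<circ> tr x l \<circ> ?s = w \<circ> ?s \<circ> tr y l" "w \<circ> tr x l \<circ> tr y l \<circ> ?s = w \<circ> tr y l"
      unfolding s(1) using tr_conj[OF d] by (simp_all add: comp_assoc)
    show "w \<circ> tr y l \<circ> ?s = w \<circ> ?s \<circ> tr x l"
      unfolding s(2) using tr_conj(1)[of y x l] d by (simp add: comp_assoc)
  qed
  have D: "dn i w = w \<circ> ?s" using desc by (simp add: dn_def)
  have D1: "dn i (w \<circ> tr x l) = w \<circ> ?s \<circ> tr y l" if "covers w l x"
    using d1[OF that] by (simp only: dn_def t if_True)
  have D2: "dn i (w \<circ> tr y l) = (if covers w l x then w \<circ> tr y l else w \<circ> ?s \<circ> tr x l)" if "covers w l y"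
    using d2[OF that] by (simp only: dn_def t) auto
  have D12: "dn i (w \<circ> tr x l \<circ> tr y l) = w \<circ> tr y l" if "covers w l x" "covers w l y"
    using d12[OF that] by (simp only: dn_def t if_True)
  show ?thesis
    unfolding cover_diff_def D using P12 Q12 Q1 Q2 D1 D2 D12
    by (cases "covers w l x"; cases "covers w l y") simp_all
qed

text \<open>At an ascent \<open>dn i\<close> fixes \<open>w\<close> and both single exchanges, while
  the double exchange is excluded; the two sides agree term by term.\<close>

lemma cover_diff_cover_diff_dn_ascent:
  assumes asc: "\<not> w i > w (i + 1)"
    and P12: "covers w l x \<Longrightarrow> \<not> covers (w \<circ> tr x l) l y"
    and d1: "covers w l x \<Longrightarrow> \<not> (w \<circ> tr x l) i > (w \<circ> tr x l) (i + 1)"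
    and d2: "covers w l y \<Longrightarrow> \<not> (w \<circ> tr y l) i > (w \<circ> tr y l) (i + 1)"
  shows "cover_diff l x (cover_diff l y (\<lambda>w. F (dn i w))) w = cover_diff l x (cover_diff l y F) (dn i w)"
proof -
  have "dn i w = w" using asc by (simp add: dn_def)
  moreover have "dn i (w \<circ> tr x l) = w \<circ> tr x l" if "covers w l x"
    using d1[OF that] by (simp only: dn_def if_False)
  moreover have "dn i (w \<circ> tr y l) = w \<circ> tr y l" if "covers w l y"
    using d2[OF that] by (simp only: dn_def if_False)
  ultimately show ?thesis unfolding cover_diff_def using P12 by simp
qed

lemma all_between_Suc:
  "i + 1 < l \<Longrightarrow> (\<forall>p. i < p \<and> p < l \<longrightarrow> P p) \<longleftrightarrow> P (i + 1) \<and> (\<forall>p. i + 1 < p \<and> p < l \<longrightarrow> P p)"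
  for i l :: nat
  by (metis Suc_eq_plus1 Suc_lessI lessI less_trans)

lemma all_between_pred:
  "l < i \<Longrightarrow> (\<forall>p. l < p \<and> p < i + 1 \<longrightarrow> P p) \<longleftrightarrow> P i \<and> (\<forall>p. l < p \<and> p < i \<longrightarrow> P p)"
  for i l :: nat
  by (metis Suc_eq_plus1 less_Suc_eq)

text \<open>Whether \<open>i\<close> and \<open>i + 1\<close> are covers depends on the order of
  \<open>w i\<close>, \<open>w (i + 1)\<close>, \<open>w l\<close> and on a condition about the
  positions from \<open>i + 2\<close> to \<open>l - 1\<close>, which \<open>s_i\<close> does not
  touch. The position farther from \<open>l\<close> comes first in the list.\<close>

lemma commutes_dn_near_left:
  assumes il: "i + 1 < l" and i: "1 \<le> i"
  shows "commutes_dn i l [i, i + 1]"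
  unfolding commutes_dn_def cover_diffs_Cons cover_diffs_Nil
proof (intro allI ballI)
  fix F w assume w: "w \<in> S_inf"
  have neq: "w i \<noteq> w (i + 1)" "w i \<noteq> w l" "w (i + 1) \<noteq> w l"
    using S_inf_eq_iff[OF w] il by auto
  have neq': "w p \<noteq> w i" if "i + 1 < p" for p
    using S_inf_eq_iff[OF w] that by auto
  have cov_i: "covers u l i \<longleftrightarrow> u i < u l \<and> \<not> (u i < u (i + 1) \<and> u (i + 1) < u l) \<and>
     (\<forall>p. i + 1 < p \<and> p < l \<longrightarrow> \<not> (u i < u p \<and> u p < u l))" for u
    using il unfolding covers_def by (simp only: all_between_Suc[OF il]) auto
  have cov_i1: "covers u l (i + 1) \<longleftrightarrow> u (i + 1) < u l \<and>
     (\<forall>p. i + 1 < p \<and> p < l \<longrightarrow> \<not> (u (i + 1) < u p \<and> u p < u l))" for u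
    using il unfolding covers_def by simp
  have t: "tr i (i + 1) l = l" "tr i l (i + 1) = i + 1" "tr (i + 1) l i = i" "tr i l i = l" "tr i l l = i"
    using il by (auto simp: transpose_def)
  have tp: "tr i (i + 1) p = p" "tr i l p = p" "tr (i + 1) l p = p" if "i + 1 < p" "p < l" for p
    using that by (auto simp: transpose_def)
  show "cover_diff l i (cover_diff l (i + 1) (\<lambda>w. F (dn i w))) w = cover_diff l i (cover_diff l (i + 1) F) (dn i w)"
  proof (cases "w i > w (i + 1)")
    case True
    show ?thesis
    proof (rule cover_diff_cover_diff_dn_descent)
      show "\<not> covers (w \<circ> tr i (i + 1) \<circ> tr i l) l (i + 1)"
        using True unfolding cov_i1 by (simp add: t)
      show "covers (w \<circ> tr i (i + 1)) l i \<longleftrightarrow> covers w l (i + 1) \<and> \<not> covers w l i"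
        unfolding cov_i cov_i1 using True neq by (auto simp: t tp)
      show "covers (w \<circ> tr i (i + 1)) l (i + 1) \<longleftrightarrow> covers w l i"
        unfolding cov_i cov_i1 using True neq by (auto simp: t tp)
      show "covers (w \<circ> tr i l) l (i + 1) \<longleftrightarrow> covers w l (i + 1)" if "covers w l i"
        using that True neq neq' unfolding cov_i cov_i1 by (auto simp: t tp) (metis linorder_neqE_nat order.strict_trans)+
      show "(w \<circ> tr i l) (i + 1) < (w \<circ> tr i l) i" if "covers w l i"
        using that True unfolding cov_i by (simp add: t)
      show "(w \<circ> tr (i + 1) l) i > (w \<circ> tr (i + 1) l) (i + 1) \<longleftrightarrow> \<not> covers w l i" if "covers w l (i + 1)"
        using that True neq unfolding cov_i cov_i1 by (auto simp: t)
      show "(w \<circ> tr i l \<circ> tr (i + 1) l) i > (w \<circ> tr i l \<circ> tr (i + 1) l) (i + 1)" if "covers w l i" "covers w l (i + 1)"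
        using that True neq unfolding cov_i cov_i1 by (auto simp: t)
    qed (use True il in auto)
  next
    case False
    show ?thesis
      by (rule cover_diff_cover_diff_dn_ascent) (use False neq in \<open>auto simp: t cov_i cov_i1\<close>)
  qed
qed

text \<open>To the right of \<open>l\<close> the farther position is \<open>i + 1\<close>, so it
  takes the role of \<open>x\<close>, in accordance with the reversed list on the right-hand side of
  the Monk rule.\<close>

lemma commutes_dn_near_right:
  assumes il: "l < i" and l: "1 \<le> l"
  shows "commutes_dn i l [i + 1, i]"
  unfolding commutes_dn_def cover_diffs_Cons cover_diffs_Nil
proof (intro allI ballI)
  fix F w assume w: "w \<in> S_inf"
  have neq: "w i \<noteq> w (i + 1)" "w i \<noteq> w l" "w (i + 1) \<noteq> w l"
    using S_inf_eq_iff[OF w] il by auto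
  have neq': "w p \<noteq> w (i + 1)" if "p < i" for p
    using S_inf_eq_iff[OF w] that by auto
  have cov_i1: "covers u l (i + 1) \<longleftrightarrow> u l < u (i + 1) \<and> \<not> (u l < u i \<and> u i < u (i + 1)) \<and>
     (\<forall>p. l < p \<and> p < i \<longrightarrow> \<not> (u l < u p \<and> u p < u (i + 1)))" for u
    using il unfolding covers_def by (simp only: all_between_pred[OF il]) auto
  have cov_i: "covers u l i \<longleftrightarrow> u l < u i \<and>
     (\<forall>p. l < p \<and> p < i \<longrightarrow> \<not> (u l < u p \<and> u p < u i))" for u
    using il unfolding covers_def by simp
  have t: "tr i (i + 1) l = l" "tr i l (i + 1) = i + 1" "tr (i + 1) l i = i"
     "tr (i + 1) l (i + 1) = l" "tr (i + 1) l l = i + 1"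
    using il by (auto simp: transpose_def)
  have tp: "tr i (i + 1) p = p" "tr i l p = p" "tr (i + 1) l p = p" if "l < p" "p < i" for p
    using that by (auto simp: transpose_def)
  show "cover_diff l (i + 1) (cover_diff l i (\<lambda>w. F (dn i w))) w = cover_diff l (i + 1) (cover_diff l i F) (dn i w)"
  proof (cases "w i > w (i + 1)")
    case True
    show ?thesis
    proof (rule cover_diff_cover_diff_dn_descent)
      show "\<not> covers (w \<circ> tr i (i + 1) \<circ> tr (i + 1) l) l i"
        using True unfolding cov_i by (simp add: t)
      show "covers (w \<circ> tr i (i + 1)) l (i + 1) \<longleftrightarrow> covers w l i \<and> \<not> covers w l (i + 1)"
        unfolding cov_i cov_i1 using True neq by (auto simp: t tp)
      show "covers (w \<circ> tr i (i + 1)) l i \<longleftrightarrow> covers w l (i + 1)"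
        unfolding cov_i cov_i1 using True neq by (auto simp: t tp)
      show "covers (w \<circ> tr (i + 1) l) l i \<longleftrightarrow> covers w l i" if "covers w l (i + 1)"
        using that True neq neq' unfolding cov_i cov_i1 by (auto simp: t tp) (metis linorder_neqE_nat order.strict_trans)+
      show "(w \<circ> tr (i + 1) l) (i + 1) < (w \<circ> tr (i + 1) l) i" if "covers w l (i + 1)"
        using that True unfolding cov_i1 by (simp add: t)
      show "(w \<circ> tr i l) i > (w \<circ> tr i l) (i + 1) \<longleftrightarrow> \<not> covers w l (i + 1)" if "covers w l i"
        using that True neq unfolding cov_i cov_i1 by (auto simp: t)
      show "(w \<circ> tr (i + 1) l \<circ> tr i l) i > (w \<circ> tr (i + 1) l \<circ> tr i l) (i + 1)" if "covers w l (i + 1)" "covers w l i"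
        using that True neq unfolding cov_i cov_i1 by (auto simp: t)
    qed (use True il in auto)
  next
    case False
    show ?thesis
      by (rule cover_diff_cover_diff_dn_ascent) (use False neq in \<open>auto simp: t cov_i cov_i1\<close>)
  qed
qed

text \<open>It replaces commutation with \<open>dn i\<close> when \<open>l\<close> is
  \<open>i\<close> or \<open>i + 1\<close>: operators at one of the two indices then correspond to
  operators at the other. Vanishing at ascents is part of the relation because a cover of a
  permutation with a descent at \<open>i\<close> may lead to one with an ascent, and such terms have
  no counterpart on the side of \<open>H\<close>.\<close>

definition swap_related :: "nat \<Rightarrow> ((nat \<Rightarrow> nat) \<Rightarrow> mpoly) \<Rightarrow> ((nat \<Rightarrow> nat) \<Rightarrow> mpoly) \<Rightarrow> bool" where
  "swap_related i H K \<longleftrightarrow> (\<forall>w\<in>S_inf. K w = (if w i > w (i + 1) then H (w \<circ> tr i (i + 1)) else 0))"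

text \<open>A cover at \<open>j\<close> that keeps the descent at \<open>i\<close> corresponds,
  after conjugation by \<open>s_i\<close>, to a cover at \<open>j'\<close> of \<open>w s_i\<close>;
  one that destroys it contributes a vanishing value of \<open>K\<close>. From an ascent at
  \<open>i\<close> no cover leads to a descent.\<close>

lemma swap_related_cover_diff:
  assumes R: "swap_related i H K" and i: "1 \<le> i" "1 \<le> a" and a: "a \<noteq> i" "a \<noteq> i + 1"
    and jj: "(j = i \<and> j' = i + 1) \<or> (j = i + 1 \<and> j' = i)"
  shows "swap_related i (cover_diff j' a H) (cover_diff j a K)"
  unfolding swap_related_def
proof
  fix w assume w: "w \<in> S_inf"
  let ?s = "tr i (i + 1)"
  have neq: "w i \<noteq> w (i + 1)" "w a \<noteq> w i" "w a \<noteq> w (i + 1)"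
    using S_inf_eq_iff[OF w] a by auto
  have w': "w \<circ> tr a j \<in> S_inf" using S_inf_comp_tr[OF w] i jj by auto
  have K: "K w = (if w i > w (i + 1) then H (w \<circ> ?s) else 0)"
    "K (w \<circ> tr a j) = (if (w \<circ> tr a j) i > (w \<circ> tr a j) (i + 1) then H (w \<circ> tr a j \<circ> ?s) else 0)"
    using R w w' unfolding swap_related_def by blast+
  have t: "w \<circ> tr a j \<circ> ?s = w \<circ> ?s \<circ> tr a j'"
  proof -
    have s: "?s = tr j j'" and d: "j \<noteq> j'" "j \<noteq> a" "j' \<noteq> a"
      using a jj by (auto simp: transpose_commute)
    show ?thesis unfolding s using tr_conj(1)[OF d] by (simp add: comp_assoc transpose_commute)
  qed
  have t1: "tr a i (i + 1) = i + 1" "tr a i i = a" "tr a (i + 1) i = i" "tr a (i + 1) (i + 1) = a" "?s a = a"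
    using a by (auto simp: transpose_def)
  have tp: "?s p = p" if "p < i \<or> i + 1 < p" for p
    using that by (auto simp: transpose_def)
  have "(\<not> w i > w (i + 1) \<longrightarrow> covers w j a \<longrightarrow> \<not> (w \<circ> tr a j) i > (w \<circ> tr a j) (i + 1)) \<and>
    (w i > w (i + 1) \<longrightarrow> (covers (w \<circ> ?s) j' a \<longleftrightarrow> covers w j a \<and> (w \<circ> tr a j) i > (w \<circ> tr a j) (i + 1)))"
  proof (cases "a < i")
    case True
    have "(\<forall>p. a < p \<and> p < i + 1 \<longrightarrow> P p) \<longleftrightarrow> P i \<and> (\<forall>p. a < p \<and> p < i \<longrightarrow> P p)" for P
      using True by (rule all_between_pred)
    then have cov_i1: "covers u (i + 1) a \<longleftrightarrow> u a < u (i + 1) \<and> \<not> (u a < u i \<and> u i < u (i + 1)) \<and>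
      (\<forall>p. a < p \<and> p < i \<longrightarrow> \<not> (u a < u p \<and> u p < u (i + 1)))" for u
      using True unfolding covers_def by auto
    have cov_i: "covers u i a \<longleftrightarrow> u a < u i \<and> (\<forall>p. a < p \<and> p < i \<longrightarrow> \<not> (u a < u p \<and> u p < u i))" for u
      using True unfolding covers_def by simp
    show ?thesis using jj neq by (auto simp: cov_i1 cov_i t1 tp)
  next
    case False
    then have ia: "i + 1 < a" using a by simp
    then have "(\<forall>p. i < p \<and> p < a \<longrightarrow> P p) \<longleftrightarrow> P (i + 1) \<and> (\<forall>p. i + 1 < p \<and> p < a \<longrightarrow> P p)" for P
      by (rule all_between_Suc)
    then have cov_i: "covers u i a \<longleftrightarrow> u i < u a \<and> \<not> (u i < u (i + 1) \<and> u (i + 1) < u a) \<and>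
      (\<forall>p. i + 1 < p \<and> p < a \<longrightarrow> \<not> (u i < u p \<and> u p < u a))" for u
      using ia unfolding covers_def by auto
    have cov_i1: "covers u (i + 1) a \<longleftrightarrow> u (i + 1) < u a \<and> (\<forall>p. i + 1 < p \<and> p < a \<longrightarrow> \<not> (u (i + 1) < u p \<and> u p < u a))" for u
      using ia unfolding covers_def by simp
    show ?thesis using jj neq by (auto simp: cov_i1 cov_i t1 tp)
  qed
  then have asc: "\<not> w i > w (i + 1) \<Longrightarrow> covers w j a \<Longrightarrow> \<not> (w \<circ> tr a j) i > (w \<circ> tr a j) (i + 1)"
    and desc: "w i > w (i + 1) \<Longrightarrow> covers (w \<circ> ?s) j' a \<longleftrightarrow> covers w j a \<and> (w \<circ> tr a j) i > (w \<circ> tr a j) (i + 1)"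
    by blast+
  show "cover_diff j a K w = (if w i > w (i + 1) then cover_diff j' a H (w \<circ> ?s) else 0)"
  proof (cases "w i > w (i + 1)")
    case True
    show ?thesis unfolding cover_diff_def desc[OF True] K t using True by simp
  next
    case False
    show ?thesis unfolding cover_diff_def K using False asc[OF False] by auto
  qed
qed

lemma swap_related_cover_diffs:
  assumes "swap_related i H K" "1 \<le> i" "\<forall>a\<in>set xs. 1 \<le> a \<and> a \<noteq> i \<and> a \<noteq> i + 1"
    and "(j = i \<and> j' = i + 1) \<or> (j = i + 1 \<and> j' = i)"
  shows "swap_related i (cover_diffs j' xs H) (cover_diffs j xs K)"
  using assms(3)
proof (induction xs)
  case (Cons a xs)
  then show ?case unfolding cover_diffs_Cons using assms by (intro swap_related_cover_diff) auto
qed (use assms in simp)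

lemma covers_adjacent: "covers w (i + 1) i \<longleftrightarrow> w i < w (i + 1)" "covers w i (i + 1) \<longleftrightarrow> w i < w (i + 1)"
  by (auto simp: covers_def)

text \<open>Of two corresponding lists only one contains the neighbouring position \<open>a\<close>.
  Here it is the list for \<open>H\<close>, and the difference on the other side, which stems from
  the product rule, makes up for it.\<close>

lemma swap_related_dn_diff:
  assumes "1 \<le> i" "(j = i \<and> a = i + 1) \<or> (j = i + 1 \<and> a = i)"
  shows "swap_related i (cover_diff j a F) (\<lambda>w. F (dn i w) - F w)"
proof -
  have "tr a j = tr i (i + 1)" using assms(2) by (auto simp: transpose_commute)
  moreover have "covers w j a \<longleftrightarrow> w i < w (i + 1)" for w using assms(2) covers_adjacent by auto
  ultimately show ?thesis unfolding swap_related_def cover_diff_def dn_def by simp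
qed

text \<open>Here the neighbouring position belongs to the list for \<open>K\<close>. Its factor
  cancels the value at an ascent, because \<open>dn i\<close> takes the same value at
  \<open>w\<close> and at \<open>w s_i\<close>.\<close>

lemma swap_related_dn:
  assumes "1 \<le> i" "(j = i \<and> a = i + 1) \<or> (j = i + 1 \<and> a = i)"
  shows "swap_related i F (cover_diff j a (\<lambda>w. F (dn i w)))"
  unfolding swap_related_def
proof
  fix w assume w: "w \<in> S_inf"
  have "w i \<noteq> w (i + 1)" using S_inf_eq_iff[OF w] by simp
  moreover have "tr a j = tr i (i + 1)" using assms(2) by (auto simp: transpose_commute)
  moreover have "covers w j a \<longleftrightarrow> w i < w (i + 1)" for w using assms(2) covers_adjacent by auto
  ultimately show "cover_diff j a (\<lambda>w. F (dn i w)) w = (if w i > w (i + 1) then F (w \<circ> tr i (i + 1)) else 0)"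
    unfolding cover_diff_def dn_def by (auto simp: comp_assoc)
qed

section \<open>The induction for the Monk rule\<close>

lemma upt_split_adjacent:
  assumes "1 \<le> i" "i + 1 < l"
  shows "[1..<l] = [1..<i] @ [i, i + 1] @ [i + 2..<l]"
proof -
  have "[1..<l] = [1..<i] @ [i..<l]" using upt_add_eq_append[of 1 i "l - i"] assms by simp
  also have "[i..<l] = i # (i + 1) # [i + 2..<l]" using assms by (simp add: upt_conv_Cons)
  finally show ?thesis by simp
qed

lemma rev_upt_split_adjacent:
  assumes "l < i" "i < N"
  shows "rev [l + 1..<N + 2] = rev [i + 2..<N + 2] @ [i + 1, i] @ rev [l + 1..<i]"
proof -
  have "[l + 1..<N + 2] = [l + 1..<i] @ [i..<N + 2]"
    using upt_add_eq_append[of "l + 1" i "N + 2 - i"] assms by simp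
  also have "[i..<N + 2] = i # (i + 1) # [i + 2..<N + 2]" using assms by (simp add: upt_conv_Cons)
  finally show ?thesis by simp
qed

text \<open>The list up to \<open>N + 1\<close> contains every right cover of \<open>v\<close> at
  \<open>l\<close>: for a position beyond it, the entry \<open>N + 1\<close> in position
  \<open>N + 1\<close> lies between the two entries to be exchanged.\<close>

lemma K_Monk:
  assumes "v \<in> S N" "1 \<le> l" "l \<le> N"
  shows "(1 - X l) * cover_diffs l [1..<l] Groth v = cover_diffs l (rev [l + 1..<N + 2]) Groth v"
  using assms
proof (induction "N * N - len v" arbitrary: v l rule: less_induct)
  case less
  note v = less.prems(1) and l = less.prems(2,3)
  show ?case
  proof (cases "v = longest N")
    case True
    have "cover_diffs l [1..<l] Groth v = Groth v"
      using l by (intro cover_diffs_trivial) (auto simp: covers_def longest_def True)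
    moreover have "cover_diffs l (rev [l + 1..<N + 2]) Groth v = Groth v - Groth (v \<circ> tr (N + 1) l)"
    proof -
      have "rev [l + 1..<N + 2] = (N + 1) # rev [l + 1..<N + 1]" using l by (simp add: One_nat_def)
      moreover have "covers v l (N + 1)" using l by (auto simp: covers_def longest_def True)
      moreover have "cover_diffs l (rev [l + 1..<N + 1]) Groth v = Groth v"
        using l by (intro cover_diffs_trivial) (auto simp: covers_def longest_def True)
      moreover have "cover_diffs l (rev [l + 1..<N + 1]) Groth (v \<circ> tr (N + 1) l) = Groth (v \<circ> tr (N + 1) l)"
        using l by (intro cover_diffs_trivial) (auto simp: covers_def longest_def True transpose_def)
      ultimately show ?thesis by (simp add: cover_diffs_Cons cover_diff_def)
    qed
    moreover have "Groth (v \<circ> tr (N + 1) l) = X l * Groth v"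
      using Groth_longest_transpose[OF l] by (simp add: True transpose_commute)
    ultimately show ?thesis by (simp add: algebra_simps)
  next
    case False
    then obtain i where i: "1 \<le> i" "i < N" "\<not> v i > v (i + 1)"
      using decreasing_imp_longest[OF v] by blast
    have vi: "v \<in> S_inf" using v by (rule S_subset_S_inf)
    have lt: "v i < v (i + 1)" using i S_inf_eq_iff[OF vi, of i "i + 1"] by simp
    define u where "u = v \<circ> tr i (i + 1)"
    have u: "u \<in> S N" unfolding u_def using i v by (intro S_comp_tr) auto
    have ui: "u \<in> S_inf" using u by (rule S_subset_S_inf)
    have desc: "u i > u (i + 1)" using lt by (simp add: u_def)
    have v_eq: "v = u \<circ> tr i (i + 1)" by (simp add: u_def)
    have dnu: "dn i u = v" using desc by (simp add: dn_def v_eq)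
    have "N * N - len u < N * N - len v"
      using len_ascent[OF vi i(1) lt] len_le[OF u] by (simp add: u_def)
    then have IH: "(1 - X k) * cover_diffs k [1..<k] Groth u = cover_diffs k (rev [k + 1..<N + 2]) Groth u"
      if "1 \<le> k" "k \<le> N" for k using less.hyps u that by blast
    have dop: "demazure i (cover_diffs k xs Groth u) = cover_diffs k xs (\<lambda>w. Groth (dn i w)) u"
      if "1 \<le> k" "\<forall>a\<in>set xs. 1 \<le> a" for k xs
      unfolding demazure_cover_diffs using that ui i(1) by (intro cover_diffs_cong) (auto simp: demazure_Groth)
    have dIH: "demazure i ((1 - X k) * cover_diffs k [1..<k] Groth u) =
        cover_diffs k (rev [k + 1..<N + 2]) (\<lambda>w. Groth (dn i w)) u" if "1 \<le> k" "k \<le> N" for k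
      unfolding IH[OF that] using that by (intro dop) auto
    have cover_diffs_diff: "cover_diffs k xs (\<lambda>w. F w - H w) w = cover_diffs k xs F w - cover_diffs k xs H w" for k xs F H w
      by (induction xs arbitrary: w) (simp_all add: cover_diffs_Cons cover_diff_def)
    have swapped: "K u = H v" if "swap_related i H K" for H K
      using that ui desc by (simp add: swap_related_def v_eq)
    consider "l \<noteq> i" "l \<noteq> i + 1" | "l = i + 1" | "l = i" by blast
    then show ?thesis
    proof cases
      case 1
      have cA: "commutes_dn i l [1..<l]"
      proof (cases "i + 1 < l")
        case True
        then show ?thesis unfolding upt_split_adjacent[OF i(1) True]
          using 1 i l
          by (intro commutes_dn_append commutes_dn_near_left[OF True i(1)] commutes_dn_far[of l i]) auto
      next
        case False
        then show ?thesis using 1 l by (intro commutes_dn_far) auto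
      qed
      have cB: "commutes_dn i l (rev [l + 1..<N + 2])"
      proof (cases "l < i")
        case True
        then show ?thesis unfolding rev_upt_split_adjacent[OF True i(2)]
          using 1 i l
          by (intro commutes_dn_append commutes_dn_near_right[OF True l(1)] commutes_dn_far[of l i]) auto
      next
        case False
        then show ?thesis using 1 l by (intro commutes_dn_far) auto
      qed
      have "swap_vars i (1 - X l) = 1 - X l" using 1 by (simp add: transpose_def)
      then have "(1 - X l) * demazure i (cover_diffs l [1..<l] Groth u) = cover_diffs l (rev [l + 1..<N + 2]) (\<lambda>w. Groth (dn i w)) u"
        using dIH[OF l] demazure_mult_symmetric by simp
      then show ?thesis
        using cA cB ui l dop[of l "[1..<l]"] by (simp add: commutes_dn_def dnu)
    next
      case 2
      \<comment> \<open>The rule for \<open>u\<close> at \<open>i\<close> yields the rule for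
        \<open>v\<close> at \<open>i + 1\<close>.\<close>
      have "(1 - X (i + 1)) * (demazure i (cover_diffs i [1..<i] Groth u) - cover_diffs i [1..<i] Groth u) =
          cover_diffs i (rev [i + 1..<N + 2]) (\<lambda>w. Groth (dn i w)) u"
        using dIH[of i] i demazure_times_y(1) by simp
      moreover have "demazure i (cover_diffs i [1..<i] Groth u) - cover_diffs i [1..<i] Groth u =
          cover_diffs i [1..<i] (\<lambda>w. Groth (dn i w) - Groth w) u"
        using i by (simp add: cover_diffs_diff dop)
      moreover have "cover_diffs i [1..<i] (\<lambda>w. Groth (dn i w) - Groth w) u = cover_diffs l [1..<l] Groth v"
      proof (rule swapped)
        have e: "[1..<l] = [1..<i] @ [i]" using 2 i by (simp add: One_nat_def)
        have "swap_related i (cover_diffs l [1..<i] (cover_diff l i Groth)) (cover_diffs i [1..<i] (\<lambda>w. Groth (dn i w) - Groth w))"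
          using 2 i by (intro swap_related_cover_diffs swap_related_dn_diff) auto
        then show "swap_related i (cover_diffs l [1..<l] Groth) (cover_diffs i [1..<i] (\<lambda>w. Groth (dn i w) - Groth w))"
          by (simp only: e cover_diffs_append cover_diffs_Cons cover_diffs_Nil)
      qed
      moreover have "cover_diffs i (rev [i + 1..<N + 2]) (\<lambda>w. Groth (dn i w)) u = cover_diffs l (rev [l + 1..<N + 2]) Groth v"
      proof (rule swapped)
        have e: "rev [i + 1..<N + 2] = rev [l + 1..<N + 2] @ [i + 1]" using i 2 by (simp add: upt_conv_Cons One_nat_def)
        have "swap_related i (cover_diffs l (rev [l + 1..<N + 2]) Groth)
            (cover_diffs i (rev [l + 1..<N + 2]) (cover_diff i (i + 1) (\<lambda>w. Groth (dn i w))))"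
          using 2 i by (intro swap_related_cover_diffs swap_related_dn) auto
        then show "swap_related i (cover_diffs l (rev [l + 1..<N + 2]) Groth) (cover_diffs i (rev [i + 1..<N + 2]) (\<lambda>w. Groth (dn i w)))"
          by (simp only: e cover_diffs_append cover_diffs_Cons cover_diffs_Nil)
      qed
      ultimately show ?thesis using 2 by simp
    next
      case 3
      \<comment> \<open>The rule for \<open>u\<close> at \<open>i + 1\<close> yields the rule for
        \<open>v\<close> at \<open>i\<close>. The second summand of the product rule has been
        replaced by means of the rule for \<open>u\<close> itself.\<close>
      have "(1 - X i) * demazure i (cover_diffs (i + 1) [1..<i + 1] Groth u) + cover_diffs (i + 1) (rev [i + 1 + 1..<N + 2]) Groth u =
          cover_diffs (i + 1) (rev [i + 1 + 1..<N + 2]) (\<lambda>w. Groth (dn i w)) u"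
        using dIH[of "i + 1"] IH[of "i + 1"] i unfolding demazure_times_y(2) by simp
      then have "(1 - X i) * cover_diffs (i + 1) [1..<i + 1] (\<lambda>w. Groth (dn i w)) u =
          cover_diffs (i + 1) (rev [i + 1 + 1..<N + 2]) (\<lambda>w. Groth (dn i w) - Groth w) u"
        unfolding cover_diffs_diff using i dop[of "i + 1" "[1..<i + 1]"] by (simp add: algebra_simps)
      moreover have "cover_diffs (i + 1) [1..<i + 1] (\<lambda>w. Groth (dn i w)) u = cover_diffs l [1..<l] Groth v"
      proof (rule swapped)
        have e: "[1..<i + 1] = [1..<l] @ [i]" using 3 i by (simp add: One_nat_def)
        have "swap_related i (cover_diffs l [1..<l] Groth) (cover_diffs (i + 1) [1..<l] (cover_diff (i + 1) i (\<lambda>w. Groth (dn i w))))"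
          using 3 i by (intro swap_related_cover_diffs swap_related_dn) auto
        then show "swap_related i (cover_diffs l [1..<l] Groth) (cover_diffs (i + 1) [1..<i + 1] (\<lambda>w. Groth (dn i w)))"
          by (simp only: e cover_diffs_append cover_diffs_Cons cover_diffs_Nil)
      qed
      moreover have "cover_diffs (i + 1) (rev [i + 1 + 1..<N + 2]) (\<lambda>w. Groth (dn i w) - Groth w) u = cover_diffs l (rev [l + 1..<N + 2]) Groth v"
      proof (rule swapped)
        have e: "rev [l + 1..<N + 2] = rev [i + 1 + 1..<N + 2] @ [i + 1]" using i 3 by (simp add: upt_conv_Cons One_nat_def)
        have "swap_related i (cover_diffs l (rev [i + 1 + 1..<N + 2]) (cover_diff l (i + 1) Groth))
            (cover_diffs (i + 1) (rev [i + 1 + 1..<N + 2]) (\<lambda>w. Groth (dn i w) - Groth w))"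
          using 3 i by (intro swap_related_cover_diffs swap_related_dn_diff) auto
        then show "swap_related i (cover_diffs l (rev [l + 1..<N + 2]) Groth) (cover_diffs (i + 1) (rev [i + 1 + 1..<N + 2]) (\<lambda>w. Groth (dn i w) - Groth w))"
          by (simp only: e cover_diffs_append cover_diffs_Cons cover_diffs_Nil)
      qed
      ultimately show ?thesis using 3 by simp
    qed
  qed
qed

declare One_nat_def [simp]

section \<open>Transition\<close>

text \<open>On \<open>S_inf\<close> equivalent to \<open>last_descent w \<le> l\<close>, in a form
  free of maxima.\<close>

definition asc_after :: "(nat \<Rightarrow> nat) \<Rightarrow> nat \<Rightarrow> bool" where
  "asc_after w l \<longleftrightarrow> (\<forall>p>l. w p < w (p + 1))"

lemma asc_afterD:
  assumes "asc_after w l" "l < p" "p < q"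
  shows "w p < w q"
  using assms(3)
proof (induction q rule: less_induct)
  case (less q)
  show ?case
  proof (cases "p + 1 = q")
    case True
    then show ?thesis using assms by (auto simp: asc_after_def)
  next
    case False
    then have "w p < w (q - 1)" "l < q - 1" "q - 1 + 1 = q" using less assms(2) by auto
    then show ?thesis using assms(1) unfolding asc_after_def by (metis order.strict_trans)
  qed
qed

lemma asc_after_less_iff: "asc_after w l \<Longrightarrow> l < p \<Longrightarrow> l < q \<Longrightarrow> w p < w q \<longleftrightarrow> p < q"
  by (metis asc_afterD linorder_neqE_nat order_less_asym order_less_irrefl)

text \<open>As the entries after \<open>l\<close> increase, the last two conditions determine
  \<open>k\<close>, and \<open>(l, w k)\<close> is the maximal corner of the diagram.\<close>

definition corner :: "(nat \<Rightarrow> nat) \<Rightarrow> nat \<Rightarrow> nat \<Rightarrow> bool" where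
  "corner w l k \<longleftrightarrow> w \<in> S_inf \<and> 1 \<le> l \<and> l < k \<and> asc_after w l \<and> w k < w l \<and> w l < w (k + 1)"

lemma cornerD:
  assumes "corner w l k"
  shows "w \<in> S_inf" "1 \<le> l" "l < k" "asc_after w l" "w k < w l" "w l < w (k + 1)"
    "\<And>q. l < q \<Longrightarrow> w q < w l \<longleftrightarrow> q \<le> k"
proof -
  show *: "w \<in> S_inf" "1 \<le> l" "l < k" "asc_after w l" "w k < w l" "w l < w (k + 1)"
    using assms by (auto simp: corner_def)
  fix q assume q: "l < q"
  show "w q < w l \<longleftrightarrow> q \<le> k"
  proof
    assume "q \<le> k"
    then show "w q < w l" using * asc_afterD[OF *(4) q, of k] by (cases "q = k") auto
  next
    assume "w q < w l"
    then have "w q < w (k + 1)" using * by simp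
    then have "q < k + 1" using asc_after_less_iff[OF *(4) q] * by auto
    then show "q \<le> k" by simp
  qed
qed

lemma corner_swap:
  assumes "corner w l k"
  shows "w \<circ> tr l k \<in> S_inf" "(w \<circ> tr l k) l = w k" "(w \<circ> tr l k) k = w l"
    "\<And>p. p \<noteq> l \<Longrightarrow> p \<noteq> k \<Longrightarrow> (w \<circ> tr l k) p = w p"
    "asc_after (w \<circ> tr l k) l"
proof -
  note c = cornerD[OF assms]
  show "w \<circ> tr l k \<in> S_inf" using c by (intro S_inf_comp_tr) auto
  show "(w \<circ> tr l k) l = w k" "(w \<circ> tr l k) k = w l"
    "\<And>p. p \<noteq> l \<Longrightarrow> p \<noteq> k \<Longrightarrow> (w \<circ> tr l k) p = w p"
    by (auto simp: transpose_def)
  show "asc_after (w \<circ> tr l k) l"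
    unfolding asc_after_def
  proof (intro allI impI)
    fix p assume p: "p > l"
    have "w p < w l" if "p + 1 = k" using c(7)[of p] that p by simp
    then show "(w \<circ> tr l k) p < (w \<circ> tr l k) (p + 1)"
      using p c(4,6) unfolding asc_after_def by (auto simp: transpose_def)
  qed
qed

text \<open>In \<open>w t_lk\<close> the entry at \<open>l\<close> is \<open>w k\<close>. Positions
  between \<open>l\<close> and \<open>k\<close> hold smaller entries, and for positions beyond
  \<open>k\<close> the entry \<open>w l\<close> at \<open>k\<close> lies in between.\<close>

lemma corner_covers:
  assumes "corner w l k" "l < q"
  shows "covers (w \<circ> tr l k) l q \<longleftrightarrow> q = k"
proof -
  note c = cornerD[OF assms(1)] and s = corner_swap[OF assms(1)]
  consider "q < k" | "q = k" | "q > k" by linarith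
  then show ?thesis
  proof cases
    case 1
    then have "(w \<circ> tr l k) q < (w \<circ> tr l k) l"
      using assms(2) s asc_afterD[OF c(4) assms(2) 1] by simp
    then show ?thesis using 1 assms(2) by (auto simp: covers_def)
  next
    case 2
    have "(w \<circ> tr l k) p < (w \<circ> tr l k) l" if "l < p" "p < k" for p
      using that s(2) s(4)[of p] asc_afterD[OF c(4) that] by simp
    then have "\<not> (w \<circ> tr l k) l < (w \<circ> tr l k) p" if "l < p" "p < k" for p
      using that less_asym by blast
    moreover have "(w \<circ> tr l k) l < (w \<circ> tr l k) k" using c s by simp
    ultimately show ?thesis using 2 c(3) unfolding covers_def by auto
  next
    case 3
    have "(w \<circ> tr l k) k < (w \<circ> tr l k) q" using asc_afterD[OF s(5) c(3) 3] .
    moreover have "(w \<circ> tr l k) l < (w \<circ> tr l k) k" using c s by simp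
    ultimately show ?thesis using 3 c(3) by (auto simp: covers_def)
  qed
qed

text \<open>On the right-hand side of the Monk rule only the factor at \<open>k\<close> survives:
  the other positions are no covers of \<open>v\<close>, and after the exchange with
  \<open>k\<close> the positions before \<open>k\<close> hold entries below the one at
  \<open>l\<close>. The statement speaks of covers instead of \<open>corner\<close> so as to apply
  to star products, which may descend after \<open>l\<close>.\<close>

lemma transition_covers:
  assumes v: "v \<in> S_inf" "1 \<le> l" "l < k"
    and covers: "\<And>q. l < q \<Longrightarrow> covers v l q \<longleftrightarrow> q = k"
    and below: "\<And>q. l < q \<Longrightarrow> q < k \<Longrightarrow> v q < v k"
  shows "Groth (v \<circ> tr l k) = Groth v - (1 - X l) * cover_diffs l [1..<l] Groth v"
proof -
  obtain N where N: "v \<in> S N" "N \<ge> k" using S_infE[OF v(1)] by blast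
  have "[l + 1..<N + 2] = [l + 1..<k] @ k # [k + 1..<N + 2]"
    using upt_add_eq_append[of "l + 1" k "N + 2 - k"] v N by (simp add: upt_conv_Cons)
  then have e: "rev [l + 1..<N + 2] = rev [k + 1..<N + 2] @ k # rev [l + 1..<k]" by simp
  have "cover_diffs l (rev [l + 1..<N + 2]) Groth v = cover_diffs l (k # rev [l + 1..<k]) Groth v"
    unfolding e cover_diffs_append using covers v by (intro cover_diffs_trivial) auto
  also have "\<dots> = cover_diffs l (rev [l + 1..<k]) Groth v - cover_diffs l (rev [l + 1..<k]) Groth (v \<circ> tr k l)"
    using covers[OF v(3)] by (simp add: cover_diffs_Cons cover_diff_def)
  also have "cover_diffs l (rev [l + 1..<k]) Groth v = Groth v"
    using covers v by (intro cover_diffs_trivial) auto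
  also have "cover_diffs l (rev [l + 1..<k]) Groth (v \<circ> tr k l) = Groth (v \<circ> tr k l)"
  proof (rule cover_diffs_trivial, rule ballI)
    fix q assume "q \<in> set (rev [l + 1..<k])"
    then have q: "l < q" "q < k" by auto
    then have "(v \<circ> tr k l) q < (v \<circ> tr k l) l" using below[OF q] by (simp add: transpose_def)
    then show "\<not> covers (v \<circ> tr k l) l q" using q unfolding covers_def by auto
  qed
  finally have "cover_diffs l (rev [l + 1..<N + 2]) Groth v = Groth v - Groth (v \<circ> tr k l)" .
  moreover have "l \<le> N" using v N by simp
  ultimately have "(1 - X l) * cover_diffs l [1..<l] Groth v = Groth v - Groth (v \<circ> tr k l)"
    using K_Monk[OF N(1) v(2)] by metis
  then show ?thesis by (simp add: transpose_commute[of k])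
qed

lemma transition:
  assumes "corner w l k"
  shows "Groth w = Groth (w \<circ> tr l k) - (1 - X l) * cover_diffs l [1..<l] Groth (w \<circ> tr l k)"
proof -
  note c = cornerD[OF assms] and s = corner_swap[OF assms]
  have "Groth (w \<circ> tr l k \<circ> tr l k) = Groth (w \<circ> tr l k) - (1 - X l) * cover_diffs l [1..<l] Groth (w \<circ> tr l k)"
    using corner_covers[OF assms] asc_afterD[OF s(5)] by (intro transition_covers[OF s(1) c(2,3)])
  then show ?thesis by simp
qed

section \<open>Chains of covers to the left of \<open>l\<close>\<close>

definition chain :: "(nat \<Rightarrow> nat) \<Rightarrow> nat \<Rightarrow> nat list \<Rightarrow> nat \<Rightarrow> nat" where
  "chain w l as = foldl (\<lambda>u a. u \<circ> tr a l) w as"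

lemma chain_simps [simp]: "chain w l [] = w" "chain w l (a # as) = chain (w \<circ> tr a l) l as"
  by (simp_all add: chain_def)

text \<open>No entry in positions between \<open>a\<close> and \<open>l\<close> has a value between
  \<open>w a\<close> and \<open>w l\<close>, so comparing these entries with the new entry at
  \<open>l\<close> gives the same answers as with the old one. An increasing chain can therefore be
  prescribed by any set of covers of the starting permutation.\<close>

lemma covers_after_tr:
  assumes "covers w l a" "a < p" "p < l" "w \<in> S_inf"
  shows "covers (w \<circ> tr a l) l p \<longleftrightarrow> covers w l p"
proof -
  have a: "w a < w l" "\<And>q. a < q \<Longrightarrow> q < l \<Longrightarrow> w q < w a \<or> w l < w q"
    using assms(1-3) S_inf_eq_iff[OF assms(4)]
    by (auto simp: covers_def) (metis linorder_neqE_nat order_less_irrefl)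
  have t: "tr a l l = a" "\<And>q. a < q \<Longrightarrow> q < l \<Longrightarrow> tr a l q = q"
    by (auto simp: transpose_def)
  have "covers (w \<circ> tr a l) l p \<longleftrightarrow> w p < w a \<and> (\<forall>q. p < q \<and> q < l \<longrightarrow> \<not> (w p < w q \<and> w q < w a))"
    using assms(2,3) t by (auto simp: covers_def)
  also have "\<dots> \<longleftrightarrow> w p < w l \<and> (\<forall>q. p < q \<and> q < l \<longrightarrow> \<not> (w p < w q \<and> w q < w l))"
    using a assms(2,3) by (meson order.strict_trans order_less_asym)
  also have "\<dots> \<longleftrightarrow> covers w l p" using assms(3) by (simp add: covers_def)
  finally show ?thesis .
qed

text \<open>Multiplying out the factors means deciding for each position whether to exchange it; by
  \<open>covers_after_tr\<close> the positions available later do not depend on the decisions made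
  before.\<close>

lemma cover_diffs_expand:
  assumes "1 \<le> a" "w \<in> S_inf" "1 \<le> l"
  shows "cover_diffs l [a..<l] F w = (\<Sum>I\<in>Pow {p. a \<le> p \<and> p < l \<and> covers w l p}.
     (- 1) ^ card I * F (chain w l (sorted_list_of_set I)))"
  using assms(1,2)
proof (induction "l - a" arbitrary: a w)
  case 0
  then have "{p. a \<le> p \<and> p < l \<and> covers w l p} = {}" "[a..<l] = []" by auto
  then show ?case by (simp only:) simp
next
  case (Suc d)
  let ?Q = "{p. Suc a \<le> p \<and> p < l \<and> covers w l p}"
  let ?f = "\<lambda>w I. (- 1) ^ card I * F (chain w l (sorted_list_of_set I))"
  have al: "a < l" using Suc by simp
  have fin: "finite ?Q" by (rule finite_subset[of _ "{..<l}"]) auto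
  have w': "w \<circ> tr a l \<in> S_inf" using Suc.prems assms(3) by (intro S_inf_comp_tr) auto
  have IH: "cover_diffs l [Suc a..<l] F u = (\<Sum>I\<in>Pow {p. Suc a \<le> p \<and> p < l \<and> covers u l p}. ?f u I)" if "u \<in> S_inf" for u
    using Suc that by (intro Suc.hyps(1)) auto
  have cover_diffs: "cover_diffs l [a..<l] F w = cover_diffs l [Suc a..<l] F w - (if covers w l a then cover_diffs l [Suc a..<l] F (w \<circ> tr a l) else 0)"
    using al by (simp add: upt_conv_Cons cover_diffs_Cons cover_diff_def)
  show ?case
  proof (cases "covers w l a")
    case False
    then have "a \<le> p \<and> p < l \<and> covers w l p \<longleftrightarrow> Suc a \<le> p \<and> p < l \<and> covers w l p" for p
      by (cases "p = a") auto
    then have "{p. a \<le> p \<and> p < l \<and> covers w l p} = ?Q" by simp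
    then show ?thesis using cover_diffs False IH[OF Suc.prems(2)] by simp
  next
    case True
    have "a \<le> p \<and> p < l \<and> covers w l p \<longleftrightarrow> p = a \<or> Suc a \<le> p \<and> p < l \<and> covers w l p" for p
      using True al by (cases "p = a") auto
    then have Q: "{p. a \<le> p \<and> p < l \<and> covers w l p} = insert a ?Q" by auto
    have Q': "{p. Suc a \<le> p \<and> p < l \<and> covers (w \<circ> tr a l) l p} = ?Q"
      using covers_after_tr[OF True _ _ Suc.prems(2)] by (auto simp: Suc_le_eq)
    have ins: "?f w (insert a I) = - ?f (w \<circ> tr a l) I" if "I \<in> Pow ?Q" for I
    proof -
      have I: "finite I" "a \<notin> I" using that finite_subset[OF _ fin] by auto
      have "sorted_list_of_set (insert a I) = a # sorted_list_of_set I"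
      proof (rule sorted_list_of_set_unique[THEN iffD1])
        show "finite (insert a I)" using I by simp
        show "sorted_wrt (<) (a # sorted_list_of_set I) \<and> set (a # sorted_list_of_set I) = insert a I
          \<and> length (a # sorted_list_of_set I) = card (insert a I)"
          using I that by (auto simp: strict_sorted_iff Suc_le_eq)
      qed
      then show ?thesis using I by simp
    qed
    have inj: "inj_on (insert a) (Pow ?Q)" by (rule inj_on_inverseI[where g = "\<lambda>A. A - {a}"]) auto
    have "(\<Sum>I\<in>Pow (insert a ?Q). ?f w I) = (\<Sum>I\<in>Pow ?Q. ?f w I) + (\<Sum>I\<in>insert a ` Pow ?Q. ?f w I)"
      unfolding Pow_insert using fin by (intro sum.union_disjoint) auto
    also have "(\<Sum>I\<in>insert a ` Pow ?Q. ?f w I) = (\<Sum>I\<in>Pow ?Q. - ?f (w \<circ> tr a l) I)"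
      by (rule trans[OF sum.reindex[OF inj] sum.cong[OF refl]]) (simp only: comp_apply ins)
    finally show ?thesis
      using cover_diffs True IH[OF Suc.prems(2)] IH[OF w'] unfolding Q Q' by (simp add: sum_negf)
  qed
qed

lemma chain_S_inf:
  assumes "w \<in> S_inf" "\<forall>a\<in>set as. 1 \<le> a" "1 \<le> l"
  shows "chain w l as \<in> S_inf"
  using assms(1,2)
proof (induction as arbitrary: w)
  case (Cons a as)
  then show ?case using S_inf_comp_tr[of w a l] assms(3) by simp
qed simp

lemma chain_outside:
  assumes "\<forall>a\<in>set as. a < l" "p > l"
  shows "chain w l as p = w p"
  using assms(1)
proof (induction as arbitrary: w)
  case (Cons a as)
  then show ?case using assms(2) by (simp add: transpose_def)
qed simp

lemma chain_le:
  assumes "w \<in> S_inf" "sorted_wrt (<) as" "\<forall>a\<in>set as. 1 \<le> a \<and> a < l \<and> covers w l a" "1 \<le> l"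
  shows "chain w l as l \<le> w l"
  using assms(1-3)
proof (induction as arbitrary: w)
  case (Cons a as)
  have covers': "1 \<le> p \<and> p < l \<and> covers (w \<circ> tr a l) l p" if "p \<in> set as" for p
    using that Cons.prems covers_after_tr[of w l a p] by auto
  have "chain (w \<circ> tr a l) l as l \<le> (w \<circ> tr a l) l"
  proof (intro Cons.IH)
    show "w \<circ> tr a l \<in> S_inf" using Cons.prems assms(4) by (intro S_inf_comp_tr) auto
    show "\<forall>p\<in>set as. 1 \<le> p \<and> p < l \<and> covers (w \<circ> tr a l) l p" using covers' by blast
  qed (use Cons.prems in simp)
  also have "\<dots> \<le> w l" using Cons.prems by (auto simp: covers_def)
  finally show ?case by simp
qed simp

section \<open>Induction along corners\<close>

lemma asc_after_0_imp_id:
  assumes "w \<in> S_inf" "asc_after w 0"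
  shows "w = id"
proof -
  obtain N where N: "w \<in> S N" using assms(1) by (auto simp: S_inf_def)
  have low: "p \<le> w p" for p
  proof (induction p)
    case (Suc p)
    then show ?case using S_inf_ge_1[OF assms(1), of "Suc p"] asc_afterD[OF assms(2), of p "Suc p"]
      by (cases "p = 0") auto
  qed simp
  have "w p \<le> p" if "p \<le> N" for p
    using that
  proof (induction rule: inc_induct)
    case base
    then show ?case using S_inside[OF N, of N] S_inf_0[OF assms(1)] by (cases "N = 0") auto
  next
    case (step n)
    then show ?case using asc_afterD[OF assms(2), of n "Suc n"] S_inf_0[OF assms(1)] by (cases "n = 0") auto
  qed
  then have "w p = p" for p using low[of p] S_outside[OF N, of p] by (cases "p \<le> N") (auto intro: antisym)
  then show ?thesis by auto
qed

text \<open>The well-founded order behind this rule compares the last descent \<open>l\<close> first and then the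
  number \<open>k - l\<close> of boxes in row \<open>l\<close> of the diagram.\<close>

lemma corner_induct [consumes 1, case_names id step]:
  assumes "w \<in> S_inf"
    and id: "P id"
    and step: "\<And>w l k. corner w l k \<Longrightarrow>
      (\<And>u. u \<in> S_inf \<Longrightarrow> asc_after u l \<Longrightarrow> u k > u l \<Longrightarrow> P u) \<Longrightarrow> P w"
  shows "P w"
proof -
  have *: "P w" if "w \<in> S_inf" "asc_after w l" for w l
    using that
  proof (induction l arbitrary: w)
    case 0
    then show ?case using asc_after_0_imp_id id by blast
  next
    case (Suc l)
    let ?l = "Suc l"
    have "P u" if "u \<in> S_inf" "asc_after u ?l" "u (?l + c + 1) > u ?l" for u c
      using that
    proof (induction c arbitrary: u)
      case 0
      then have "asc_after u l" unfolding asc_after_def by (metis Suc_lessI add.right_neutral)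
      then show ?case using Suc.IH 0 by blast
    next
      case (Suc c)
      show ?case
      proof (cases "u (?l + c + 1) > u ?l")
        case True
        then show ?thesis using Suc by blast
      next
        case False
        then have "u (?l + c + 1) < u ?l"
          using S_inf_eq_iff[OF Suc.prems(1), of "?l + c + 1" ?l] by simp
        then have "corner u ?l (?l + c + 1)" using Suc.prems by (simp add: corner_def)
        then show ?thesis using step Suc.IH by blast
      qed
    qed
    moreover obtain N where N: "w \<in> S N" "N \<ge> ?l" using S_infE[OF Suc.prems(1)] by blast
    have "w ?l < w (?l + N + 1)"
      using S_outside[OF N(1), of "?l + N + 1"] S_inside[OF N(1), of ?l] N(2) by simp
    ultimately show ?case using Suc.prems by blast
  qed
  obtain N where N: "w \<in> S N" using assms(1) by (auto simp: S_inf_def)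
  have "asc_after w N" unfolding asc_after_def using S_outside[OF N] by simp
  then show ?thesis using * assms(1) by blast
qed

section \<open>Diagrams and marching\<close>

text \<open>Naming a column by the position \<open>c\<close> of its dot removes the inverse: the box
  \<open>(p, w c)\<close> is the inversion \<open>(p, c)\<close>.\<close>

lemma diagram_iff:
  assumes "w \<in> S_inf"
  shows "(p, w c) \<in> diagram w \<longleftrightarrow> 1 \<le> p \<and> p < c \<and> w c < w p"
proof -
  have "inv w (w c) = c" using S_inf_inj[OF assms] by simp
  moreover have "1 \<le> w c \<longleftrightarrow> 1 \<le> c" using S_inf_ge_1[OF assms] .
  ultimately show ?thesis by (auto simp: diagram_def)
qed

lemma diagram_eqI:
  assumes "w \<in> S_inf"
    "\<And>p c. (p, w c) \<in> B \<longleftrightarrow> 1 \<le> p \<and> p < c \<and> w c < w p"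
  shows "diagram w = B"
proof (intro set_eqI)
  fix x :: "nat \<times> nat"
  obtain p q where x: "x = (p, q)" by (cases x)
  obtain c where "q = w c" using bij_pointE[OF S_inf_bij[OF assms(1)], of q] by metis
  then show "x \<in> diagram w \<longleftrightarrow> x \<in> B" using diagram_iff[OF assms(1)] assms(2) x by simp
qed

text \<open>A dot is never a box. If the rows above \<open>p\<close> agree and
  \<open>u p > w p\<close>, the value \<open>w p\<close> occurs in \<open>u\<close> below row
  \<open>p\<close>, so \<open>(p, w p)\<close> would be a box of the common diagram although it is a
  dot of \<open>w\<close>.\<close>

lemma diagram_inj:
  assumes u: "u \<in> S_inf" and w: "w \<in> S_inf" and eq: "diagram u = diagram w"
  shows "u = w"
proof
  fix p
  show "u p = w p"
  proof (induction p rule: less_induct)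
    case (less p)
    have le: "u p \<le> w p" if u: "u \<in> S_inf" and w: "w \<in> S_inf" and eq: "diagram u = diagram w"
      and p: "1 \<le> p" and IH: "\<And>q. q < p \<Longrightarrow> u q = w q" for u w
    proof (rule ccontr)
      assume "\<not> u p \<le> w p"
      obtain c where c: "u c = w p" using bij_pointE[OF S_inf_bij[OF u], of "w p"] by metis
      have "c \<noteq> p" using \<open>\<not> u p \<le> w p\<close> c by auto
      moreover have "\<not> c < p" using IH[of c] c S_inf_eq_iff[OF w, of c p] by auto
      ultimately have "(p, u c) \<in> diagram u" unfolding diagram_iff[OF u] using p c \<open>\<not> u p \<le> w p\<close> by auto
      then have "(p, w p) \<in> diagram w" using eq c by simp
      then show False using diagram_iff[OF w] by simp
    qed
    show ?case
    proof (cases "p = 0")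
      case True
      then show ?thesis using u w by simp
    next
      case False
      then show ?thesis using le[OF u w eq] le[OF w u eq[symmetric]] less by (intro antisym) auto
    qed
  qed
qed

lemma perm_of_diagram_eq: "w \<in> S_inf \<Longrightarrow> diagram w = B \<Longrightarrow> perm_of_diagram B = w"
  unfolding perm_of_diagram_def using diagram_inj by (intro the_equality) auto

lemma asc_after_diagram:
  assumes "w \<in> S_inf" "asc_after w l" "(p, q) \<in> diagram w"
  shows "p \<le> l"
proof -
  obtain c where "q = w c" using bij_pointE[OF S_inf_bij[OF assms(1)], of q] by metis
  then have "p < c" "w c < w p" using assms diagram_iff by auto
  then show ?thesis using asc_afterD[OF assms(2), of p c] by (metis leI order_less_asym)
qed

lemma corner_row_col:
  assumes "corner w l k"
  shows "corner_row w = l" "corner_col w = w k"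
proof -
  note c = cornerD[OF assms]
  have b: "(l, w k) \<in> diagram w" using c diagram_iff[OF c(1)] by simp
  have sub: "fst ` diagram w \<subseteq> {..l}" using asc_after_diagram[OF c(1,4)] by auto
  show r: "corner_row w = l"
    unfolding corner_row_def
  proof (rule Max_eqI)
    show "finite (fst ` diagram w)" using sub finite_subset by blast
    show "y \<le> l" if "y \<in> fst ` diagram w" for y using that sub by auto
    show "l \<in> fst ` diagram w" using b by force
  qed
  have le: "q \<le> w k" if "(l, q) \<in> diagram w" for q
  proof -
    obtain d where d: "q = w d" using bij_pointE[OF S_inf_bij[OF c(1)], of q] by metis
    then have "l < d" "w d < w l" using that diagram_iff[OF c(1)] by auto
    then have "d \<le> k" using c(7) by blast
    then show ?thesis using d asc_afterD[OF c(4) \<open>l < d\<close>, of k] by (cases "d = k") auto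
  qed
  show "corner_col w = w k"
    unfolding corner_col_def r
  proof (rule Max_eqI)
    show "finite {q. (l, q) \<in> diagram w}" by (rule finite_subset[of _ "{..w k}"]) (use le in auto)
  qed (use le b in auto)
qed

definition pivs :: "(nat \<Rightarrow> nat) \<Rightarrow> nat \<Rightarrow> nat set" where
  "pivs w l = {a. 1 \<le> a \<and> a < l \<and> covers w l a}"

text \<open>In \<open>w t_lk\<close> the entry at \<open>l\<close> is the column \<open>w k\<close>
  of the corner. A dot northwest of the corner is maximal precisely if no dot lies between it and
  the corner, which is the condition for a left cover at \<open>l\<close>.\<close>

lemma pivot_rows_corner:
  assumes "corner w l k"
  shows "pivot_rows w = pivs (w \<circ> tr l k) l"
proof -
  note c = cornerD[OF assms] and s = corner_swap[OF assms]
  have v: "(w \<circ> tr l k) p = w p" if "p < l" for p using s(4)[of p] that c by simp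
  have "covers (w \<circ> tr l k) l a \<longleftrightarrow> w a < w k \<and> (\<forall>p. a < p \<and> p < l \<longrightarrow> \<not> (w a < w p \<and> w p < w k))"
    if "a < l" for a
    using that v s(2) by (simp add: covers_def)
  then show ?thesis
    unfolding pivot_rows_def nw_dot_rows_def corner_row_col[OF assms] pivs_def by auto
qed

text \<open>The insertion between two marches: exchanging \<open>l\<close> with the first later
  position that holds a larger entry creates just one new inversion, whose box is
  \<open>(l, w l)\<close>.\<close>

lemma corner_insert:
  assumes w: "w \<in> S_inf" "asc_after w l" "1 \<le> l"
  obtains k where "corner (w \<circ> tr l k) l k" "diagram (w \<circ> tr l k) = insert (l, w l) (diagram w)"
proof -
  obtain N where N: "w \<in> S N" "N \<ge> l" using S_infE[OF w(1)] by blast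
  define k where "k = (LEAST k. l < k \<and> w l < w k)"
  have "l < N + 1 \<and> w l < w (N + 1)" using S_outside[OF N(1), of "N + 1"] S_inside[OF N(1), of l] N w by auto
  then have k: "l < k" "w l < w k" unfolding k_def by (metis (mono_tags, lifting) LeastI)+
  have below: "w q < w l" if "l < q" "q < k" for q
    using not_less_Least[of q "\<lambda>k. l < k \<and> w l < w k"] that S_inf_eq_iff[OF w(1), of q l]
    unfolding k_def by auto
  have above: "w k < w q" if "k < q" for q using asc_afterD[OF w(2) k(1) that] .
  let ?u = "w \<circ> tr l k"
  have u: "?u \<in> S_inf" using w k by (intro S_inf_comp_tr) auto
  have t: "tr l k l = k" "tr l k k = l" "\<And>p. p \<noteq> l \<Longrightarrow> p \<noteq> k \<Longrightarrow> tr l k p = p"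
    by (auto simp: transpose_def)
  have "asc_after ?u l"
    unfolding asc_after_def
  proof (intro allI impI)
    fix p assume p: "p > l"
    consider "p = k" | "p + 1 = k" | "p \<noteq> k" "p + 1 \<noteq> k" by blast
    then show "?u p < ?u (p + 1)"
    proof cases
      case 1
      then show ?thesis using above[of "k + 1"] k t by simp
    next
      case 2
      then show ?thesis using below[of p] p t by auto
    next
      case 3
      then show ?thesis using w(2) p t by (simp add: asc_after_def)
    qed
  qed
  then have "corner ?u l k"
    using u w k above[of "k + 1"] t by (simp add: corner_def)
  moreover have "diagram ?u = insert (l, w l) (diagram w)"
  proof (rule diagram_eqI[OF u])
    fix p d
    \<comment> \<open>Columns are compared by value: \<open>c\<close> is the position in
      \<open>w\<close> of the value \<open>?u d\<close>.\<close>
    define c where "c = tr l k d"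
    have d: "d = tr l k c" by (simp add: c_def)
    have "(p = l \<and> c = l) \<or> (1 \<le> p \<and> p < c \<and> w c < w p) \<longleftrightarrow> 1 \<le> p \<and> p < tr l k c \<and> w c < w (tr l k p)"
    proof -
      consider "p < l" | "p = l" | "p > l" "p = k" | "p > l" "p \<noteq> k" by linarith
      then show ?thesis
      proof cases
        case 1
        then have "tr l k p = p" "p < tr l k c \<longleftrightarrow> p < c" using k by (auto simp: transpose_def)
        then show ?thesis using 1 by auto
      next
        case 2
        consider "c = l" | "c = k" | "c \<noteq> l" "c \<noteq> k" by blast
        then show ?thesis
        proof cases
          case 1
          then show ?thesis using 2 k w t by simp
        next
          case 2: 2
          then show ?thesis using \<open>p = l\<close> k t by simp
        next
          case 3
          have "w c < w k \<longleftrightarrow> w c < w l" if "l < c"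
            using below[of c] above[of c] k that 3 by (cases "c < k") auto
          then show ?thesis using 2 3 w t by auto
        qed
      next
        case 3
        have "\<not> (k < tr l k c \<and> w c < w l)"
          using above[of c] k t by (cases "c = l"; cases "c = k") auto
        then show ?thesis using 3 t above[of c] by auto
      next
        case 4
        have "\<not> (p < c \<and> w c < w p)" using asc_afterD[OF w(2) 4(1), of c] by auto
        moreover have "\<not> (p < k \<and> w l < w p)" using below[of p] 4 by auto
        ultimately show ?thesis using 4 t by (cases "c = l"; cases "c = k") auto
      qed
    qed
    moreover have "(l, w c) = (l, w l) \<longleftrightarrow> c = l" using S_inf_eq_iff[OF w(1)] by simp
    ultimately show "(p, ?u d) \<in> insert (l, w l) (diagram w) \<longleftrightarrow> 1 \<le> p \<and> p < d \<and> ?u d < ?u p"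
      using diagram_iff[OF w(1), of p c] by (auto simp: d)
  qed
  ultimately show ?thesis by (rule that)
qed

text \<open>\<open>grid_pred a A x\<close> is the predecessor of \<open>x \<in> A\<close> in \<open>A \<union> {a}\<close>, where \<open>a\<close> lies below \<open>A\<close>.\<close>

definition grid_pred :: "nat \<Rightarrow> nat set \<Rightarrow> nat \<Rightarrow> nat" where
  "grid_pred a A x = Max (insert a A \<inter> {..<x})"

context
  fixes a :: nat and A :: "nat set"
  assumes A: "\<forall>x\<in>A. a < x"
begin

lemma grid_pred:
  assumes "x \<in> A"
  shows "grid_pred a A x \<in> insert a A" "grid_pred a A x < x" "y \<in> insert a A \<Longrightarrow> y < x \<Longrightarrow> y \<le> grid_pred a A x"
proof -
  have "a \<in> insert a A \<inter> {..<x}" using A assms by auto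
  then have "grid_pred a A x \<in> insert a A \<inter> {..<x}"
    unfolding grid_pred_def by (intro Max_in) auto
  then show "grid_pred a A x \<in> insert a A" "grid_pred a A x < x" by auto
  show "y \<le> grid_pred a A x" if "y \<in> insert a A" "y < x"
    unfolding grid_pred_def using that by (intro Max_ge) auto
qed

lemma grid_pred_inj: "x \<in> A \<Longrightarrow> y \<in> A \<Longrightarrow> grid_pred a A x = grid_pred a A y \<Longrightarrow> x = y"
  using grid_pred[of x] grid_pred[of y]
  by (metis insertCI leD linorder_neqE_nat)

lemma grid_pred_surj:
  assumes "y \<in> insert a A" "x \<in> A" "y < x"
  obtains z where "z \<in> A" "z \<le> x" "grid_pred a A z = y"
proof -
  define z where "z = (LEAST z. z \<in> A \<and> y < z)"
  have z: "z \<in> A" "y < z" unfolding z_def using LeastI[of "\<lambda>z. z \<in> A \<and> y < z" x] assms by auto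
  have "z \<le> x" unfolding z_def using assms by (intro Least_le) auto
  moreover have "grid_pred a A z = y"
  proof (rule ccontr)
    assume "grid_pred a A z \<noteq> y"
    then have g: "y < grid_pred a A z" "grid_pred a A z < z" using grid_pred[OF z(1)] assms z by (auto simp: le_neq_implies_less)
    then have "grid_pred a A z \<in> A" using grid_pred(1)[OF z(1)] A assms(1) by fastforce
    then show False using g not_less_Least[of "grid_pred a A z" "\<lambda>z. z \<in> A \<and> y < z"] unfolding z_def[symmetric] by blast
  qed
  ultimately show ?thesis using that z by blast
qed

text \<open>The predecessor map shifts \<open>A\<close> down by one place in
  \<open>insert a A\<close>, so the maximum is the only place left free.\<close>

lemma grid_pred_image:
  assumes "m \<in> A" "\<forall>x\<in>A. x \<le> m"
  shows "grid_pred a A ` A = insert a A - {m}"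
proof (intro equalityI subsetI)
  fix y assume "y \<in> grid_pred a A ` A"
  then obtain x where x: "x \<in> A" "y = grid_pred a A x" by blast
  then have "y < m" using grid_pred(2)[OF x(1)] assms(2) by fastforce
  then show "y \<in> insert a A - {m}" using grid_pred(1)[OF x(1)] x by simp
next
  fix y assume y: "y \<in> insert a A - {m}"
  then have "y < m" using A assms by (auto simp: le_neq_implies_less)
  then obtain z where "z \<in> A" "grid_pred a A z = y"
    using grid_pred_surj[of y m] y assms(1) by blast
  then show "y \<in> grid_pred a A ` A" by blast
qed

end

section \<open>Moving a grid of boxes in reading order\<close>

definition lex_less :: "nat \<times> nat \<Rightarrow> nat \<times> nat \<Rightarrow> bool" where
  "lex_less x y \<longleftrightarrow> fst x < fst y \<or> fst x = fst y \<and> snd x < snd y"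

lemma sorted_product:
  assumes "sorted_wrt (<) xs" "sorted_wrt (<) ys"
  shows "sorted_wrt lex_less (List.product xs ys)"
  using assms(1)
proof (induction xs)
  case (Cons x xs)
  have "sorted_wrt lex_less (map (Pair x) ys)"
    using assms(2) by (simp add: sorted_wrt_map lex_less_def)
  moreover have "lex_less a b" if "a \<in> set (map (Pair x) ys)" "b \<in> set (List.product xs ys)" for a b
    using that Cons.prems by (auto simp: lex_less_def)
  ultimately show ?case using Cons by (simp add: sorted_wrt_append)
qed simp

text \<open>The state after processing a prefix depends on that prefix only as a set, so it suffices
  to check one move from each such state.\<close>

lemma fold_move_box:
  assumes "\<And>pre b post. L = pre @ b # post \<Longrightarrow>
    move_box H b ((D - set pre) \<union> f ` set pre) = (D - insert b (set pre)) \<union> f ` insert b (set pre)"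
  shows "fold (move_box H) L D = (D - set L) \<union> f ` set L"
proof -
  have "fold (move_box H) pre D = (D - set pre) \<union> f ` set pre" if "L = pre @ post" for pre post
    using that
  proof (induction pre arbitrary: post rule: rev_induct)
    case (snoc b pre)
    then have "fold (move_box H) pre D = (D - set pre) \<union> f ` set pre" by simp
    then show ?case using assms[of pre b post] snoc.prems by simp
  qed simp
  then show ?thesis by simp
qed

text \<open>\<open>R \<times> C\<close> are the boxes to be moved, \<open>i\<close> and
  \<open>j\<close> the row and column of the pivot. Removing its hook opens this row and column, and
  each box moves to the preceding row and column of the enlarged grid. By \<open>free\<close>, every
  uncovered cell outside that grid northwest of the corner holds a box that stays; by
  \<open>border\<close>, the opened row and column start empty there.\<close>

lemma fold_move_box_grid:
  fixes D H :: "(nat \<times> nat) set"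
  assumes xs: "sorted_wrt (<) xs" "set xs = R" "\<forall>x\<in>R. i < x" "1 \<le> i"
    and ys: "sorted_wrt (<) ys" "set ys = C" "\<forall>y\<in>C. j < y" "1 \<le> j"
    and l: "l \<in> R" "\<forall>x\<in>R. x \<le> l" and m: "m \<in> C" "\<forall>y\<in>C. y \<le> m"
    and RC: "R \<times> C \<subseteq> D"
    and free: "\<And>x y. 1 \<le> x \<Longrightarrow> x < l \<Longrightarrow> 1 \<le> y \<Longrightarrow> y < m \<Longrightarrow> (x, y) \<notin> H \<Longrightarrow>
      (x, y) \<in> D \<or> (x \<in> insert i R \<and> y \<in> insert j C)"
    and grid: "\<And>x y. x \<in> insert i R \<Longrightarrow> y \<in> insert j C \<Longrightarrow> (x, y) \<notin> H"
    and border: "\<And>x y. x \<in> insert i R \<Longrightarrow> y \<in> insert j C \<Longrightarrow> x = i \<or> y = j \<Longrightarrow> (x, y) \<notin> D"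
  shows "fold (move_box H) (List.product xs ys) D =
    (D - R \<times> C) \<union> (insert i R - {l}) \<times> (insert j C - {m})"
proof -
  let ?L = "List.product xs ys"
  define f where "f = map_prod (grid_pred i R) (grid_pred j C)"
  have L: "set ?L = R \<times> C" using xs ys by simp
  note gR = grid_pred[OF xs(3)] and gC = grid_pred[OF ys(3)]
  have "fold (move_box H) ?L D = (D - set ?L) \<union> f ` set ?L"
  proof (rule fold_move_box)
    fix pre b post assume Leq: "?L = pre @ b # post"
    obtain p q where b: "b = (p, q)" by (cases b)
    have pq: "p \<in> R" "q \<in> C" using L b unfolding Leq by auto
    have srt: "sorted_wrt lex_less (pre @ b # post)" using sorted_product[OF xs(1) ys(1)] Leq by simp
    have pre: "x \<in> set pre \<longleftrightarrow> x \<in> R \<times> C \<and> lex_less x b" for x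
    proof
      assume x: "x \<in> set pre"
      then show "x \<in> R \<times> C \<and> lex_less x b" using L srt unfolding Leq by (auto simp: sorted_wrt_append)
    next
      assume x: "x \<in> R \<times> C \<and> lex_less x b"
      then have "x \<in> set pre \<or> x = b \<or> x \<in> set post" using L unfolding Leq by auto
      moreover have "x \<noteq> b" using x by (auto simp: lex_less_def)
      moreover have "x \<notin> set post" using srt x by (auto simp: sorted_wrt_append lex_less_def)
      ultimately show "x \<in> set pre" by blast
    qed
    let ?B = "(D - set pre) \<union> f ` set pre"
    have fb: "f b = (grid_pred i R p, grid_pred j C q)" by (simp add: b f_def)
    have fless: "lex_less (f x) x" if "x \<in> R \<times> C" for x
      using that gR(2) gC(2) by (auto simp: lex_less_def f_def)
    have trans: "lex_less x z" if "lex_less x y" "lex_less y z" for x y z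
      using that by (auto simp: lex_less_def)
    have irrefl: "\<not> lex_less x x" for x by (simp add: lex_less_def)
    have fb_grid: "grid_pred i R p \<in> insert i R" "grid_pred j C q \<in> insert j C" using gR gC pq by auto
    have inj: "x = y" if "x \<in> R \<times> C" "y \<in> R \<times> C" "f x = f y" for x y
      using that grid_pred_inj[OF xs(3)] grid_pred_inj[OF ys(3)] by (auto simp: f_def)
    \<comment> \<open>The target lies on the opened border, which starts empty, or is a grid box
      earlier in reading order, which has already left. Injectivity of \<open>f\<close> keeps
      earlier boxes from landing on it.\<close>
    have fb_B: "f b \<notin> ?B"
    proof
      assume "f b \<in> ?B"
      then consider "f b \<in> D" "f b \<notin> set pre" | "f b \<in> f ` set pre" by blast
      then show False
      proof cases
        case 1
        then have "grid_pred i R p \<noteq> i" "grid_pred j C q \<noteq> j" using border[OF fb_grid] fb by auto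
        then have "f b \<in> R \<times> C" using fb_grid fb by simp
        moreover have "lex_less (f b) b" using fless[of b] pq b by simp
        ultimately show False using 1 pre[of "f b"] by argo
      next
        case 2
        then obtain x where "x \<in> set pre" "f b = f x" by blast
        then have "x = b" "lex_less x b" using inj[of b x] pre[of x] pq b by auto
        then show False using irrefl by blast
      qed
    qed
    have the: "(THE c. 1 \<le> fst c \<and> fst c < fst b \<and> 1 \<le> snd c \<and> snd c < snd b \<and> c \<notin> H \<and> c \<notin> ?B) = f b"
    proof (rule the_equality)
      have "1 \<le> grid_pred i R p" "1 \<le> grid_pred j C q" using fb_grid xs(3,4) ys(3,4) by auto
      then show "1 \<le> fst (f b) \<and> fst (f b) < fst b \<and> 1 \<le> snd (f b) \<and> snd (f b) < snd b \<and> f b \<notin> H \<and> f b \<notin> ?B"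
        using fb_B gR(2)[OF pq(1)] gC(2)[OF pq(2)] grid[OF fb_grid] by (simp add: fb) (simp add: b)
    next
      \<comment> \<open>A competing cell \<open>c\<close> lies on the enlarged grid, hence is the
        target of a grid box weakly northwest of \<open>b\<close>. Unless that box is
        \<open>b\<close>, it was processed earlier and occupies \<open>c\<close>.\<close>
      fix c assume c: "1 \<le> fst c \<and> fst c < fst b \<and> 1 \<le> snd c \<and> snd c < snd b \<and> c \<notin> H \<and> c \<notin> ?B"
      obtain x y where xy: "c = (x, y)" by (cases c)
      have lt: "1 \<le> x" "x < p" "1 \<le> y" "y < q" using c xy b by auto
      have "x \<in> insert i R \<and> y \<in> insert j C"
      proof (rule ccontr)
        assume n: "\<not> ?thesis"
        then have "c \<in> D" using free[of x y] lt c xy pq l m by fastforce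
        then have "c \<in> set pre" using c by blast
        then show False using pre[of c] xy n by auto
      qed
      then obtain x' y' where x': "x' \<in> R" "x' \<le> p" "grid_pred i R x' = x"
        and y': "y' \<in> C" "y' \<le> q" "grid_pred j C y' = y"
        using grid_pred_surj[OF xs(3) _ pq(1) lt(2)] grid_pred_surj[OF ys(3) _ pq(2) lt(4)] by metis
      have fc: "c = f (x', y')" using x' y' xy by (simp add: f_def)
      have "(x', y') \<notin> set pre" using fc c by blast
      then have "\<not> lex_less (x', y') b" using pre[of "(x', y')"] x' y' by simp
      then have "(x', y') = b" using x' y' b by (auto simp: lex_less_def)
      then show "c = f b" using fc by simp
    qed
    have "b \<notin> f ` set pre"
    proof
      assume "b \<in> f ` set pre"
      then obtain x where "x \<in> set pre" "b = f x" by blast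
      then have "lex_less b x" "lex_less x b" using fless[of x] pre[of x] by auto
      then show False using trans irrefl by blast
    qed
    then have "insert (f b) (?B - {b}) = (D - insert b (set pre)) \<union> f ` insert b (set pre)" by auto
    then show "move_box H b ?B = (D - insert b (set pre)) \<union> f ` insert b (set pre)"
      unfolding move_box_def the .
  qed
  also have "f ` set ?L = (insert i R - {l}) \<times> (insert j C - {m})"
    unfolding L f_def map_prod_surj_on[OF grid_pred_image[OF xs(3) l] grid_pred_image[OF ys(3) m]] ..
  finally show ?thesis unfolding L .
qed

lemma filter_product:
  "filter (\<lambda>x. P (fst x) \<and> Q (snd x)) (List.product xs ys) = List.product (filter P xs) (filter Q ys)"
proof (induction xs)
  case (Cons x xs)
  then show ?case by (cases "P x") (simp_all add: filter_map comp_def)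
qed simp

text \<open>No dot lies between pivot and corner, so each row strictly between \<open>i\<close> and
  \<open>l\<close> has its dot left of column \<open>j\<close> or right of column \<open>m\<close>.
  The boxes of the rectangle are therefore the product of the rows \<open>R\<close> of the second
  kind, together with \<open>l\<close>, and the columns \<open>C\<close> whose dots lie below row
  \<open>l\<close>.\<close>

lemma march_eq:
  assumes cor: "corner w l k" and i: "i \<in> pivs (w \<circ> tr l k) l"
  shows "march w i = w \<circ> tr l k \<circ> tr i l"
proof -
  note c = cornerD[OF cor] and s = corner_swap[OF cor]
  define m j where "m = w k" "j = w i"
  note mj = this
  have i': "1 \<le> i" "i < l" and cov_i: "covers (w \<circ> tr l k) l i" using i by (auto simp: pivs_def)
  have v: "(w \<circ> tr l k) p = w p" if "p < l" for p using s(4)[of p] that c by simp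
  have jm: "j < m" using cov_i i' v s(2) by (simp add: covers_def mj)
  have nodot': "\<not> (j < w p \<and> w p < m)" if "i < p" "p < l" for p
    using cov_i i' v[of p] v[of i] s(2) that unfolding covers_def by (auto simp: mj)
  have eqm: "w p = m \<longleftrightarrow> p = k" and eqj: "w p = j \<longleftrightarrow> p = i" for p
    using S_inf_eq_iff[OF c(1)] by (auto simp: mj)
  have nodot: "w p < j \<or> m < w p" if "i < p" "p < l" for p
    using nodot'[OF that] eqm[of p] eqj[of p] that c by (metis linorder_neqE_nat less_irrefl order.strict_trans)
  have wl: "m < w l" using c by (simp add: mj)
  define R where "R = {p. i < p \<and> p \<le> l \<and> m < w p}"
  define C where "C = {q. j < q \<and> q \<le> m \<and> l < inv w q}"
  have inv: "inv w (w d) = d" for d using S_inf_inj[OF c(1)] by simp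
  have C_iff: "w d \<in> C \<longleftrightarrow> j < w d \<and> w d \<le> m \<and> l < d" for d by (simp add: C_def inv)
  have surj: "\<exists>d. q = w d" for q using bij_pointE[OF S_inf_bij[OF c(1)], of q] by metis
  let ?xs = "filter (\<lambda>p. p \<in> R) [i..<Suc l]" and ?ys = "filter (\<lambda>q. q \<in> C) [j..<Suc m]"
  have box: "(p, w d) \<in> diagram w \<longleftrightarrow> p \<in> R \<and> w d \<in> C"
    if p: "i \<le> p" "p \<le> l" and q: "j \<le> w d" "w d \<le> m" for p d
  proof
    assume "(p, w d) \<in> diagram w"
    then have b: "p < d" "w d < w p" using diagram_iff[OF c(1)] by auto
    have "p \<noteq> i" using b q by (auto simp: mj)
    then have ip: "i < p" using p by simp
    have "m < w p" using nodot[of p] wl b q ip p by (cases "p = l") auto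
    moreover have "d \<noteq> i" using ip b by auto
    then have "j < w d" using q eqj[of d] by auto
    moreover have "l < d"
    proof (rule ccontr)
      assume "\<not> l < d"
      then have "d = l \<or> d < l" by auto
      then show False using nodot[of d] b ip q wl eqm[of d] eqj[of d] p c by auto
    qed
    ultimately show "p \<in> R \<and> w d \<in> C" using ip p q by (auto simp: R_def C_iff)
  next
    assume "p \<in> R \<and> w d \<in> C"
    then show "(p, w d) \<in> diagram w"
      using diagram_iff[OF c(1)] i' by (auto simp: R_def C_iff)
  qed
  have rect: "rect_boxes w i = List.product ?xs ?ys"
    unfolding rect_boxes_def corner_row_col[OF cor] filter_product[symmetric] mj(1)[symmetric] mj(2)[symmetric]
  proof (rule filter_cong[OF refl])
    fix b assume b: "b \<in> set (List.product [i..<Suc l] [j..<Suc m])"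
    obtain p q where pq: "b = (p, q)" by (cases b)
    obtain d where "q = w d" using surj by blast
    then show "b \<in> diagram w \<longleftrightarrow> fst b \<in> R \<and> snd b \<in> C" using box[of p d] b pq by auto
  qed
  let ?H = "\<Union>p\<in>{1..} - {i}. hook (p, w p)"
  have H_iff: "(x, w d) \<in> ?H \<longleftrightarrow> (1 \<le> x \<and> x \<noteq> i \<and> w x \<le> w d) \<or> (1 \<le> d \<and> d \<noteq> i \<and> d \<le> x)" for x d
    using S_inf_eq_iff[OF c(1)] by (auto simp: hook_def)
  have fold: "fold (move_box ?H) (List.product ?xs ?ys) (diagram w) =
    (diagram w - R \<times> C) \<union> (insert i R - {l}) \<times> (insert j C - {m})"
  proof (rule fold_move_box_grid)
    show "sorted_wrt (<) ?xs" "sorted_wrt (<) ?ys"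
      by (simp_all add: sorted_wrt_filter del: upt_Suc)
    show "set ?xs = R" "set ?ys = C" by (auto simp: R_def C_def)
    show "\<forall>x\<in>R. i < x" "\<forall>y\<in>C. j < y" by (auto simp: R_def C_def)
    show "1 \<le> i" "1 \<le> j" using i' S_inf_ge_1[OF c(1)] by (auto simp: mj)
    show "l \<in> R" "\<forall>x\<in>R. x \<le> l" using i' wl by (auto simp: R_def)
    show "m \<in> C" "\<forall>y\<in>C. y \<le> m" using jm c inv[of k] by (auto simp: C_def mj)
    show "R \<times> C \<subseteq> diagram w"
    proof safe
      fix p q assume "p \<in> R" "q \<in> C"
      moreover obtain d where "q = w d" using surj by blast
      ultimately show "(p, q) \<in> diagram w" using box[of p d] by (auto simp: R_def C_def)
    qed
  next
    \<comment> \<open>An uncovered cell outside the row and column of the pivot has its row dot to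
      the east and its column dot to the south, hence is a box. What remains are the cells in row
      \<open>i\<close> or column \<open>j\<close>.\<close>
    fix x y assume x: "1 \<le> x" "x < l" and y: "1 \<le> y" "y < m" and H: "(x, y) \<notin> ?H"
    obtain d where d: "y = w d" using surj by blast
    have "1 \<le> d" using y d S_inf_ge_1[OF c(1), of d] by simp
    then have *: "x = i \<or> w d < w x" "d = i \<or> x < d" using H x unfolding d H_iff by auto
    have Cd: "y \<in> C" if "i < d" "j < w d"
    proof -
      have "l < d"
      proof (rule ccontr)
        assume "\<not> l < d"
        then have "d = l \<or> d < l" by auto
        then show False using that nodot[of d] y d wl by auto
      qed
      then show ?thesis using that y d by (auto simp: C_iff)
    qed
    show "(x, y) \<in> diagram w \<or> (x \<in> insert i R \<and> y \<in> insert j C)"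
    proof (cases "x = i")
      case True
      then show ?thesis using * d Cd x diagram_iff[OF c(1), of i d] eqj[of d]
        by (cases "w d" j rule: linorder_cases) (auto simp: mj)
    next
      case False
      then have lt: "w d < w x" using * by simp
      show ?thesis
      proof (cases "d = i")
        case True
        show ?thesis
        proof (cases "x < i")
          case True
          then show ?thesis using lt \<open>d = i\<close> x d diagram_iff[OF c(1), of x d] by simp
        next
          case False
          then have "i < x" using \<open>x \<noteq> i\<close> by simp
          then have "x \<in> R" using nodot[of x] lt \<open>d = i\<close> x by (auto simp: R_def mj)
          then show ?thesis using \<open>d = i\<close> d by (simp add: mj)
        qed
      next
        case False
        then show ?thesis using * lt x d diagram_iff[OF c(1), of x d] by simp
      qed
    qed
  next
    fix x y assume x: "x \<in> insert i R" and y: "y \<in> insert j C"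
    obtain d where d: "y = w d" using surj by blast
    have x': "x = i \<or> (i < x \<and> x \<le> l \<and> m < w x)" using x by (auto simp: R_def)
    have y': "d = i \<or> (j < w d \<and> w d \<le> m \<and> l < d)" using y d eqj[of d] C_iff by auto
    show "(x, y) \<notin> ?H"
      unfolding d H_iff using x' y' jm i' by (auto simp: mj)
    show "(x, y) \<notin> diagram w" if "x = i \<or> y = j"
      using that x' y' i' d eqj[of d] diagram_iff[OF c(1), of x d] by (auto simp: mj)
  qed
  let ?u = "w \<circ> tr l k \<circ> tr i l"
  have u: "?u \<in> S_inf" by (rule S_inf_comp_tr[OF s(1)]) (use i' in auto)
  have "diagram ?u = (diagram w - R \<times> C) \<union> (insert i R - {l}) \<times> (insert j C - {m})"
  proof (rule diagram_eqI[OF u])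
    fix p e
    \<comment> \<open>\<open>?u\<close> is \<open>w \<circ> g\<close>, and \<open>g'\<close> inverts
      \<open>g\<close>. The value \<open>?u e\<close> sits at position \<open>d\<close> of
      \<open>w\<close>, so both sides become statements about \<open>p\<close> and \<open>d\<close>
      in \<open>w\<close>.\<close>
    define g where "g = tr l k \<circ> tr i l"
    define g' where "g' = tr i l \<circ> tr l k"
    define d where "d = g e"
    have e: "e = g' d" by (simp add: d_def g_def g'_def)
    have dist: "i \<noteq> l" "i \<noteq> k" "l \<noteq> k" using i' c by auto
    have g: "g i = k" "g l = i" "g k = l" "\<And>x. x \<noteq> i \<Longrightarrow> x \<noteq> l \<Longrightarrow> x \<noteq> k \<Longrightarrow> g x = x"
      using dist by (auto simp: g_def transpose_def)
    have g': "g' k = i" "g' i = l" "g' l = k" "\<And>x. x \<noteq> i \<Longrightarrow> x \<noteq> l \<Longrightarrow> x \<noteq> k \<Longrightarrow> g' x = x"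
      using dist by (auto simp: g'_def transpose_def)
    let ?D = "1 \<le> p \<and> p < d \<and> w d < w p"
    let ?R = "i < p \<and> p \<le> l \<and> m < w p" and ?C = "j < w d \<and> w d \<le> m \<and> l < d"
    let ?R' = "p = i \<or> (i < p \<and> p < l \<and> m < w p)" and ?C' = "d = i \<or> (j < w d \<and> w d < m \<and> l < d)"
    have mem: "(p, w d) \<in> (diagram w - R \<times> C) \<union> (insert i R - {l}) \<times> (insert j C - {m}) \<longleftrightarrow>
      (?D \<and> \<not> (?R \<and> ?C)) \<or> (?R' \<and> ?C')"
    proof -
      have "p \<in> insert i R - {l} \<longleftrightarrow> ?R'" using i' by (auto simp: R_def)
      moreover have "w d \<in> insert j C - {m} \<longleftrightarrow> ?C'" using jm eqj[of d] by (auto simp: C_iff mj)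
      ultimately show ?thesis using diagram_iff[OF c(1), of p d] C_iff[of d] by (auto simp: R_def)
    qed
    have asc: "w x < w y \<longleftrightarrow> x < y" if "l < x" "l < y" for x y
      using asc_after_less_iff[OF c(4) that] .
    have after: "w d < w l \<longleftrightarrow> w d \<le> m" if "l < d"
      using c(7)[OF that] asc[OF that c(3)] eqm[of d] by (auto simp: mj le_less)
    have facts: "w k = m" "w i = j" by (simp_all add: mj)
    have less_k: "l < k" using c(3) .
    have key: "(?D \<and> \<not> (?R \<and> ?C)) \<or> (?R' \<and> ?C') \<longleftrightarrow> 1 \<le> p \<and> p < g' d \<and> w d < w (g p)"
    proof -
      note ord = i' less_k jm wl facts
      \<comment> \<open>Only the rows \<open>i\<close>, \<open>l\<close> and \<open>k\<close>
        receive another dot; any other row is affected only in the columns whose dots come from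
        these rows.\<close>
      consider "p < i" | "p = i" | "i < p" "p < l" | "p = l" | "p = k" | "l < p" "p \<noteq> k"
        by linarith
      then show ?thesis
      proof cases
        case 1
        then have "g p = p" using g(4) ord by simp
        moreover have "p < g' d \<longleftrightarrow> p < d"
          using 1 ord g'(1-3) g'(4)[of d] by (cases "d = i"; cases "d = l"; cases "d = k") simp_all
        ultimately show ?thesis using 1 ord by auto
      next
        case 2
        have "1 \<le> i \<and> i < g' d \<and> w d < m \<longleftrightarrow> (i < d \<and> w d < j) \<or> ?C'"
        proof (cases "d = i \<or> d = l \<or> d = k")
          case True
          then show ?thesis using ord g'(1-3) by auto
        next
          case False
          then have "g' d = d" using g'(4) by simp
          moreover have "w d \<noteq> j" using eqj False by simp
          moreover have "w d < j \<or> m < w d" if "i < d" "d < l" using nodot that .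
          ultimately show ?thesis using ord False by (cases "i < d"; cases "d < l") auto
        qed
        then show ?thesis using 2 g(1) facts by auto
      next
        case 3
        have gp: "g p = p" using g(4) 3 ord by simp
        have np: "w p < j \<or> m < w p" using nodot 3 .
        show ?thesis
        proof (cases "d = i \<or> d = l \<or> d = k")
          case True
          then show ?thesis unfolding gp using 3 np ord g'(1-3) by auto
        next
          case False
          then have "g' d = d" "w d \<noteq> m" using g'(4) eqm by simp_all
          then show ?thesis unfolding gp using 3 ord False by auto
        qed
      next
        case 4
        have "(l < d \<and> w d < w l \<and> \<not> ?C) \<longleftrightarrow> l < g' d \<and> w d < j"
        proof (cases "d = i \<or> d = l \<or> d = k")
          case True
          then show ?thesis using ord g'(1-3) by auto
        next
          case False
          then have "g' d = d" "w d \<noteq> j" using g'(4) eqj by simp_all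
          then show ?thesis using after ord by auto
        qed
        then show ?thesis using 4 g(2) ord by auto
      next
        case 5
        have "\<not> (k < d \<and> w d < w k)" using asc[of d k] less_k by auto
        moreover have "\<not> (k < d \<and> w d < w l)" using c(7)[of d] less_k by auto
        moreover have "k < g' d \<longleftrightarrow> k < d"
          using ord g'(1-3) g'(4)[of d] by (cases "d = i"; cases "d = l"; cases "d = k") simp_all
        ultimately show ?thesis using 5 g(3) ord by auto
      next
        case 6
        have gp: "g p = p" using g(4) 6 ord by simp
        have "\<not> (p < d \<and> w d < w p)" using asc[of d p] 6 by auto
        moreover have "\<not> (p < k \<and> w l < w p)" using c(7)[of p] 6 by auto
        moreover have "p < g' d \<longleftrightarrow> (if d = l then p < k else p < d \<and> d \<noteq> k)"
          using 6 ord g'(1-3) g'(4)[of d] by (cases "d = i"; cases "d = l"; cases "d = k") simp_all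
        ultimately show ?thesis unfolding gp using 6 ord by (cases "d = l") auto
      qed
    qed
    have "?u e = w d" "?u p = w (g p)" by (simp_all add: d_def g_def)
    then show "(p, ?u e) \<in> (diagram w - R \<times> C) \<union> (insert i R - {l}) \<times> (insert j C - {m}) \<longleftrightarrow>
      1 \<le> p \<and> p < e \<and> ?u e < ?u p"
      using mem key e by simp
  qed
  then show ?thesis
    unfolding march_def rect fold by (rule perm_of_diagram_eq[OF u])
qed

lemma K_march_list_eq:
  assumes "corner w l k" "is \<noteq> []" "sorted_wrt (<) is" "set is \<subseteq> pivs (w \<circ> tr l k) l"
  shows "K_march_list l w is = chain (w \<circ> tr l k) l is"
  using assms
proof (induction "is" arbitrary: w k)
  case (Cons i js)
  note cor = Cons.prems(1)
  note c = cornerD[OF cor] and s = corner_swap[OF cor]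
  have sub: "set (i # js) \<subseteq> pivs (w \<circ> tr l k) l" using Cons.prems(4) .
  have i: "i \<in> pivs (w \<circ> tr l k) l" by (rule subsetD[OF sub]) simp
  then have i': "1 \<le> i" "i < l" "covers (w \<circ> tr l k) l i" by (auto simp: pivs_def)
  show ?case
  proof (cases js)
    case Nil
    then show ?thesis using march_eq[OF cor i] by simp
  next
    case (Cons i2 js')
    let ?u = "w \<circ> tr l k \<circ> tr i l"
    have u: "?u \<in> S_inf" by (rule S_inf_comp_tr[OF s(1)]) (use i' in auto)
    have "?u p = (w \<circ> tr l k) p" if "p > l" for p using that i' by (simp add: transpose_def)
    then have "asc_after ?u l" using s(5) by (simp add: asc_after_def)
    then obtain k' where k': "corner (?u \<circ> tr l k') l k'"
      "diagram (?u \<circ> tr l k') = insert (l, ?u l) (diagram ?u)"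
      using corner_insert[OF u _ c(2)] by blast
    \<comment> \<open>The remaining pivot rows are larger than \<open>i\<close>, so their covers
      survive the first exchange.\<close>
    have "set js \<subseteq> pivs ?u l"
    proof
      fix p assume p: "p \<in> set js"
      have "p \<in> pivs (w \<circ> tr l k) l" by (rule subsetD[OF sub]) (use p in simp)
      then have "1 \<le> p" "p < l" "covers (w \<circ> tr l k) l p" unfolding pivs_def by blast+
      moreover have "i < p" using Cons.prems(3) p by simp
      ultimately show "p \<in> pivs ?u l"
        using covers_after_tr[OF i'(3) _ _ s(1), of p] unfolding pivs_def by blast
    qed
    then have IH: "K_march_list l (?u \<circ> tr l k') js = chain (?u \<circ> tr l k' \<circ> tr l k') l js"
      using Cons.prems(3) Cons by (intro Cons.IH[OF k'(1)]) (simp_all only: comp_tr_tr, auto)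
    have "K_march_list l w (i # js) = K_march_list l (perm_of_diagram (insert (l, ?u l) (diagram ?u))) js"
      unfolding Cons by (simp only: K_march_list.simps march_eq[OF cor i] Let_def)
    also have "perm_of_diagram (insert (l, ?u l) (diagram ?u)) = ?u \<circ> tr l k'"
      using cornerD(1)[OF k'(1)] k'(2) by (rule perm_of_diagram_eq)
    also have "K_march_list l (?u \<circ> tr l k') js = chain (w \<circ> tr l k) l (i # js)"
      using IH by (simp only: comp_tr_tr chain_simps)
    finally show ?thesis .
  qed
qed simp

lemma pivs_finite: "finite (pivs w l)"
  by (rule finite_subset[of _ "{..<l}"]) (auto simp: pivs_def)

lemma K_march_eq:
  assumes "corner w l k" "I \<noteq> {}" "I \<subseteq> pivot_rows w"
  shows "K_march w I = chain (w \<circ> tr l k) l (sorted_list_of_set I)"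
proof -
  have I: "I \<subseteq> pivs (w \<circ> tr l k) l" using assms(3) pivot_rows_corner[OF assms(1)] by simp
  then have "finite I" using pivs_finite finite_subset by blast
  then show ?thesis
    unfolding K_march_def corner_row_col[OF assms(1)] using assms I
    by (intro K_march_list_eq) auto
qed

text \<open>These are the conditions under which \<open>corner_induct\<close> grants its hypothesis.
  Exchanges with positions before \<open>l\<close> leave all entries after \<open>l\<close>
  unchanged and only lower the entry at \<open>l\<close>, which starts as \<open>w k\<close>, while
  position \<open>k\<close> holds \<open>w l\<close>.\<close>

lemma pivs_chain:
  assumes "corner w l k" "I \<subseteq> pivs (w \<circ> tr l k) l"
  defines "u \<equiv> chain (w \<circ> tr l k) l (sorted_list_of_set I)"
  shows "u \<in> S_inf" "asc_after u l" "u k > u l"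
proof -
  note c = cornerD[OF assms(1)] and s = corner_swap[OF assms(1)]
  have fin: "finite I" using assms(2) pivs_finite finite_subset by blast
  have a: "1 \<le> a \<and> a < l \<and> covers (w \<circ> tr l k) l a" if "a \<in> set (sorted_list_of_set I)" for a
    using that assms(2) fin by (auto simp: pivs_def)
  show "u \<in> S_inf" unfolding u_def using a c(2) s(1) by (intro chain_S_inf) auto
  have out: "u p = (w \<circ> tr l k) p" if "p > l" for p
    unfolding u_def using a that by (intro chain_outside) auto
  then show "asc_after u l" using s(5) by (simp add: asc_after_def)
  have "u l \<le> (w \<circ> tr l k) l"
    unfolding u_def using a c(2) s(1) by (intro chain_le) auto
  then show "u k > u l" using out[OF c(3)] s c(5) by simp
qed

section \<open>Signs\<close>

lemma S_inf_permutation: "w \<in> S_inf \<Longrightarrow> permutation w"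
  unfolding S_inf_def S_def using permutes_imp_permutation[OF finite_atLeastAtMost] by blast

text \<open>The change of \<open>len\<close> is known for adjacent exchanges only, that of
  \<open>evenperm\<close> for all transpositions. Sorting by adjacent exchanges links the two, so
  that every transposition flips the parity of the length.\<close>

lemma even_len_iff: "w \<in> S_inf \<Longrightarrow> even (len w) \<longleftrightarrow> evenperm w"
proof (induction "len w" arbitrary: w)
  case 0
  have "asc_after w 0"
    unfolding asc_after_def
  proof (intro allI impI)
    fix p :: nat assume "p > 0"
    then show "w p < w (p + 1)"
      using len_descent[OF 0(2), of p] 0(1) S_inf_eq_iff[OF 0(2), of p "p + 1"]
      by (cases "w p" "w (p + 1)" rule: linorder_cases) auto
  qed
  then have "w = id" using asc_after_0_imp_id 0 by blast
  then show ?case using 0 evenperm_id by (simp add: id_def)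
next
  case (Suc n)
  have "\<exists>i\<ge>1. w i > w (i + 1)"
  proof (rule ccontr)
    assume n: "\<not> ?thesis"
    have "asc_after w 0"
      unfolding asc_after_def
    proof (intro allI impI)
      fix p :: nat assume "p > 0"
      then show "w p < w (p + 1)"
        using n S_inf_eq_iff[OF Suc(3), of p "p + 1"] by (metis One_nat_def Suc_leI add_eq_self_zero linorder_neqE_nat one_neq_zero)
    qed
    then have "w = id" using asc_after_0_imp_id Suc by blast
    moreover have "len id = 0" unfolding len_def by (simp add: card_eq_0_iff)
    ultimately show False using Suc by simp
  qed
  then obtain i where i: "1 \<le> i" "w i > w (i + 1)" by blast
  have w': "w \<circ> tr i (i + 1) \<in> S_inf" using S_inf_comp_tr[OF Suc(3)] i by simp
  have "len w = Suc (len (w \<circ> tr i (i + 1)))" using len_descent[OF Suc(3) i] .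
  moreover from this have "even (len (w \<circ> tr i (i + 1))) \<longleftrightarrow> evenperm (w \<circ> tr i (i + 1))"
    using Suc w' by auto
  moreover have "evenperm (w \<circ> tr i (i + 1)) \<longleftrightarrow> \<not> evenperm w"
    using evenperm_comp[OF S_inf_permutation[OF Suc(3)] permutation_swap_id] by (simp add: evenperm_swap)
  ultimately show ?case by simp
qed

lemma even_len_comp_tr:
  assumes "w \<in> S_inf" "1 \<le> a" "1 \<le> b" "a \<noteq> b"
  shows "even (len (w \<circ> tr a b)) \<longleftrightarrow> odd (len w)"
  using even_len_iff[OF assms(1)] even_len_iff[OF S_inf_comp_tr[OF assms(1-3)]]
    evenperm_comp[OF S_inf_permutation[OF assms(1)] permutation_swap_id[of a b]] assms(4)
  by (simp add: evenperm_swap)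

lemma even_len_chain:
  assumes "w \<in> S_inf" "\<forall>a\<in>set as. 1 \<le> a \<and> a < l"
  shows "even (len (chain w l as)) \<longleftrightarrow> even (len w + length as)"
  using assms
proof (induction as arbitrary: w)
  case (Cons a as)
  have "w \<circ> tr a l \<in> S_inf" using Cons.prems by (intro S_inf_comp_tr) auto
  then have "even (len (chain (w \<circ> tr a l) l as)) \<longleftrightarrow> even (len (w \<circ> tr a l) + length as)"
    by (rule Cons.IH) (use Cons.prems in simp)
  moreover have "even (len (w \<circ> tr a l)) \<longleftrightarrow> odd (len w)"
    using Cons.prems by (intro even_len_comp_tr) auto
  ultimately show ?case unfolding chain_simps by auto
qed simp

lemma neg_one_power_eq: "neg_one_power k = (if even k then 1 else - 1)"
  unfolding neg_one_power_def by (simp add: even_nat_iff)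

lemma neg_one_power_add: "neg_one_power (a + b) = neg_one_power a * neg_one_power b"
  by (simp add: neg_one_power_eq)

text \<open>Passing from \<open>w\<close> to \<open>w t_lk\<close> accounts for the sign in front,
  each position of \<open>I\<close> for one further sign.\<close>

lemma neg_one_power_chain:
  assumes "corner w l k" "I \<subseteq> pivs (w \<circ> tr l k) l"
  shows "neg_one_power (int (len w) - int (len (chain (w \<circ> tr l k) l (sorted_list_of_set I)))) = - ((- 1) ^ card I)"
proof -
  note c = cornerD[OF assms(1)] and s = corner_swap[OF assms(1)]
  have fin: "finite I" using assms(2) pivs_finite finite_subset by blast
  have "even (len (chain (w \<circ> tr l k) l (sorted_list_of_set I))) \<longleftrightarrow> even (len (w \<circ> tr l k) + card I)"
    using even_len_chain[OF s(1), of "sorted_list_of_set I" l] fin assms(2) by (auto simp: pivs_def)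
  moreover have "even (len (w \<circ> tr l k)) \<longleftrightarrow> odd (len w)" using even_len_comp_tr c by auto
  ultimately show ?thesis by (auto simp: neg_one_power_eq minus_one_power_iff)
qed

section \<open>Truncation\<close>

lemma trunc_hom [simp]:
  "trunc t (a - b) = trunc t a - trunc t b" "trunc t (a * b) = trunc t a * trunc t b"
  "trunc t 1 = 1" "trunc t (sum f A) = (\<Sum>x\<in>A. trunc t (f x))" "trunc t (a ^ n) = trunc t a ^ n"
  "trunc t (- a) = - trunc t a"
  "trunc t (X i) = (if 1 \<le> i \<and> i \<le> t then X i else 0)"
  by (simp_all add: trunc_def)

text \<open>For \<open>i < N\<close> the exchange of \<open>x_i\<close> and \<open>x_(i+1)\<close>
  stays within the variables kept by \<open>trunc N\<close>, so that truncation commutes with the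
  divided difference.\<close>

lemma trunc_groth_rel: "groth_rel N w f \<Longrightarrow> trunc N f = f"
proof (induction rule: groth_rel.induct)
  case longest
  show ?case unfolding trunc_def subst_prod by (rule prod.cong) auto
next
  case (descend w f i)
  have comm: "trunc N (swap_vars i h) = swap_vars i (trunc N h)" for h
    by (induction h rule: mpoly_induct) (use descend in \<open>auto simp: transpose_def\<close>)
  have "trunc N ((X i - X (i + 1)) * demazure i f) = (1 - X (i + 1)) * f - (1 - X i) * swap_vars i f"
    unfolding demazure_eq using descend comm by simp
  then have "(X i - X (i + 1)) * trunc N (demazure i f) = (1 - X (i + 1)) * f - (1 - X i) * swap_vars i f"
    using descend by simp
  then show ?case using demazure_eq_iff by metis
qed

text \<open>Truncations are lowered one variable at a time; \<open>kill p f = f\<close> expresses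
  that \<open>x_p\<close> does not occur in \<open>f\<close>.\<close>

definition kill :: "nat \<Rightarrow> mpoly \<Rightarrow> mpoly" where
  "kill p = subst (X(p := 0))"

lemma kill_trunc: "kill (Suc t) (trunc (Suc t) f) = trunc t f"
  unfolding kill_def trunc_def subst_subst by (rule arg_cong[of _ _ "\<lambda>g. subst g f"]) auto

lemma kill_trunc_same: "kill (Suc t) (trunc t f) = trunc t f"
  unfolding kill_def trunc_def subst_subst by (rule arg_cong[of _ _ "\<lambda>g. subst g f"]) auto

lemma kill_shift:
  assumes "swap_vars i f = f" "kill (i + 1) f = f"
  shows "kill i f = f"
proof -
  have "swap_vars i (kill i f) = kill (i + 1) (swap_vars i f)"
    unfolding kill_def swap_vars_def subst_subst
    by (rule arg_cong[of _ _ "\<lambda>g. subst g f"]) (auto simp: transpose_def)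
  then have "swap_vars i (kill i f) = f" using assms by simp
  then show ?thesis using assms(1) swap_vars_invol by metis
qed

text \<open>\<open>\<GG>\<^sub>w\<close> is symmetric in \<open>x\<^sub>t\<^sub>+\<^sub>1, x\<^sub>t\<^sub>+\<^sub>2, \<dots>\<close> and does not involve \<open>x\<^sub>N\<^sub>+\<^sub>1\<close>, hence involves none of them.\<close>

lemma trunc_Groth:
  assumes w: "w \<in> S_inf" and asc: "asc_after w t"
  shows "trunc t (Groth w) = Groth w"
proof -
  obtain N where N: "w \<in> S N" "N \<ge> t" using S_infE[OF w] by blast
  have TN: "trunc N (Groth w) = Groth w" using trunc_groth_rel[OF groth_rel_Groth[OF N(1)]] .
  have sym: "swap_vars i (Groth w) = Groth w" if "i > t" for i
    using demazure_Groth_ascent[OF w, of i] asc that demazure_fixed_iff by (auto simp: asc_after_def)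
  have kill: "kill p (Groth w) = Groth w" if "p \<le> Suc N" "t < p" for p
    using that
  proof (induction rule: inc_induct)
    case base
    then show ?case using kill_trunc_same[of N "Groth w"] TN by simp
  next
    case (step p)
    then show ?case using kill_shift[of p] sym by simp
  qed
  have "trunc s (Groth w) = Groth w" if "s \<le> N" "t \<le> s" for s
    using that
  proof (induction rule: inc_induct)
    case base
    then show ?case using TN by simp
  next
    case (step s)
    then show ?case using kill_trunc[of s "Groth w"] kill[of "Suc s"] by simp
  qed
  then show ?thesis using N by simp
qed

lemma last_descent_le_iff:
  assumes "w \<in> S_inf"
  shows "last_descent w \<le> t \<longleftrightarrow> asc_after w t"
proof -
  obtain N where N: "w \<in> S N" using assms by (auto simp: S_inf_def)
  let ?A = "{l. 1 \<le> l \<and> w l > w (l + 1)}"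
  have "?A \<subseteq> {..N}"
  proof
    fix l assume "l \<in> ?A"
    then have "(l, l + 1) \<in> inversions w" by (auto simp: inversions_def)
    then show "l \<in> {..N}" using inversions_subset[OF N] by auto
  qed
  then have fin: "finite (insert 0 ?A)" using finite_subset by auto
  have "last_descent w \<le> t \<longleftrightarrow> (\<forall>l\<in>insert 0 ?A. l \<le> t)"
    unfolding last_descent_def using fin by (intro Max_le_iff) auto
  also have "\<dots> \<longleftrightarrow> (\<forall>l. 1 \<le> l \<and> w l > w (l + 1) \<longrightarrow> l \<le> t)" by simp
  also have "\<dots> \<longleftrightarrow> asc_after w t"
    unfolding asc_after_def
  proof (intro iffI allI impI)
    fix p assume *: "\<forall>l. 1 \<le> l \<and> w l > w (l + 1) \<longrightarrow> l \<le> t" and "p > t"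
    then have "\<not> (1 \<le> p \<and> w p > w (p + 1))" using not_le by blast
    then have "\<not> w p > w (p + 1)" using \<open>p > t\<close> by auto
    then show "w p < w (p + 1)" using S_inf_eq_iff[OF assms, of p "p + 1"] by simp
  next
    fix l assume *: "\<forall>p>t. w p < w (p + 1)" and "1 \<le> l \<and> w l > w (l + 1)"
    then show "l \<le> t" by (meson not_le less_asym)
  qed
  finally show ?thesis .
qed

lemma corner_last_descent:
  assumes "corner w l k"
  shows "last_descent w = l"
proof -
  note c = cornerD[OF assms]
  have "last_descent w \<le> l" using last_descent_le_iff[OF c(1)] c(4) by simp
  moreover have "\<not> last_descent w \<le> l - 1"
  proof
    assume "last_descent w \<le> l - 1"
    then have "w l < w (l + 1)" using last_descent_le_iff[OF c(1)] c(2) by (auto simp: asc_after_def)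
    then show False using c(7)[of "l + 1"] c(3) by simp
  qed
  ultimately show ?thesis by linarith
qed

section \<open>Leaves of the tree\<close>

lemma KT_vertex_Nil: "KT_vertex t \<beta> [] a \<longleftrightarrow> a = Some \<beta>"
  by (auto intro: KT_vertex.root elim: KT_vertex.cases)

text \<open>The inductive definition lengthens addresses at the end, whereas the sum over leaves
  recurses from the root. This decomposes the same tree at its first edge.\<close>

lemma KT_vertex_Cons:
  "KT_vertex t \<beta> (I # \<nu>) a \<longleftrightarrow> t < last_descent \<beta> \<and>
    ((I \<noteq> {} \<and> I \<subseteq> pivot_rows \<beta> \<and> KT_vertex t (K_march \<beta> I) \<nu> a) \<or>
     (I = {} \<and> pivot_rows \<beta> = {} \<and> \<nu> = [] \<and> a = None))" (is "_ \<longleftrightarrow> ?R I \<nu> a")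
proof
  have "case \<mu> of [] \<Rightarrow> a = Some \<beta> | I # \<nu> \<Rightarrow> ?R I \<nu> a" if "KT_vertex t \<beta> \<mu> a" for \<mu>
    using that
  proof (induction rule: KT_vertex.induct)
    case root
    then show ?case by simp
  next
    case (march \<mu> \<pi> J)
    then show ?case
      by (cases \<mu>) (auto intro: KT_vertex.root KT_vertex.march)
  next
    case (no_pivots \<mu> \<pi>)
    then show ?case
      by (cases \<mu>) (auto intro: KT_vertex.no_pivots)
  qed
  then show "?R I \<nu> a" if "KT_vertex t \<beta> (I # \<nu>) a" using that by force
next
  assume R: "?R I \<nu> a"
  show "KT_vertex t \<beta> (I # \<nu>) a"
  proof (cases "I = {}")
    case True
    then show ?thesis using R KT_vertex.no_pivots[OF KT_vertex.root, of t \<beta>] by simp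
  next
    case False
    then have I: "t < last_descent \<beta>" "I \<noteq> {}" "I \<subseteq> pivot_rows \<beta>" "KT_vertex t (K_march \<beta> I) \<nu> a"
      using R by auto
    show ?thesis using I(4)
    proof (induction rule: KT_vertex.induct)
      case root
      show ?case using KT_vertex.march[OF KT_vertex.root I(1-3)] by simp
    next
      case (march \<nu> \<pi> J)
      then show ?case using KT_vertex.march[of t \<beta> "I # \<nu>" \<pi> J] by simp
    next
      case (no_pivots \<nu> \<pi>)
      then show ?case using KT_vertex.no_pivots[of t \<beta> "I # \<nu>" \<pi>] by simp
    qed
  qed
qed

section \<open>Leaves labelled by permutations\<close>

definition perm_leaves :: "nat \<Rightarrow> (nat \<Rightarrow> nat) \<Rightarrow> (nat set list \<times> (nat \<Rightarrow> nat) option) set" where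
  "perm_leaves t \<beta> = {v. v \<in> KT_leaves t \<beta> \<and> snd v \<noteq> None}"

lemma KT_leaves_trivial:
  assumes "last_descent \<beta> \<le> t"
  shows "KT_leaves t \<beta> = {([], Some \<beta>)}"
proof -
  have "KT_vertex t \<beta> \<nu> a \<longleftrightarrow> \<nu> = [] \<and> a = Some \<beta>" for \<nu> a
    using assms by (cases \<nu>) (auto simp: KT_vertex_Nil KT_vertex_Cons)
  then show ?thesis using assms by (auto simp: KT_leaves_def)
qed

lemma KT_leaves_step:
  assumes "t < last_descent \<beta>"
  shows "KT_leaves t \<beta> = (\<Union>I\<in>Pow (pivot_rows \<beta>) - {{}}. map_prod (Cons I) id ` KT_leaves t (K_march \<beta> I))
    \<union> (if pivot_rows \<beta> = {} then {([{}], None)} else {})"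
proof (intro set_eqI)
  fix x :: "nat set list \<times> (nat \<Rightarrow> nat) option"
  obtain \<nu> a where x: "x = (\<nu>, a)" by (cases x)
  show "x \<in> KT_leaves t \<beta> \<longleftrightarrow> x \<in> (\<Union>I\<in>Pow (pivot_rows \<beta>) - {{}}. map_prod (Cons I) id ` KT_leaves t (K_march \<beta> I))
    \<union> (if pivot_rows \<beta> = {} then {([{}], None)} else {})"
  proof (cases \<nu>)
    case Nil
    then show ?thesis using assms by (auto simp: KT_leaves_def KT_vertex_Nil x)
  next
    case (Cons I \<mu>)
    have "(\<nu>, a) \<in> map_prod (Cons J) id ` KT_leaves t (K_march \<beta> J) \<longleftrightarrow> J = I \<and> (\<mu>, a) \<in> KT_leaves t (K_march \<beta> I)" for J
      by (auto simp: Cons intro!: rev_image_eqI)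
    then show ?thesis
      unfolding x UnE using assms by (auto simp: KT_leaves_def KT_vertex_Cons Cons)
  qed
qed

lemma perm_leaves_step:
  assumes "t < last_descent \<beta>"
  shows "perm_leaves t \<beta> = (\<Union>I\<in>Pow (pivot_rows \<beta>) - {{}}. map_prod (Cons I) id ` perm_leaves t (K_march \<beta> I))"
proof -
  have *: "{v. v \<in> (\<Union>I\<in>A. f I ` K I) \<union> Y \<and> snd v \<noteq> None} = (\<Union>I\<in>A. f I ` {v. v \<in> K I \<and> snd v \<noteq> None})"
    if "\<And>I v. snd (f I v) = snd v" "\<And>y. y \<in> Y \<Longrightarrow> snd y = None"
    for f :: "nat set \<Rightarrow> nat set list \<times> (nat \<Rightarrow> nat) option \<Rightarrow> nat set list \<times> (nat \<Rightarrow> nat) option" and A K Y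
    using that by fastforce
  show ?thesis
    unfolding perm_leaves_def KT_leaves_step[OF assms] by (rule *) (auto split: if_splits)
qed

text \<open>Finiteness is carried along in the induction, since splitting the sum over the children
  relies on it.\<close>

lemma truncation_leaves:
  assumes "w \<in> S_inf"
  shows "finite (KT_leaves t w) \<and> trunc t (Groth w) =
    (\<Sum>v\<in>perm_leaves t w. neg_one_power (int (len w) - int (len (label v))) * Groth (label v))"
  using assms
proof (induction w rule: corner_induct)
  case id
  have "last_descent id \<le> t" unfolding last_descent_def by simp
  then have "KT_leaves t id = {([], Some id)}" by (rule KT_leaves_trivial)
  moreover from this have "perm_leaves t id = {([], Some id)}" by (auto simp: perm_leaves_def)
  ultimately have "finite (KT_leaves t id) \<and> trunc t (Groth id) =
    (\<Sum>v\<in>perm_leaves t id. neg_one_power (int (len id) - int (len (label v))) * Groth (label v))"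
    by (simp add: Groth_id neg_one_power_eq)
  then show ?case .
next
  case (step w l k)
  note cor = step.hyps
  note c = cornerD[OF cor] and s = corner_swap[OF cor] and ld = corner_last_descent[OF cor]
  show ?case
  proof (cases "l \<le> t")
    case True
    then have "KT_leaves t w = {([], Some w)}" using ld by (intro KT_leaves_trivial) simp
    moreover from this have "perm_leaves t w = {([], Some w)}" by (auto simp: perm_leaves_def)
    moreover have "trunc t (Groth w) = Groth w"
      using True ld last_descent_le_iff[OF c(1)] by (intro trunc_Groth[OF c(1)]) simp
    ultimately show ?thesis by (simp add: neg_one_power_eq)
  next
    case False
    then have tl: "t < last_descent w" using ld by simp
    let ?v = "w \<circ> tr l k"
    let ?P = "pivs ?v l"
    let ?u = "\<lambda>I. chain ?v l (sorted_list_of_set I)"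
    \<comment> \<open>Without pivots \<open>?A\<close> is empty: the truncation is \<open>0\<close>,
      in accordance with a single leaf labelled \<open>\<emptyset>\<close>.\<close>
    let ?A = "Pow ?P - {{}}"
    have piv: "pivot_rows w = ?P" using pivot_rows_corner[OF cor] .
    have finA: "finite ?A" using pivs_finite by simp
    have K: "K_march w I = ?u I" if "I \<in> ?A" for I
      using K_march_eq[OF cor, of I] that piv by simp
    have IH: "finite (KT_leaves t (?u I)) \<and> trunc t (Groth (?u I)) =
      (\<Sum>v\<in>perm_leaves t (?u I). neg_one_power (int (len (?u I)) - int (len (label v))) * Groth (label v))"
      if "I \<in> ?A" for I
    proof -
      have "I \<subseteq> ?P" using that by blast
      note u = pivs_chain[OF cor this]
      show ?thesis by (rule step.IH[OF u])
    qed
    note IH = conjunct1[OF IH] conjunct2[OF IH]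
    have leaves: "KT_leaves t w = (\<Union>I\<in>?A. map_prod (Cons I) id ` KT_leaves t (?u I))
      \<union> (if ?P = {} then {([{}], None)} else {})"
      using KT_leaves_step[OF tl] K unfolding piv by simp
    have fin: "finite (KT_leaves t w)" unfolding leaves using finA IH(1) by simp
    have rl: "perm_leaves t w = (\<Union>I\<in>?A. map_prod (Cons I) id ` perm_leaves t (?u I))"
      using perm_leaves_step[OF tl] K unfolding piv by simp
    have finr: "finite (perm_leaves t (?u I))" if "I \<in> ?A" for I
      using IH(1)[OF that] by (simp add: perm_leaves_def)
    let ?g = "\<lambda>z v. neg_one_power (int (len z) - int (len (label v))) * Groth (label v)"
    have inj: "inj_on (map_prod (Cons I) id) B" for I :: "nat set" and B :: "(nat set list \<times> (nat \<Rightarrow> nat) option) set"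
      by (auto intro!: inj_onI)
    \<comment> \<open>Leaves below different children are distinct, because their addresses start
      with different sets.\<close>
    have "(\<Sum>v\<in>perm_leaves t w. ?g w v) = (\<Sum>I\<in>?A. \<Sum>v\<in>map_prod (Cons I) id ` perm_leaves t (?u I). ?g w v)"
      unfolding rl using finA finr by (intro sum.UNION_disjoint) auto
    also have "\<dots> = (\<Sum>I\<in>?A. - ((- 1) ^ card I) * trunc t (Groth (?u I)))"
    proof (rule sum.cong[OF refl])
      fix I assume I: "I \<in> ?A"
      have "(\<Sum>v\<in>map_prod (Cons I) id ` perm_leaves t (?u I). ?g w v) = (\<Sum>v\<in>perm_leaves t (?u I). ?g w v)"
        unfolding sum.reindex[OF inj] by (rule sum.cong) auto
      also have "\<dots> = (\<Sum>v\<in>perm_leaves t (?u I). - ((- 1) ^ card I) * ?g (?u I) v)"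
      proof (rule sum.cong[OF refl])
        fix v :: "nat set list \<times> (nat \<Rightarrow> nat) option"
        have "neg_one_power (int (len w) - int (len (label v))) =
          neg_one_power (int (len w) - int (len (?u I))) * neg_one_power (int (len (?u I)) - int (len (label v)))"
          unfolding neg_one_power_add[symmetric] by simp
        then show "?g w v = - ((- 1) ^ card I) * ?g (?u I) v"
          using neg_one_power_chain[OF cor, of I] I by (simp add: mult.assoc)
      qed
      also have "\<dots> = - ((- 1) ^ card I) * trunc t (Groth (?u I))"
        unfolding IH(2)[OF I] by (simp add: sum_distrib_left)
      finally show "(\<Sum>v\<in>map_prod (Cons I) id ` perm_leaves t (?u I). ?g w v) =
        - ((- 1) ^ card I) * trunc t (Groth (?u I))" .
    qed
    also have "\<dots> = trunc t (Groth w)"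
    proof -
      have "cover_diffs l [1..<l] Groth ?v = (\<Sum>I\<in>Pow ?P. (- 1) ^ card I * Groth (?u I))"
        using cover_diffs_expand[of 1 ?v l Groth] s(1) c(2) by (simp add: pivs_def)
      also have "Pow ?P = insert {} ?A" by auto
      also have "(\<Sum>I\<in>insert {} ?A. (- 1) ^ card I * Groth (?u I)) = Groth ?v + (\<Sum>I\<in>?A. (- 1) ^ card I * Groth (?u I))"
        using finA by (subst sum.insert) auto
      finally have cover_diffs: "cover_diffs l [1..<l] Groth ?v = Groth ?v + (\<Sum>I\<in>?A. (- 1) ^ card I * Groth (?u I))" .
      have "trunc t (1 - X l) = 1" using False by simp
      then have "trunc t (Groth w) = trunc t (Groth ?v) - trunc t (cover_diffs l [1..<l] Groth ?v)"
        using arg_cong[OF transition[OF cor], of "trunc t"] by (simp only: trunc_hom(1,2) mult_1_left)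
      also have "\<dots> = - (\<Sum>I\<in>?A. (- 1) ^ card I * trunc t (Groth (?u I)))"
        unfolding cover_diffs by (simp add: trunc_def)
      finally show ?thesis by (simp add: sum_negf)
    qed
    finally show ?thesis using fin by simp
  qed
qed

section \<open>Factorization\<close>

lemma star_S:
  assumes "\<sigma> \<in> S n" "\<alpha> \<in> S n"
  shows "star n \<sigma> \<alpha> \<in> S (2 * n)"
proof -
  have s: "\<sigma> \<in> S_inf" and a: "\<alpha> \<in> S_inf" using assms S_subset_S_inf by auto
  have maps: "star n \<sigma> \<alpha> ` {1..2 * n} \<subseteq> {1..2 * n}"
  proof
    fix y assume "y \<in> star n \<sigma> \<alpha> ` {1..2 * n}"
    then obtain x where x: "1 \<le> x" "x \<le> 2 * n" "y = star n \<sigma> \<alpha> x" by auto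
    then show "y \<in> {1..2 * n}"
      using S_inside[OF assms(1), of x] S_inside[OF assms(2), of "x - n"] by (auto simp: star_def)
  qed
  have "inj_on (star n \<sigma> \<alpha>) {1..2 * n}"
  proof (rule inj_onI)
    fix x y assume x: "x \<in> {1..2 * n}" and y: "y \<in> {1..2 * n}" and eq: "star n \<sigma> \<alpha> x = star n \<sigma> \<alpha> y"
    have low: "star n \<sigma> \<alpha> z \<le> n \<longleftrightarrow> z \<le> n" if "z \<in> {1..2 * n}" for z
      using that S_inside[OF assms(1), of z] S_inf_ge_1[OF a, of "z - n"] by (auto simp: star_def)
    show "x = y"
    proof (cases "x \<le> n")
      case True
      then show ?thesis using low[OF x] low[OF y] eq S_inf_eq_iff[OF s, of x y] by (simp add: star_def)
    next
      case False
      then have "y > n" using low[OF x] low[OF y] eq by simp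
      then show ?thesis using False eq S_inf_eq_iff[OF a, of "x - n" "y - n"] by (simp add: star_def)
    qed
  qed
  then have "bij_betw (star n \<sigma> \<alpha>) {1..2 * n} {1..2 * n}"
    using maps by (simp add: bij_betw_def endo_inj_surj)
  moreover have "star n \<sigma> \<alpha> x = x" if "x \<notin> {1..2 * n}" for x
    using that S_inf_0[OF s] S_outside[OF assms(2), of "x - n"] by (cases "x = 0") (auto simp: star_def)
  ultimately show ?thesis unfolding S_def by (auto intro: bij_imp_permutes)
qed

text \<open>The values in the first block are at most \<open>n\<close>, those in the second block
  exceed \<open>n\<close>; no inversion joins the two.\<close>

lemma len_star:
  assumes "\<sigma> \<in> S n" "\<alpha> \<in> S n"
  shows "len (star n \<sigma> \<alpha>) = len \<sigma> + len \<alpha>"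
proof -
  let ?sh = "map_prod ((+) n) ((+) n)"
  have sub: "inversions \<sigma> \<subseteq> {1..n} \<times> {1..n}" using inversions_subset[OF assms(1)] .
  have "inversions (star n \<sigma> \<alpha>) = inversions \<sigma> \<union> ?sh ` inversions \<alpha>"
  proof (intro set_eqI iffI)
    fix z assume z: "z \<in> inversions (star n \<sigma> \<alpha>)"
    obtain p q where pq: "z = (p, q)" by (cases z)
    have p: "1 \<le> p" "p < q" "star n \<sigma> \<alpha> p > star n \<sigma> \<alpha> q" using z pq by (auto simp: inversions_def)
    consider "q \<le> n" | "p \<le> n" "n < q" | "n < p" by linarith
    then show "z \<in> inversions \<sigma> \<union> ?sh ` inversions \<alpha>"
    proof cases
      case 1
      then show ?thesis using p by (auto simp: pq inversions_def star_def)
    next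
      case 2
      then show ?thesis using p S_inside[OF assms(1), of p] by (auto simp: star_def)
    next
      case 3
      then have "(p - n, q - n) \<in> inversions \<alpha>" using p by (auto simp: inversions_def star_def)
      moreover have "z = ?sh (p - n, q - n)" using 3 p pq by simp
      ultimately show ?thesis by blast
    qed
  next
    fix z assume "z \<in> inversions \<sigma> \<union> ?sh ` inversions \<alpha>"
    then show "z \<in> inversions (star n \<sigma> \<alpha>)"
    proof
      assume "z \<in> inversions \<sigma>"
      then show ?thesis using sub by (auto simp: inversions_def star_def)
    next
      assume "z \<in> ?sh ` inversions \<alpha>"
      then show ?thesis by (auto simp: inversions_def star_def)
    qed
  qed
  moreover have "inversions \<sigma> \<inter> ?sh ` inversions \<alpha> = {}" using sub by (auto simp: inversions_def)
  moreover have "card (?sh ` inversions \<alpha>) = card (inversions \<alpha>)"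
    by (rule card_image) (auto intro!: inj_onI)
  ultimately show ?thesis
    unfolding len_inversions using finite_inversions[OF S_subset_S_inf] assms by (simp add: card_Un_disjoint)
qed

section \<open>Exchanges within the first block\<close>

lemma star_comp_tr:
  assumes "1 \<le> a" "a \<le> n" "1 \<le> b" "b \<le> n"
  shows "star n \<sigma> \<alpha> \<circ> tr a b = star n (\<sigma> \<circ> tr a b) \<alpha>"
  using assms by (auto simp: fun_eq_iff star_def transpose_def)

lemma star_chain:
  assumes "\<forall>a\<in>set as. 1 \<le> a \<and> a \<le> n" "1 \<le> l" "l \<le> n"
  shows "chain (star n \<sigma> \<alpha>) l as = star n (chain \<sigma> l as) \<alpha>"
  using assms(1)
proof (induction as arbitrary: \<sigma>)
  case (Cons a as)
  then have "star n \<sigma> \<alpha> \<circ> tr a l = star n (\<sigma> \<circ> tr a l) \<alpha>" using assms by (intro star_comp_tr) auto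
  then show ?case using Cons by simp
qed simp

lemma chain_S:
  assumes "w \<in> S n" "\<forall>a\<in>set as. 1 \<le> a \<and> a \<le> n" "1 \<le> l" "l \<le> n"
  shows "chain w l as \<in> S n"
  using assms(1,2)
proof (induction as arbitrary: w)
  case (Cons a as)
  then show ?case using S_comp_tr[of w n a l] assms(3,4) by simp
qed simp

lemma covers_star: "a \<le> n \<Longrightarrow> l \<le> n \<Longrightarrow> covers (star n \<sigma> \<alpha>) l a \<longleftrightarrow> covers \<sigma> l a"
  by (auto simp: covers_def star_def)

text \<open>The transition for \<open>\<sigma>\<close> takes place in positions up to
  \<open>n\<close>, where \<open>star n \<sigma> \<alpha>\<close> has the same entries. The block of
  \<open>\<alpha>\<close> lies to the right, has larger values and contributes no cover.\<close>

lemma Groth_star: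
  assumes "\<sigma> \<in> S n" "\<alpha> \<in> S n"
  shows "Groth (star n \<sigma> \<alpha>) = Groth \<sigma> * Groth (star n id \<alpha>)"
proof -
  have "\<sigma> \<in> S_inf" using assms(1) by (rule S_subset_S_inf)
  then show ?thesis using assms(1)
  proof (induction \<sigma> rule: corner_induct)
    case id
    have "Groth (star n id \<alpha>) = Groth id * Groth (star n id \<alpha>)" by (simp only: Groth_id mult_1_left)
    then show ?case .
  next
    case (step \<sigma> l k)
    note cor = step.hyps
    note c = cornerD[OF cor] and s = corner_swap[OF cor]
    let ?v = "\<sigma> \<circ> tr l k"
    let ?P = "pivs ?v l"
    let ?u = "\<lambda>I. chain ?v l (sorted_list_of_set I)"
    let ?G = "Groth (star n id \<alpha>)"
    have "(l, k) \<in> inversions \<sigma>" using c by (auto simp: inversions_def)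
    then have ln: "l \<le> n" "k \<le> n" using inversions_subset[OF step.prems] by auto
    have v: "?v \<in> S n" using step.prems c ln by (intro S_comp_tr) auto
    have sv: "star n ?v \<alpha> \<in> S_inf" using star_S[OF v assms(2)] by (rule S_subset_S_inf)
    have eq: "star n \<sigma> \<alpha> = star n ?v \<alpha> \<circ> tr l k"
      using star_comp_tr[of l n k ?v \<alpha>] c ln by simp
    have "Groth (star n ?v \<alpha> \<circ> tr l k) = Groth (star n ?v \<alpha>) - (1 - X l) * cover_diffs l [1..<l] Groth (star n ?v \<alpha>)"
    proof (rule transition_covers[OF sv c(2,3)])
      fix q assume q: "l < q"
      show "covers (star n ?v \<alpha>) l q \<longleftrightarrow> q = k"
      proof (cases "q \<le> n")
        case True
        then show ?thesis using covers_star ln corner_covers[OF cor q] by simp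
      next
        case False
        \<comment> \<open>Position \<open>k\<close> lies between \<open>l\<close> and
          \<open>q\<close>, and so does its entry between theirs.\<close>
        have "star n ?v \<alpha> l < star n ?v \<alpha> k" using ln s c(5) by (simp add: star_def)
        moreover have "1 \<le> \<alpha> (q - n)" using S_inf_ge_1[OF S_subset_S_inf[OF assms(2)], of "q - n"] False by simp
        then have "star n ?v \<alpha> k < star n ?v \<alpha> q"
          using ln False S_inside[OF v, of k] c(3) by (simp add: star_def)
        ultimately have "\<not> covers (star n ?v \<alpha>) l q" using q ln False c(3) unfolding covers_def by auto
        then show ?thesis using False ln by auto
      qed
      show "star n ?v \<alpha> q < star n ?v \<alpha> k" if "q < k"
        using asc_afterD[OF s(5) q that] ln that by (simp add: star_def)
    qed
    moreover have "cover_diffs l [1..<l] Groth (star n ?v \<alpha>) = cover_diffs l [1..<l] Groth ?v * ?G"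
    proof -
      have sub: "\<forall>a\<in>set (sorted_list_of_set I). 1 \<le> a \<and> a \<le> n" if "I \<in> Pow ?P" for I
        using that pivs_finite finite_subset[of I ?P] ln by (auto simp: pivs_def)
      have P: "{p. 1 \<le> p \<and> p < l \<and> covers (star n ?v \<alpha>) l p} = ?P"
        using covers_star[of _ n l ?v \<alpha>] ln by (auto simp: pivs_def)
      have "cover_diffs l [1..<l] Groth (star n ?v \<alpha>) = (\<Sum>I\<in>Pow ?P. (- 1) ^ card I * Groth (chain (star n ?v \<alpha>) l (sorted_list_of_set I)))"
        using cover_diffs_expand[of 1 "star n ?v \<alpha>" l Groth] sv c(2) unfolding P by simp
      also have "\<dots> = (\<Sum>I\<in>Pow ?P. (- 1) ^ card I * Groth (?u I) * ?G)"
      proof (rule sum.cong[OF refl])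
        fix I assume I: "I \<in> Pow ?P"
        have "?u I \<in> S n" using chain_S[OF v sub[OF I] c(2) ln(1)] .
        then have "Groth (star n (?u I) \<alpha>) = Groth (?u I) * ?G"
          using step.IH pivs_chain[OF cor, of I] I by blast
        then show "(- 1) ^ card I * Groth (chain (star n ?v \<alpha>) l (sorted_list_of_set I)) = (- 1) ^ card I * Groth (?u I) * ?G"
          using star_chain[OF sub[OF I] c(2) ln(1)] by (simp add: mult.assoc)
      qed
      also have "\<dots> = cover_diffs l [1..<l] Groth ?v * ?G"
        using cover_diffs_expand[of 1 ?v l Groth] s(1) c(2) by (simp add: pivs_def sum_distrib_right)
      finally show ?thesis .
    qed
    moreover have "Groth (star n ?v \<alpha>) = Groth ?v * ?G"
      by (rule step.IH[OF s(1,5) _ v]) (use s(2,3) c(5) in simp)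
    ultimately have "Groth (star n \<sigma> \<alpha>) = (Groth ?v - (1 - X l) * cover_diffs l [1..<l] Groth ?v) * ?G"
      unfolding eq by (simp only: left_diff_distrib mult.assoc)
    then show ?case unfolding transition[OF cor, symmetric] .
  qed
qed

text \<open>Finiteness of the set of leaves is part of the claim because a sum over an infinite set
  is \<open>0\<close> by convention.\<close>

theorem theorem3:
  shows "(\<forall>\<gamma>\<in>S_inf. \<forall>t\<ge>1.
            finite (KT_leaves t \<gamma>) \<and>
            trunc t (Groth \<gamma>) =
              (\<Sum>v | v \<in> KT_leaves t \<gamma> \<and> snd v \<noteq> None.
                 neg_one_power (int (len \<gamma>) - int (len (label v))) * Groth (label v)))
       \<and> (\<forall>n. \<forall>t\<ge>1. \<forall>\<sigma>\<in>S n. \<forall>\<alpha>\<in>S n. last_descent \<sigma> \<le> t \<longrightarrow>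
            finite (KT_leaves t (star n \<sigma> \<alpha>)) \<and>
            Groth \<sigma> * trunc t (Groth (star n id \<alpha>)) =
              (\<Sum>v | v \<in> KT_leaves t (star n \<sigma> \<alpha>) \<and> snd v \<noteq> None.
                 neg_one_power (int (len \<sigma>) + int (len \<alpha>) - int (len (label v)))
                   * Groth (label v)))"
proof (intro conjI[of "\<forall>\<gamma>\<in>S_inf. _ \<gamma>"] ballI allI impI)
  fix \<gamma> t assume "\<gamma> \<in> S_inf"
  then show "finite (KT_leaves t \<gamma>) \<and> trunc t (Groth \<gamma>) =
      (\<Sum>v | v \<in> KT_leaves t \<gamma> \<and> snd v \<noteq> None.
         neg_one_power (int (len \<gamma>) - int (len (label v))) * Groth (label v))"
    using truncation_leaves[of \<gamma> t] by (simp only: perm_leaves_def)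
next
  fix n t \<sigma> \<alpha> assume \<sigma>: "\<sigma> \<in> S n" and \<alpha>: "\<alpha> \<in> S n" and ld: "last_descent \<sigma> \<le> t"
  have "\<sigma> \<in> S_inf" using \<sigma> by (rule S_subset_S_inf)
  \<comment> \<open>\<open>trunc t\<close> is multiplicative and fixes
    \<open>Groth \<sigma>\<close>, so the second part is the first one for the star product.\<close>
  then have "Groth \<sigma> * trunc t (Groth (star n id \<alpha>)) = trunc t (Groth (star n \<sigma> \<alpha>))"
    using Groth_star[OF \<sigma> \<alpha>] trunc_Groth[of \<sigma> t] last_descent_le_iff[of \<sigma> t] ld by simp
  moreover have "star n \<sigma> \<alpha> \<in> S_inf" using star_S[OF \<sigma> \<alpha>] by (rule S_subset_S_inf)
  ultimately show "finite (KT_leaves t (star n \<sigma> \<alpha>)) \<and>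
      Groth \<sigma> * trunc t (Groth (star n id \<alpha>)) =
        (\<Sum>v | v \<in> KT_leaves t (star n \<sigma> \<alpha>) \<and> snd v \<noteq> None.
           neg_one_power (int (len \<sigma>) + int (len \<alpha>) - int (len (label v))) * Groth (label v))"
    using truncation_leaves[of "star n \<sigma> \<alpha>" t] len_star[OF \<sigma> \<alpha>] by (simp only: perm_leaves_def of_nat_add)
qed

end
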